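(* Let $\mu$ be a probability measure on $\mathbb R^d$ and let $\sigma^2>0$ and $C_{\rm SG}<\infty$ be constants such that $$\iint\exp\Bigl(\frac{\|x-x'\|^2}{\sigma^2}\Bigr)\,d\mu(x)\,d\mu(x')\le C_{\rm SG}.$$ Let $t>\sigma^2$ and let $\gamma_{0,t}$ be the centered Gaussian measure on $\mathbb R^d$ with covariance $tI_d$. Then $\mu*\gamma_{0,t}$ satisfies both a Poincaré inequality and a log-Sobolev inequality, with $$C_{\rm P}(\mu*\gamma_{0,t})\le t\,\Bigl\{\frac{t}{t-\sigma^2}+C_{\rm SG}^{\sigma^2/(t-\sigma^2)}\Bigr\}$$ and $$C_{\rm LS}(\mu*\gamma_{0,t})\le 3t\,\Bigl\{\frac{t}{t-\sigma^2}+C_{\rm SG}^{\sigma^2/(t-\sigma^2)}\Bigr\}\Bigl\{1+\frac{\sigma^2}{t-\sigma^2}\log C_{\rm SG}\Bigr\}.$$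
   Context: For a probability measure $\rho$ on $\mathbb R^d$ and $f$ ranging over $C_{\rm b}^\infty(\mathbb R^d)$ (bounded, infinitely differentiable functions all of whose derivatives are bounded): $C_{\rm P}(\rho)$ is the smallest constant $C$ with $\operatorname{var}_\rho(f)\le C\,\mathbb E_\rho\|\nabla f\|^2$ for all $f$, and $C_{\rm LS}(\rho)$ is the smallest constant $C$ with $\operatorname{ent}_\rho(f^2)\le 2C\,\mathbb E_\rho\|\nabla f\|^2$ for all $f$, where for $g\ge 0$, $\operatorname{ent}_\rho(g)=\mathbb E_\rho(g\log g)-\mathbb E_\rho g\,\log\mathbb E_\rho g$, with $0\log 0=0$. The measure $\rho$ satisfies a Poincaré (resp. log-Sobolev) inequality if $C_{\rm P}(\rho)<\infty$ (resp. $C_{\rm LS}(\rho)<\infty$). *)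

theory Defs
  imports "HOL-Probability.Probability"
begin

definition partial_deriv :: "'n::finite \<Rightarrow> (real^'n \<Rightarrow> real) \<Rightarrow> real^'n \<Rightarrow> real" where
  "partial_deriv i f x = frechet_derivative f (at x) (axis i 1)"

definition grad :: "(real^'n \<Rightarrow> real) \<Rightarrow> real^'n \<Rightarrow> real^'n::finite" where
  "grad f x = (\<chi> i. partial_deriv i f x)"

fun iter_partial :: "'n::finite list \<Rightarrow> (real^'n \<Rightarrow> real) \<Rightarrow> real^'n \<Rightarrow> real" where
  "iter_partial [] f = f"
| "iter_partial (i # is) f = partial_deriv i (iter_partial is f)"

text \<open>
  The value of \<^const>\<open>frechet_derivative\<close> is unspecified where the function is not
  differentiable, hence the explicit requirement that every iterated partial derivative is
  (totally) differentiable everywhere. Since differentiability of all iterated partial derivatives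
  implies their continuity, this is infinite differentiability in the usual sense.
\<close>

definition Cb_infty :: "(real^'n::finite \<Rightarrow> real) set" where
  "Cb_infty = {f. \<forall>is. (\<forall>x. iter_partial is f differentiable (at x)) \<and>
                       bounded (range (iter_partial is f))}"

definition var_of :: "'a measure \<Rightarrow> ('a \<Rightarrow> real) \<Rightarrow> real" where
  "var_of \<rho> f = (\<integral>x. (f x - (\<integral>y. f y \<partial>\<rho>))\<^sup>2 \<partial>\<rho>)"

text \<open>The convention \<open>0 log 0 = 0\<close> is automatic, as the factor \<open>g x\<close> vanishes.\<close>

definition ent_of :: "'a measure \<Rightarrow> ('a \<Rightarrow> real) \<Rightarrow> real" where
  "ent_of \<rho> g = (\<integral>x. g x * ln (g x) \<partial>\<rho>) - (\<integral>x. g x \<partial>\<rho>) * ln (\<integral>x. g x \<partial>\<rho>)"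

definition poincare_with :: "(real^'n::finite) measure \<Rightarrow> real \<Rightarrow> bool" where
  "poincare_with \<rho> C \<longleftrightarrow>
     (\<forall>f\<in>Cb_infty. var_of \<rho> f \<le> C * (\<integral>x. (norm (grad f x))\<^sup>2 \<partial>\<rho>))"

definition log_sobolev_with :: "(real^'n::finite) measure \<Rightarrow> real \<Rightarrow> bool" where
  "log_sobolev_with \<rho> C \<longleftrightarrow>
     (\<forall>f\<in>Cb_infty. ent_of \<rho> (\<lambda>x. (f x)\<^sup>2) \<le> 2 * C * (\<integral>x. (norm (grad f x))\<^sup>2 \<partial>\<rho>))"

text \<open>
  The optimal constants are extended reals, with value \<open>\<infinity>\<close> if there is no admissible constant.
  The two lemmas below show that a finite infimum is attained, so it is the smallest admissible
  constant.
\<close>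

definition poincare_const :: "(real^'n::finite) measure \<Rightarrow> ereal" where
  "poincare_const \<rho> = (INF C\<in>{C. poincare_with \<rho> C}. ereal C)"

definition log_sobolev_const :: "(real^'n::finite) measure \<Rightarrow> ereal" where
  "log_sobolev_const \<rho> = (INF C\<in>{C. log_sobolev_with \<rho> C}. ereal C)"

lemma INF_ereal_le_iff_attained:
  assumes closed: "\<And>C. P C \<longleftrightarrow> (\<forall>f\<in>F. a f \<le> C * b f)"
    and nonneg: "\<And>f. f \<in> F \<Longrightarrow> 0 \<le> (b f :: real)"
  shows "(INF C\<in>{C. P C}. ereal C) \<le> ereal K \<longleftrightarrow> P K"
proof
  assume le: "(INF C\<in>{C. P C}. ereal C) \<le> ereal K"
  show "P K"
    unfolding closed
  proof
    fix f assume f: "f \<in> F"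
    show "a f \<le> K * b f"
    proof (rule field_le_epsilon)
      fix e :: real assume e: "0 < e"
      define d where "d = e / (b f + 1)"
      have bf: "0 \<le> b f" by (rule nonneg[OF f])
      with e have d: "0 < d" "d * b f \<le> e"
        by (auto simp: d_def field_simps)
      have "(INF C\<in>{C. P C}. ereal C) < ereal (K + d)"
        using le d by (meson ereal_less_eq(3) le_less_trans less_add_same_cancel1 less_ereal.simps(1))
      then obtain C where C: "P C" "C < K + d"
        by (auto simp: INF_less_iff)
      have "a f \<le> C * b f" using C(1) f closed by blast
      also have "\<dots> \<le> (K + d) * b f" using C(2) bf by (intro mult_right_mono) auto
      also have "\<dots> \<le> K * b f + e" using d(2) by (simp add: algebra_simps)
      finally show "a f \<le> K * b f + e" .
    qed
  qed
qed (auto intro: INF_lower)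

lemma poincare_const_le_iff: "poincare_const \<rho> \<le> ereal C \<longleftrightarrow> poincare_with \<rho> C"
  unfolding poincare_const_def
  by (rule INF_ereal_le_iff_attained[where F = Cb_infty and a = "var_of \<rho>"
        and b = "\<lambda>f. (\<integral>x. (norm (grad f x))\<^sup>2 \<partial>\<rho>)"])
     (auto simp: poincare_with_def)

lemma log_sobolev_const_le_iff: "log_sobolev_const \<rho> \<le> ereal C \<longleftrightarrow> log_sobolev_with \<rho> C"
  unfolding log_sobolev_const_def
  by (rule INF_ereal_le_iff_attained[where F = Cb_infty and a = "\<lambda>f. ent_of \<rho> (\<lambda>x. (f x)\<^sup>2)"
        and b = "\<lambda>f. 2 * (\<integral>x. (norm (grad f x))\<^sup>2 \<partial>\<rho>)"])
     (auto simp: log_sobolev_with_def mult_ac)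

definition satisfies_poincare :: "(real^'n::finite) measure \<Rightarrow> bool" where
  "satisfies_poincare \<rho> \<longleftrightarrow> poincare_const \<rho> < \<infinity>"

definition satisfies_log_sobolev :: "(real^'n::finite) measure \<Rightarrow> bool" where
  "satisfies_log_sobolev \<rho> \<longleftrightarrow> log_sobolev_const \<rho> < \<infinity>"

text \<open>The centered Gaussian measure with covariance matrix \<open>t\<close> times the identity, for \<open>t > 0\<close>.\<close>

definition gaussian :: "real \<Rightarrow> (real^'n::finite) measure" where
  "gaussian t = density lborel
     (\<lambda>x. ennreal (exp (- (norm x)\<^sup>2 / (2 * t)) / (2 * pi * t) powr (real CARD('n) / 2)))"

end

theory Submission
  imports Defs "HOL-Real_Asymp.Real_Asymp"
begin

text \<open>
  Write \<open>P x\<close> for the Gaussian measure with centre \<open>x\<close> and covariance \<open>t\<close> times the identity, so that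
  the convolution is the mixture of the measures \<open>P x\<close> over \<open>x\<close> drawn from \<open>\<mu>\<close>. Put \<open>s = \<sigma>\<^sup>2\<close>, \<open>p = t / s > 1\<close>
  and \<open>w x y = exp ((norm (x - y))\<^sup>2 / t)\<close>. This is the second moment of the density of \<open>P x\<close> with respect
  to \<open>P y\<close>, and the hypothesis bounds the mean of its \<open>p\<close>-th power by \<open>C\<close>. The argument uses the
  Poincare and log-Sobolev inequalities of each component, with constant \<open>t\<close>, and compares the
  components with one another.

  Variance. Let \<open>f\<close> have mean \<open>0\<close> and total variance \<open>V\<close>. Then \<open>V\<close> is the mean of the conditional
  variances \<open>v x\<close> plus half the mean of \<open>(P x f - P y f)\<^sup>2\<close>, for \<open>x\<close> and \<open>y\<close> independent. Cauchy--Schwarz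
  bounds this square by \<open>w x y * v y\<close>, but the weight may be unbounded while \<open>v\<close> is only known
  to be integrable. A second bound, in terms of \<open>V\<close>, has an integrable factor: comparison of both
  means with a third component, averaged, gives \<open>(k x + k y) * V\<close>, where \<open>k x\<close> is the mean of \<open>w x\<close>.
  Interpolating between the two with the exponents \<open>1 - 1 / p\<close> and \<open>1 / p\<close>
  (\<open>interpolate_bounds\<close>) yields only the fraction \<open>V / p\<close>, which is absorbed on the left
  (\<open>centered_mixture_variance_le\<close>).

  Entropy. The entropy of \<open>f\<^sup>2\<close> is the mean conditional entropy plus the entropy over \<open>\<mu>\<close> of
  \<open>g x = P x (f\<^sup>2)\<close>. The same comparison applied to \<open>\<bar>f\<bar>\<close> shows that \<open>ln (g x)\<close> exceeds the logarithm of the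
  mean of \<open>g\<close> by at most \<open>ln (k x)\<close>, up to the conditional entropy. Young's inequality between \<open>g\<close> and
  the logarithm again gives back the fraction \<open>1 / p\<close> of the entropy of \<open>g\<close>, at the price of a
  multiple of \<open>ln C\<close> times the mean of \<open>f\<^sup>2\<close> (\<open>mixture_entropy_le\<close>). For centred \<open>f\<close> that mean is the
  variance, and a form of Rothaus' lemma (\<open>entropy_square_le_centered\<close>) reduces to centred functions.

  The two Gaussian inequalities are proved together, for convex functions \<open>\<phi>\<close> satisfying the
  locale \<open>entropy_function\<close>. The heat flow is cut into \<open>n\<close> steps of length \<open>t / n\<close>. In one step, a
  Taylor expansion and the second moment of the Gaussian measure bound the loss of \<open>\<phi>\<close> by the energy
  density, up to an error of order \<open>3 / 2\<close> in the step length. The energy density is jointly convex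
  in the function and its gradient, so it decreases along the flow. The total error tends to \<open>0\<close> as
  \<open>n\<close> grows (\<open>heat_phi_le\<close>).
\<close>

section \<open>The Gaussian measure\<close>

abbreviation gauss_density :: "real \<Rightarrow> real^'n::finite \<Rightarrow> real" where
  "gauss_density t x \<equiv> exp (- (norm x)\<^sup>2 / (2 * t)) / (2 * pi * t) powr (real CARD('n) / 2)"

lemma norm_power2_eq_sum_Basis:
  fixes x :: "'a::euclidean_space"
  shows "(norm x)\<^sup>2 = (\<Sum>b\<in>Basis. (x \<bullet> b)\<^sup>2)"
  by (metis (no_types, lifting) euclidean_inner power2_eq_square power2_norm_eq_inner sum.cong)

lemma gauss_density_eq_prod_normal_density:
  fixes x :: "real^'n::finite"
  assumes t: "t > 0"
  shows "gauss_density t x = (\<Prod>b\<in>Basis. normal_density 0 (sqrt t) (x \<bullet> b))"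
proof -
  have "(\<Prod>b\<in>Basis. normal_density 0 (sqrt t) (x \<bullet> b))
      = (\<Prod>b\<in>(Basis :: (real^'n) set). 1 / sqrt (2 * pi * t)) * exp (\<Sum>b\<in>Basis. - ((x \<bullet> b)\<^sup>2 / (2 * t)))"
    using t unfolding normal_density_def
    by (simp only: exp_sum[OF finite_Basis] prod.distrib[symmetric]) simp
  also have "(\<Sum>b\<in>Basis. - ((x \<bullet> b)\<^sup>2 / (2 * t))) = - (norm x)\<^sup>2 / (2 * t)"
    by (simp add: norm_power2_eq_sum_Basis sum_negf sum_divide_distrib)
  also have "(\<Prod>b\<in>(Basis :: (real^'n) set). 1 / sqrt (2 * pi * t))
      = 1 / (2 * pi * t) powr (real CARD('n) / 2)"
    using t by (simp add: power_one_over powr_half_sqrt[symmetric] powr_realpow[symmetric] powr_powr)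
  finally show ?thesis by simp
qed

lemma sets_gaussian [simp, measurable_cong]: "sets (gaussian t) = sets borel"
  and space_gaussian [simp]: "space (gaussian t) = UNIV"
  by (simp_all add: gaussian_def)

lemma nn_integral_lborel_translate:
  fixes g :: "'a::euclidean_space \<Rightarrow> ennreal"
  assumes [measurable]: "g \<in> borel_measurable borel"
  shows "(\<integral>\<^sup>+z. g (c + z) \<partial>lborel) = (\<integral>\<^sup>+z. g z \<partial>lborel)"
proof -
  have "(\<integral>\<^sup>+z. g z \<partial>lborel) = (\<integral>\<^sup>+z. g z \<partial>distr lborel borel ((+) c))"
    by (simp add: lborel_distr_plus)
  also have "\<dots> = (\<integral>\<^sup>+z. g (c + z) \<partial>lborel)"
    by (subst nn_integral_distr) auto
  finally show ?thesis by simp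
qed

lemma nn_integral_gauss_density:
  fixes c :: "real^'n::finite"
  assumes t: "t > 0"
  shows "(\<integral>\<^sup>+y. ennreal (gauss_density t (c + y)) \<partial>lborel) = 1"
proof -
  have "(\<integral>\<^sup>+y. ennreal (gauss_density t (c + y)) \<partial>lborel)
      = (\<integral>\<^sup>+y. ennreal (gauss_density t (y :: real^'n)) \<partial>lborel)"
    by (rule nn_integral_lborel_translate) measurable
  also have "\<dots> = (\<integral>\<^sup>+x. (\<Prod>b\<in>Basis. ennreal (normal_density 0 (sqrt t) ((x::real^'n) \<bullet> b))) \<partial>lborel)"
    unfolding gauss_density_eq_prod_normal_density[OF t] by (simp add: prod_ennreal)
  also have "\<dots> = (\<Prod>b\<in>(Basis :: (real^'n) set). (\<integral>\<^sup>+x. ennreal (normal_density 0 (sqrt t) x) \<partial>lborel))"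
    by (subst nn_integral_lborel_prod) auto
  also have "(\<integral>\<^sup>+x. ennreal (normal_density 0 (sqrt t) x) \<partial>lborel) = 1"
    using prob_space.emeasure_space_1[OF prob_space_normal_density[of "sqrt t" 0]] t
    by (simp add: emeasure_density)
  finally show ?thesis by simp
qed

lemma prob_space_gaussian:
  assumes t: "t > 0"
  shows "prob_space (gaussian t :: (real^'n::finite) measure)"
  using nn_integral_gauss_density[OF t, of "0 :: real^'n"]
  by (intro prob_spaceI) (simp add: gaussian_def emeasure_density)

lemma measure_gaussian_UNIV [simp]: "t > 0 \<Longrightarrow> measure (gaussian t) UNIV = 1"
  using prob_space.prob_space[OF prob_space_gaussian] by simp

lemma integral_gaussian:
  fixes F :: "real^'n::finite \<Rightarrow> real"
  assumes [measurable]: "F \<in> borel_measurable borel"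
  shows "(\<integral>x. F x \<partial>gaussian t) = (\<integral>x. gauss_density t x * F x \<partial>lborel)"
  unfolding gaussian_def by (subst integral_density) auto

text \<open>The Cameron--Martin formula. A translation changes only the linear and the constant term of
  the exponent of the density. The formula gives all exponential moments of the Gaussian measure,
  and the relative densities of Gaussian measures with different centres.\<close>

lemma gaussian_shift:
  fixes F :: "real^'n::finite \<Rightarrow> real"
  assumes t: "t > 0" and [measurable]: "F \<in> borel_measurable borel"
  shows "(\<integral>z. F (a + z) \<partial>gaussian t) = (\<integral>z. F z * exp (a \<bullet> z / t - (norm a)\<^sup>2 / (2 * t)) \<partial>gaussian t)"
proof -
  have "(\<integral>z. F (a + z) \<partial>gaussian t) = (\<integral>z. gauss_density t z * F (a + z) \<partial>lborel)"
    by (rule integral_gaussian) measurable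
  also have "\<dots> = (\<integral>z. gauss_density t ((a + z) - a) * F (a + z) \<partial>lborel)"
    by simp
  also have "\<dots> = (\<integral>y. gauss_density t (y - a) * F y \<partial>distr lborel borel ((+) a))"
    by (subst integral_distr) auto
  also have "\<dots> = (\<integral>y. gauss_density t (y - a) * F y \<partial>lborel)"
    by (simp add: lborel_distr_plus)
  also have "\<dots> = (\<integral>y. gauss_density t y * (F y * exp (a \<bullet> y / t - (norm a)\<^sup>2 / (2 * t))) \<partial>lborel)"
  proof (rule Bochner_Integration.integral_cong[OF refl])
    fix y :: "real^'n"
    have "- (norm (y - a))\<^sup>2 / (2 * t) = - (norm y)\<^sup>2 / (2 * t) + (a \<bullet> y / t - (norm a)\<^sup>2 / (2 * t))"
      using t by (simp add: power2_norm_eq_inner inner_diff_left inner_diff_right inner_commute field_simps)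
    then show "gauss_density t (y - a) * F y
        = gauss_density t y * (F y * exp (a \<bullet> y / t - (norm a)\<^sup>2 / (2 * t)))"
      by (simp only: exp_add) (simp add: mult_ac)
  qed
  also have "\<dots> = (\<integral>z. F z * exp (a \<bullet> z / t - (norm a)\<^sup>2 / (2 * t)) \<partial>gaussian t)"
    by (rule integral_gaussian[symmetric]) measurable
  finally show ?thesis .
qed

lemma gaussian_mgf:
  fixes a :: "real^'n::finite"
  assumes t: "t > 0"
  shows "integrable (gaussian t) (\<lambda>z. exp (a \<bullet> z))"
    and "(\<integral>z. exp (a \<bullet> z) \<partial>gaussian t) = exp (t * (norm a)\<^sup>2 / 2)"
proof -
  interpret prob_space "gaussian t :: (real^'n) measure" by (rule prob_space_gaussian[OF t])
  have "1 = (\<integral>z. 1 * exp ((t *\<^sub>R a) \<bullet> z / t - (norm (t *\<^sub>R a))\<^sup>2 / (2 * t)) \<partial>gaussian t)"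
    using gaussian_shift[OF t, of "\<lambda>_. 1" "t *\<^sub>R a"] prob_space by simp
  also have "\<dots> = (\<integral>z. exp (a \<bullet> z) * exp (- (t * (norm a)\<^sup>2 / 2)) \<partial>gaussian t)"
    using t by (intro Bochner_Integration.integral_cong)
      (auto simp: mult_exp_exp power_mult_distrib power2_eq_square field_simps)
  finally have eq: "(\<integral>z. exp (a \<bullet> z) \<partial>gaussian t) * exp (- (t * (norm a)\<^sup>2 / 2)) = 1"
    by simp
  then show "(\<integral>z. exp (a \<bullet> z) \<partial>gaussian t) = exp (t * (norm a)\<^sup>2 / 2)"
    by (simp add: exp_minus field_simps)
  then show "integrable (gaussian t) (\<lambda>z. exp (a \<bullet> z))"
    using not_integrable_integral_eq by fastforce
qed

lemma integral_exp_dot_symmetric: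
  fixes a :: "real^'n::finite"
  assumes t: "t > 0"
  shows "integrable (gaussian t) (\<lambda>z. exp (a \<bullet> z) + exp (- (a \<bullet> z)))"
    and "(\<integral>z. exp (a \<bullet> z) + exp (- (a \<bullet> z)) \<partial>gaussian t) = 2 * exp (t * (norm a)\<^sup>2 / 2)"
  using gaussian_mgf[OF t, of a] gaussian_mgf[OF t, of "-a"]
  by (auto simp: inner_minus_left)

lemma exp_ge_power_div_fact:
  assumes "(0::real) \<le> y"
  shows "y ^ k / fact k \<le> exp y"
proof -
  have "(\<Sum>n\<in>{k}. y ^ n /\<^sub>R fact n) \<le> suminf (\<lambda>n. y ^ n /\<^sub>R fact n)"
    using assms by (intro sum_le_suminf summable_exp_generic) auto
  then show ?thesis by (simp add: exp_def divide_inverse mult.commute)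
qed

lemma abs_power_le_exp_add_exp:
  "\<bar>y::real\<bar> ^ k \<le> fact k * (exp y + exp (- y))"
proof -
  have "\<bar>y\<bar> ^ k \<le> fact k * exp \<bar>y\<bar>"
    using exp_ge_power_div_fact[of "\<bar>y\<bar>" k] by (simp add: field_simps)
  also have "\<dots> \<le> fact k * (exp y + exp (- y))"
    by (intro mult_left_mono) (auto simp: abs_if)
  finally show ?thesis .
qed

text \<open>Some coordinate of \<open>z\<close> is at least \<open>norm z\<close> divided by the dimension, which reduces all
  moments of the norm to exponential moments of the coordinates. The exponent is scaled with
  \<open>1 / sqrt t\<close> to obtain the correct order in \<open>t\<close>.\<close>

lemma gaussian_norm_moment:
  "\<exists>K. \<forall>t>0. integrable (gaussian t) (\<lambda>z :: real^'n::finite. norm z ^ k) \<and>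
     (\<integral>z. norm (z :: real^'n) ^ k \<partial>gaussian t) \<le> K * sqrt t ^ k"
proof -
  let ?B = "Basis :: (real^'n) set"
  define d where "d = real (card ?B)"
  have d: "d > 0" by (simp add: d_def)
  define K where "K = d ^ k * fact k * (d * (2 * exp (1/2)))"
  have main: "integrable (gaussian t) (\<lambda>z :: real^'n. norm z ^ k)
      \<and> (\<integral>z. norm (z :: real^'n) ^ k \<partial>gaussian t) \<le> K * sqrt t ^ k" if t: "t > 0" for t
  proof -
    define a where "a b = (1 / sqrt t) *\<^sub>R b" for b :: "real^'n"
    define H where "H z = sqrt t ^ k * d ^ k * fact k *
      (\<Sum>b\<in>?B. exp (a b \<bullet> z) + exp (- (a b \<bullet> z)))" for z :: "real^'n"
    have Hint: "integrable (gaussian t) H"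
      unfolding H_def
      by (intro integrable_mult_right Bochner_Integration.integrable_sum integral_exp_dot_symmetric(1)[OF t])
    have Hval: "(\<integral>z. H z \<partial>gaussian t) = K * sqrt t ^ k"
    proof -
      have "(\<integral>z. H z \<partial>gaussian t)
          = sqrt t ^ k * d ^ k * fact k * (\<Sum>b\<in>?B. 2 * exp (t * (norm (a b))\<^sup>2 / 2))"
        unfolding H_def
        by (subst integral_mult_right_zero, subst Bochner_Integration.integral_sum)
           (simp_all only: integral_exp_dot_symmetric[OF t])
      also have "(\<Sum>b\<in>?B. 2 * exp (t * (norm (a b))\<^sup>2 / 2)) = (\<Sum>b\<in>?B. 2 * exp (1/2))"
        using t by (intro sum.cong) (auto simp: a_def power_divide)
      finally show ?thesis by (simp add: K_def d_def mult_ac)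
    qed
    have le: "norm z ^ k \<le> H z" for z :: "real^'n"
    proof -
      have "\<exists>b\<in>?B. norm z \<le> d * \<bar>z \<bullet> b\<bar>"
      proof (rule ccontr)
        assume "\<not> ?thesis"
        then have "\<And>b. b \<in> ?B \<Longrightarrow> \<bar>z \<bullet> b\<bar> < norm z / d"
          using d by (auto simp: field_simps not_le)
        then have "(\<Sum>b\<in>?B. \<bar>z \<bullet> b\<bar>) < (\<Sum>b\<in>?B. norm z / d)"
          by (intro sum_strict_mono) auto
        with norm_le_l1[of z] d show False by (simp add: d_def)
      qed
      then obtain b where b: "b \<in> ?B" and zb: "norm z \<le> d * \<bar>z \<bullet> b\<bar>" by blast
      have ab: "a b \<bullet> z = (z \<bullet> b) / sqrt t" by (simp add: a_def inner_commute)
      have "norm z ^ k \<le> (d * \<bar>z \<bullet> b\<bar>) ^ k" using zb by (intro power_mono) auto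
      also have "\<dots> = sqrt t ^ k * d ^ k * \<bar>a b \<bullet> z\<bar> ^ k"
        unfolding ab using t by (simp add: power_mult_distrib power_divide)
      also have "\<dots> \<le> sqrt t ^ k * d ^ k * (fact k * (exp (a b \<bullet> z) + exp (- (a b \<bullet> z))))"
        using t d by (intro mult_left_mono abs_power_le_exp_add_exp) auto
      also have "\<dots> \<le> sqrt t ^ k * d ^ k * (fact k * (\<Sum>b\<in>?B. exp (a b \<bullet> z) + exp (- (a b \<bullet> z))))"
        using t d b
        by (intro mult_left_mono member_le_sum) (auto intro: add_nonneg_nonneg)
      finally show ?thesis by (simp add: H_def mult_ac)
    qed
    have int: "integrable (gaussian t) (\<lambda>z :: real^'n. norm z ^ k)"
      by (rule Bochner_Integration.integrable_bound[OF Hint]) (use le in \<open>auto intro!: AE_I2 order_trans[OF le abs_ge_self]\<close>)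
    show ?thesis
      using int integral_mono[OF int Hint le] Hval by auto
  qed
  then show ?thesis by blast
qed

lemma one_plus_half_square_le_cosh: "2 + y\<^sup>2 \<le> exp y + exp (- y :: real)"
proof -
  define u where "u = \<bar>y\<bar>"
  have u: "u \<ge> 0" by (simp add: u_def)
  have "exp u + exp (-u) - 2 - u\<^sup>2 \<ge> exp 0 + exp (-0) - 2 - 0\<^sup>2"
  proof (rule DERIV_nonneg_imp_nondecreasing[OF u])
    fix x :: real assume x: "0 \<le> x" "x \<le> u"
    have "exp x - exp (-x) - 2 * x \<ge> exp 0 - exp (-0) - 2 * 0"
    proof (rule DERIV_nonneg_imp_nondecreasing[OF x(1)])
      fix y :: real
      have "0 \<le> (exp (y/2) - exp (-y/2))\<^sup>2" by simp
      also have "\<dots> = exp y + exp (-y) - 2"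
        by (simp add: power2_diff mult_exp_exp flip: exp_of_nat_mult)
      finally have "exp y + exp (-y) - 2 \<ge> 0" .
      moreover have "((\<lambda>x. exp x - exp (-x) - 2 * x) has_real_derivative exp y + exp (-y) - 2) (at y)"
        by (auto intro!: derivative_eq_intros)
      ultimately show "\<exists>d. ((\<lambda>x. exp x - exp (-x) - 2 * x) has_real_derivative d) (at y) \<and> 0 \<le> d" by blast
    qed
    moreover have "((\<lambda>x. exp x + exp (-x) - 2 - x\<^sup>2) has_real_derivative exp x - exp (-x) - 2 * x) (at x)"
      by (auto intro!: derivative_eq_intros)
    ultimately show "\<exists>d. ((\<lambda>x. exp x + exp (-x) - 2 - x\<^sup>2) has_real_derivative d) (at x) \<and> 0 \<le> d" by auto
  qed
  then show ?thesis by (auto simp: u_def abs_if split: if_splits)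
qed

text \<open>The second moment is read off from the moment generating function: \<open>2 + y\<^sup>2 \<le> exp y + exp (- y)\<close>
  is integrated for \<open>y = sqrt l * (v \<bullet> z)\<close>, and \<open>l\<close> tends to \<open>0\<close>.\<close>

lemma gaussian_second_moment:
  fixes v :: "real^'n::finite"
  assumes t: "t > 0"
  shows "integrable (gaussian t) (\<lambda>z. (v \<bullet> z)\<^sup>2)" and "(\<integral>z. (v \<bullet> z)\<^sup>2 \<partial>gaussian t) \<le> t * (norm v)\<^sup>2"
proof -
  interpret prob_space "gaussian t :: (real^'n) measure" by (rule prob_space_gaussian[OF t])
  show int: "integrable (gaussian t) (\<lambda>z. (v \<bullet> z)\<^sup>2)"
    by (rule Bochner_Integration.integrable_bound[OF integral_exp_dot_symmetric(1)[OF t, of v]])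
       (auto intro!: AE_I2, smt (verit) one_plus_half_square_le_cosh)
  define A where "A = t * (norm v)\<^sup>2"
  have bound: "(\<integral>z. (v \<bullet> z)\<^sup>2 \<partial>gaussian t) \<le> (exp (l * (A / 2)) - 1) / (l / 2)" if l: "l > 0" for l
  proof -
    let ?a = "sqrt l *\<^sub>R v"
    have "2 + l * (\<integral>z. (v \<bullet> z)\<^sup>2 \<partial>gaussian t) = (\<integral>z. 2 + (?a \<bullet> z)\<^sup>2 \<partial>gaussian t)"
      using int l prob_space by (simp add: power_mult_distrib)
    also have "\<dots> \<le> (\<integral>z. exp (?a \<bullet> z) + exp (- (?a \<bullet> z)) \<partial>gaussian t)"
      using int l by (intro integral_mono integral_exp_dot_symmetric(1)[OF t] one_plus_half_square_le_cosh)
        (auto simp: power_mult_distrib)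
    also have "\<dots> = 2 * exp (l * (A / 2))"
      using l by (subst integral_exp_dot_symmetric(2)[OF t]) (simp add: power_mult_distrib A_def mult_ac)
    finally show ?thesis using l by (simp add: field_simps)
  qed
  have "((\<lambda>l. (exp (l * (A / 2)) - 1) / (l / 2)) \<longlongrightarrow> A) (at_right 0)"
  proof -
    have "((\<lambda>l. exp (l * (A / 2))) has_real_derivative A / 2) (at 0)"
      by (auto intro!: derivative_eq_intros)
    then have "((\<lambda>l. (exp (l * (A / 2)) - 1) / l) \<longlongrightarrow> A / 2) (at 0)"
      by (simp add: has_field_derivative_iff)
    then have "((\<lambda>l. 2 * ((exp (l * (A / 2)) - 1) / l)) \<longlongrightarrow> 2 * (A / 2)) (at 0)"
      by (rule tendsto_mult_left)
    then have "((\<lambda>l. 2 * ((exp (l * (A / 2)) - 1) / l)) \<longlongrightarrow> A) (at_right 0)"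
      by (simp add: filterlim_at_split)
    then show ?thesis by (simp add: field_simps)
  qed
  moreover have "eventually (\<lambda>l. (\<integral>z. (v \<bullet> z)\<^sup>2 \<partial>gaussian t) \<le> (exp (l * (A / 2)) - 1) / (l / 2)) (at_right 0)"
    using bound by (auto simp: eventually_at_right_field intro!: exI[of _ 1])
  ultimately show "(\<integral>z. (v \<bullet> z)\<^sup>2 \<partial>gaussian t) \<le> t * (norm v)\<^sup>2"
    by (intro tendsto_le[OF _ _ tendsto_const]) (auto simp: A_def)
qed

lemma nn_integral_gaussian:
  fixes F :: "real^'n::finite \<Rightarrow> ennreal"
  assumes [measurable]: "F \<in> borel_measurable borel"
  shows "(\<integral>\<^sup>+x. F x \<partial>gaussian t) = (\<integral>\<^sup>+x. ennreal (gauss_density t x) * F x \<partial>lborel)"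
  unfolding gaussian_def by (subst nn_integral_density) auto

text \<open>Completing the square. In probabilistic terms, given the sum \<open>w\<close> of two independent Gaussian
  vectors, the first one is again Gaussian, with a mean proportional to \<open>w\<close>. The normalising factors
  agree because \<open>s * t = (s + t) * (s * t / (s + t))\<close>.\<close>

lemma gauss_density_mult:
  fixes y w :: "real^'n::finite"
  assumes "s > 0" "t > 0"
  shows "gauss_density s y * gauss_density t (w - y)
    = gauss_density (s + t) w * gauss_density (s * t / (s + t)) (- ((s / (s + t)) *\<^sub>R w) + y)"
proof -
  define r where "r = s * t / (s + t)"
  have pos: "s + t > 0" "r > 0" using assms by (auto simp: r_def)
  have "- (norm y)\<^sup>2 / (2 * s) + - (norm (w - y))\<^sup>2 / (2 * t)
      = - (norm w)\<^sup>2 / (2 * (s + t)) + - (norm (- ((s / (s + t)) *\<^sub>R w) + y))\<^sup>2 / (2 * r)"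
  proof -
    define a b c where "a = y \<bullet> y" and "b = y \<bullet> w" and "c = w \<bullet> w"
    have n: "(norm y)\<^sup>2 = a" "(norm w)\<^sup>2 = c" "(norm (w - y))\<^sup>2 = c - 2 * b + a"
      "(norm (- ((s / (s + t)) *\<^sub>R w) + y))\<^sup>2 = (s / (s + t))\<^sup>2 * c - 2 * (s / (s + t)) * b + a"
      by (simp_all only: power2_norm_eq_inner inner_simps a_def b_def c_def inner_commute[of w y])
         (simp_all add: power2_eq_square algebra_simps inner_commute)
    have "- a / (2 * s) + - (c - 2 * b + a) / (2 * t)
      = - c / (2 * (s + t)) + - (((s / (s + t))\<^sup>2 * c - 2 * (s / (s + t)) * b + a) * (s + t)) / (2 * (s * t))"
    proof -
      define k e where "k = s / (s + t)" and "e = c / (s + t)"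
      have ks: "k * (s + t) = s" and c: "c = e * (s + t)" and ke: "k * c = s * e"
        using pos(1) by (auto simp: k_def e_def)
      have "(k\<^sup>2 * c - 2 * k * b + a) * (s + t) = (k * (s + t)) * (k * c) - 2 * (k * (s + t)) * b + a * (s + t)"
        by (simp add: power2_eq_square algebra_simps)
      also have "\<dots> = s * (s * e) - 2 * s * b + a * (s + t)"
        unfolding ks ke ..
      finally have *: "(k\<^sup>2 * c - 2 * k * b + a) * (s + t) = s * (s * e) - 2 * s * b + a * (s + t)" .
      have "- c / (2 * (s + t)) = - e / 2" using pos(1) by (simp add: e_def)
      then have "- c / (2 * (s + t)) + - ((k\<^sup>2 * c - 2 * k * b + a) * (s + t)) / (2 * (s * t))
          = - e / 2 - (s * (s * e) - 2 * s * b + a * (s + t)) / (2 * (s * t))"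
        unfolding * by (simp only: minus_divide_left diff_conv_add_uminus)
      also have "\<dots> = - a / (2 * s) + - (c - 2 * b + a) / (2 * t)"
        unfolding c using assms by (simp add: field_simps)
      finally show ?thesis unfolding k_def by (rule sym)
    qed
    moreover have "- X / (2 * r) = - (X * (s + t)) / (2 * (s * t))" for X
      by (simp add: r_def)
    ultimately show ?thesis unfolding n by (simp only:)
  qed
  then have "exp (- (norm y)\<^sup>2 / (2 * s)) * exp (- (norm (w - y))\<^sup>2 / (2 * t))
      = exp (- (norm w)\<^sup>2 / (2 * (s + t))) * exp (- (norm (- ((s / (s + t)) *\<^sub>R w) + y))\<^sup>2 / (2 * r))"
    by (simp only: exp_add[symmetric])
  moreover have "(2 * pi * s) powr k * (2 * pi * t) powr k
      = (2 * pi * (s + t)) powr k * (2 * pi * r) powr k" for k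
  proof -
    have "(s + t) * r = s * t" using pos by (simp add: r_def)
    moreover have "(2 * pi * (s + t)) * (2 * pi * r) = 4 * pi * pi * ((s + t) * r)"
      by (simp add: algebra_simps)
    ultimately have "(2 * pi * s) * (2 * pi * t) = (2 * pi * (s + t)) * (2 * pi * r)"
      by (simp add: algebra_simps)
    then show ?thesis using assms pos by (simp only: powr_mult[symmetric])
  qed
  ultimately show ?thesis unfolding r_def[symmetric] times_divide_times_eq by simp
qed

lemma gaussian_add_nn:
  fixes f :: "real^'n::finite \<Rightarrow> ennreal"
  assumes s: "s > 0" and t: "t > 0" and [measurable]: "f \<in> borel_measurable borel"
  shows "(\<integral>\<^sup>+y. (\<integral>\<^sup>+z. f (y + z) \<partial>gaussian t) \<partial>gaussian s) = (\<integral>\<^sup>+w. f w \<partial>gaussian (s + t))"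
proof -
  have "(\<integral>\<^sup>+y. (\<integral>\<^sup>+z. f (y + z) \<partial>gaussian t) \<partial>gaussian s)
     = (\<integral>\<^sup>+y. ennreal (gauss_density s y) * (\<integral>\<^sup>+z. ennreal (gauss_density t z) * f (y + z) \<partial>lborel) \<partial>lborel)"
    by (simp add: nn_integral_gaussian)
  also have "\<dots> = (\<integral>\<^sup>+y. ennreal (gauss_density s y) * (\<integral>\<^sup>+w. ennreal (gauss_density t (w - y)) * f w \<partial>lborel) \<partial>lborel)"
  proof (rule nn_integral_cong, rule arg_cong2[where f = "(*)", OF refl])
    fix y :: "real^'n"
    have [measurable]: "(\<lambda>w. ennreal (gauss_density t (w - y)) * f w) \<in> borel_measurable borel"
      by measurable
    show "(\<integral>\<^sup>+z. ennreal (gauss_density t z) * f (y + z) \<partial>lborel)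
        = (\<integral>\<^sup>+w. ennreal (gauss_density t (w - y)) * f w \<partial>lborel)"
      using nn_integral_lborel_translate[of "\<lambda>w. ennreal (gauss_density t (w - y)) * f w" y] by simp
  qed
  also have "\<dots> = (\<integral>\<^sup>+y. (\<integral>\<^sup>+w. ennreal (gauss_density s y * gauss_density t (w - y)) * f w \<partial>lborel) \<partial>lborel)"
  proof (rule nn_integral_cong)
    fix y :: "real^'n"
    have "ennreal (gauss_density s y * gauss_density t (w - y))
        = ennreal (gauss_density s y) * ennreal (gauss_density t (w - y))" for w
      by (rule ennreal_mult) simp_all
    then show "ennreal (gauss_density s y) * (\<integral>\<^sup>+w. ennreal (gauss_density t (w - y)) * f w \<partial>lborel)
        = (\<integral>\<^sup>+w. ennreal (gauss_density s y * gauss_density t (w - y)) * f w \<partial>lborel)"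
      by (simp only: mult.assoc) (rule nn_integral_cmult[symmetric], measurable)
  qed
  also have "\<dots> = (\<integral>\<^sup>+w. (\<integral>\<^sup>+y. ennreal (gauss_density s y * gauss_density t (w - y)) * f w \<partial>lborel) \<partial>lborel)"
    by (rule lborel_pair.Fubini') measurable
  also have "\<dots> = (\<integral>\<^sup>+w. ennreal (gauss_density (s + t) w) * f w \<partial>lborel)"
  proof (rule nn_integral_cong)
    fix w :: "real^'n"
    have "(\<integral>\<^sup>+y. ennreal (gauss_density s y * gauss_density t (w - y)) * f w \<partial>lborel)
       = (\<integral>\<^sup>+y. (ennreal (gauss_density (s + t) w) * f w) *
            ennreal (gauss_density (s * t / (s + t)) (- ((s / (s + t)) *\<^sub>R w) + y)) \<partial>lborel)"
    proof (rule nn_integral_cong)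
      fix y :: "real^'n"
      have "ennreal (gauss_density s y * gauss_density t (w - y)) = ennreal (gauss_density (s + t) w)
          * ennreal (gauss_density (s * t / (s + t)) (- ((s / (s + t)) *\<^sub>R w) + y))"
        unfolding gauss_density_mult[OF s t] by (rule ennreal_mult) simp_all
      then show "ennreal (gauss_density s y * gauss_density t (w - y)) * f w
          = ennreal (gauss_density (s + t) w) * f w
            * ennreal (gauss_density (s * t / (s + t)) (- ((s / (s + t)) *\<^sub>R w) + y))"
        by (simp only: mult_ac)
    qed
    also have "\<dots> = ennreal (gauss_density (s + t) w) * f w"
      by (subst nn_integral_cmult, measurable, subst nn_integral_gauss_density) (use s t in simp_all)
    finally show "(\<integral>\<^sup>+y. ennreal (gauss_density s y * gauss_density t (w - y)) * f w \<partial>lborel)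
       = ennreal (gauss_density (s + t) w) * f w" .
  qed
  also have "\<dots> = (\<integral>\<^sup>+w. f w \<partial>gaussian (s + t))"
    by (simp add: nn_integral_gaussian)
  finally show ?thesis .
qed

lemma convolution_gaussian:
  assumes s: "s > 0" and t: "t > 0"
  shows "gaussian s \<star> gaussian t = (gaussian (s + t) :: (real^'n::finite) measure)"
proof (rule measure_eqI)
  interpret S: prob_space "gaussian s :: (real^'n) measure" by (rule prob_space_gaussian[OF s])
  interpret T: prob_space "gaussian t :: (real^'n) measure" by (rule prob_space_gaussian[OF t])
  fix A :: "(real^'n) set" assume "A \<in> sets (gaussian s \<star> gaussian t)"
  then have [measurable]: "A \<in> sets borel" by simp
  have "emeasure (gaussian s \<star> gaussian t) A
      = (\<integral>\<^sup>+y. (\<integral>\<^sup>+z. indicator A (y + z) \<partial>gaussian t) \<partial>gaussian s)"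
    by (rule convolution_emeasure') (auto intro: S.finite_measure_axioms T.finite_measure_axioms)
  also have "\<dots> = (\<integral>\<^sup>+w. indicator A w \<partial>gaussian (s + t))"
    by (rule gaussian_add_nn[OF s t]) measurable
  finally show "emeasure (gaussian s \<star> gaussian t) A = emeasure (gaussian (s + t)) A" by simp
qed simp

lemma integral_convolution:
  fixes f :: "real^'n::finite \<Rightarrow> real"
  assumes M: "prob_space M" and N: "prob_space N"
    and [measurable_cong]: "sets M = sets borel" "sets N = sets borel"
    and [measurable]: "f \<in> borel_measurable borel" and bd: "\<And>x. \<bar>f x\<bar> \<le> B"
  shows "(\<integral>x. f x \<partial>(M \<star> N)) = (\<integral>y. (\<integral>z. f (y + z) \<partial>N) \<partial>M)"
proof -
  interpret M: prob_space M by fact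
  interpret N: prob_space N by fact
  interpret MN: pair_prob_space M N ..
  have "(\<integral>x. f x \<partial>(M \<star> N)) = (\<integral>p. f (fst p + snd p) \<partial>(M \<Otimes>\<^sub>M N))"
    unfolding convolution_def by (subst integral_distr) (auto simp: split_beta')
  also have "\<dots> = (\<integral>y. (\<integral>z. f (y + z) \<partial>N) \<partial>M)"
    using bd
    by (subst MN.integral_fst'[symmetric]) (auto intro!: MN.integrable_const_bound[where B = B])
  finally show ?thesis .
qed

section \<open>The heat semigroup\<close>

definition heat :: "real \<Rightarrow> (real^'n::finite \<Rightarrow> 'b::{banach, second_countable_topology}) \<Rightarrow> real^'n \<Rightarrow> 'b" where
  "heat t f x = (\<integral>z. f (x + z) \<partial>gaussian t)"

lemma borel_measurable_heat [measurable]: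
  assumes t: "t > 0" and [measurable]: "f \<in> borel_measurable borel"
  shows "heat t f \<in> borel_measurable borel"
proof -
  interpret prob_space "gaussian t :: (real^'a) measure" by (rule prob_space_gaussian[OF t])
  show ?thesis unfolding heat_def by measurable
qed

lemma integrable_heat:
  fixes f :: "real^'n::finite \<Rightarrow> 'b::{banach, second_countable_topology}"
  assumes t: "t > 0" and [measurable]: "f \<in> borel_measurable borel" and bd: "\<And>x. norm (f x) \<le> B"
  shows "integrable (gaussian t) (\<lambda>z. f (x + z))"
proof -
  interpret prob_space "gaussian t :: (real^'n) measure" by (rule prob_space_gaussian[OF t])
  show ?thesis using bd by (intro integrable_const_bound[where B = B]) auto
qed

lemma heat_const:
  fixes x :: "real^'n::finite"
  assumes t: "t > 0"
  shows "heat t (\<lambda>_. c) x = c"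
  by (simp add: heat_def t)

lemma norm_heat_le:
  fixes f :: "real^'n::finite \<Rightarrow> 'b::{banach, second_countable_topology}"
  assumes t: "t > 0" and [measurable]: "f \<in> borel_measurable borel" and bd: "\<And>x. norm (f x) \<le> B"
  shows "norm (heat t f x) \<le> B"
proof -
  interpret prob_space "gaussian t :: (real^'n) measure" by (rule prob_space_gaussian[OF t])
  have "norm (heat t f x) \<le> (\<integral>z. norm (f (x + z)) \<partial>gaussian t)"
    unfolding heat_def by (rule integral_norm_bound)
  also have "\<dots> \<le> (\<integral>z. B \<partial>(gaussian t :: (real^'n) measure))"
    using bd integrable_heat[OF t, of "\<lambda>x. norm (f x)" B x] by (intro integral_mono) auto
  finally show ?thesis by (simp add: t)
qed

lemma heat_mono:
  fixes f g :: "real^'n::finite \<Rightarrow> real"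
  assumes t: "t > 0" and [measurable]: "f \<in> borel_measurable borel" "g \<in> borel_measurable borel"
    and bd: "\<And>x. \<bar>f x\<bar> \<le> B" "\<And>x. \<bar>g x\<bar> \<le> B'" and le: "\<And>x. f x \<le> g x"
  shows "heat t f x \<le> heat t g x"
  unfolding heat_def
  using bd le by (intro integral_mono integrable_heat[OF t]) auto

lemma heat_in_interval:
  fixes f :: "real^'n::finite \<Rightarrow> real"
  assumes t: "t > 0" and [measurable]: "f \<in> borel_measurable borel" and f: "\<And>x. f x \<in> {a..b}"
  shows "heat t f x \<in> {a..b}"
proof -
  have bd: "\<bar>f x\<bar> \<le> \<bar>a\<bar> + \<bar>b\<bar>" for x using f[of x] by auto
  have "heat t (\<lambda>_. a) x \<le> heat t f x"
    using f by (intro heat_mono[OF t _ _ _ bd, where B = "\<bar>a\<bar>"]) auto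
  moreover have "heat t f x \<le> heat t (\<lambda>_. b) x"
    using f by (intro heat_mono[OF t _ _ bd, where B' = "\<bar>b\<bar>"]) auto
  ultimately show ?thesis by (simp add: heat_const[OF t])
qed

lemma heat_heat:
  fixes f :: "real^'n::finite \<Rightarrow> real"
  assumes s: "s > 0" and t: "t > 0"
    and [measurable]: "f \<in> borel_measurable borel" and bd: "\<And>x. \<bar>f x\<bar> \<le> B"
  shows "heat s (heat t f) x = heat (s + t) f x"
proof -
  have "heat (s + t) f x = (\<integral>z. f (x + z) \<partial>(gaussian s \<star> gaussian t))"
    by (simp add: heat_def convolution_gaussian[OF s t])
  also have "\<dots> = (\<integral>y. (\<integral>z. f (x + (y + z)) \<partial>gaussian t) \<partial>gaussian s)"
    by (rule integral_convolution[where B = B]) (auto simp: prob_space_gaussian s t bd)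
  finally show ?thesis by (simp add: heat_def add.assoc)
qed

text \<open>A quantitative form of continuous differentiability that passes to averages of translates.
  Stating the first-order Taylor bound directly, with \<open>G\<close> in place of the gradient, makes the
  invariance under the heat semigroup a matter of integrating inequalities, with no
  differentiation under the integral sign.\<close>

definition C11 :: "real \<Rightarrow> real \<Rightarrow> (real^'n::finite \<Rightarrow> real) \<Rightarrow> (real^'n \<Rightarrow> real^'n) \<Rightarrow> bool" where
  "C11 L M h G \<longleftrightarrow> (\<forall>x. norm (G x) \<le> L) \<and>
     (\<forall>x y. \<bar>h y - h x\<bar> \<le> L * norm (y - x)) \<and>
     (\<forall>x y. norm (G y - G x) \<le> M * norm (y - x)) \<and>
     (\<forall>x y. \<bar>h y - h x - G x \<bullet> (y - x)\<bar> \<le> M * (norm (y - x))\<^sup>2)"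

lemma borel_measurable_Lipschitz:
  fixes f :: "'a::real_normed_vector \<Rightarrow> 'b::real_normed_vector"
  assumes "\<And>x y. norm (f y - f x) \<le> L * norm (y - x)"
  shows "f \<in> borel_measurable borel"
proof -
  have "\<bar>L\<bar>-lipschitz_on UNIV f"
    using order_trans[OF assms mult_right_mono[OF abs_ge_self]]
    by (intro lipschitz_onI) (auto simp: dist_norm)
  then show ?thesis
    by (intro borel_measurable_continuous_onI lipschitz_on_continuous_on)
qed

lemma C11D:
  assumes "C11 L M h G"
  shows "norm (G x) \<le> L" "\<bar>h y - h x\<bar> \<le> L * norm (y - x)"
    "norm (G y - G x) \<le> M * norm (y - x)" "\<bar>h y - h x - G x \<bullet> (y - x)\<bar> \<le> M * (norm (y - x))\<^sup>2"
    "h \<in> borel_measurable borel" "G \<in> borel_measurable borel"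
  using assms borel_measurable_Lipschitz[of h L] borel_measurable_Lipschitz[of G M]
  by (auto simp: C11_def)

lemma C11_nonneg:
  fixes h :: "real^'n::finite \<Rightarrow> real"
  assumes "C11 L M h G"
  shows "L \<ge> 0" "M \<ge> 0"
proof -
  show "L \<ge> 0" using C11D(1)[OF assms, of 0] norm_ge_zero order_trans by blast
  have "norm (G (axis undefined 1) - G 0) \<le> M * norm (axis undefined 1 - 0 :: real^'n)"
    by (rule C11D(3)[OF assms])
  then show "M \<ge> 0" by (simp, meson norm_ge_zero order_trans)
qed

lemma heat_Lipschitz:
  fixes f :: "real^'n::finite \<Rightarrow> 'b::{banach, second_countable_topology}"
  assumes t: "t > 0" and [measurable]: "f \<in> borel_measurable borel" and bd: "\<And>x. norm (f x) \<le> B"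
    and lip: "\<And>x y. norm (f y - f x) \<le> L * norm (y - x)"
  shows "norm (heat t f y - heat t f x) \<le> L * norm (y - x)"
proof -
  interpret prob_space "gaussian t :: (real^'n) measure" by (rule prob_space_gaussian[OF t])
  have int: "integrable (gaussian t) (\<lambda>z. f (x + z))" for x
    by (rule integrable_heat[OF t _ bd]) measurable
  have "heat t f y - heat t f x = (\<integral>z. f (y + z) - f (x + z) \<partial>gaussian t)"
    unfolding heat_def using int by simp
  also have "norm \<dots> \<le> (\<integral>z. norm (f (y + z) - f (x + z)) \<partial>gaussian t)"
    by (rule integral_norm_bound)
  also have "\<dots> \<le> (\<integral>z. L * norm (y - x) \<partial>(gaussian t :: (real^'n) measure))"
  proof (rule integral_mono)
    fix z :: "real^'n"
    show "norm (f (y + z) - f (x + z)) \<le> L * norm (y - x)" using lip[of "y + z" "x + z"] by simp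
  qed (use int in auto)
  finally show ?thesis by (simp add: t)
qed

lemma C11_heat:
  fixes h :: "real^'n::finite \<Rightarrow> real"
  assumes t: "t > 0" and h: "C11 L M h G" and bd: "\<And>x. \<bar>h x\<bar> \<le> B"
  shows "C11 L M (heat t h) (heat t G)"
proof -
  interpret prob_space "gaussian t :: (real^'n) measure" by (rule prob_space_gaussian[OF t])
  note [measurable] = C11D(5,6)[OF h]
  have inth: "integrable (gaussian t) (\<lambda>z. h (x + z))" for x
    using bd by (intro integrable_heat[OF t, where B = B]) auto
  have intG: "integrable (gaussian t) (\<lambda>z. G (x + z))" for x
    using C11D(1)[OF h] by (intro integrable_heat[OF t, where B = L]) auto
  show ?thesis unfolding C11_def
  proof (intro conjI allI)
    fix x y :: "real^'n"
    show "norm (heat t G x) \<le> L" using C11D(1)[OF h] by (intro norm_heat_le[OF t]) auto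
    show "\<bar>heat t h y - heat t h x\<bar> \<le> L * norm (y - x)"
      using heat_Lipschitz[OF t, of h B L y x] bd C11D(2)[OF h] by auto
    show "norm (heat t G y - heat t G x) \<le> M * norm (y - x)"
      using heat_Lipschitz[OF t, of G L M y x] C11D(1,3)[OF h] by auto
    have "heat t h y - heat t h x - heat t G x \<bullet> (y - x)
        = (\<integral>z. h (y + z) - h (x + z) - G (x + z) \<bullet> (y - x) \<partial>gaussian t)"
      unfolding heat_def using inth intG by simp
    also have "\<bar>\<dots>\<bar> \<le> (\<integral>z. \<bar>h (y + z) - h (x + z) - G (x + z) \<bullet> (y - x)\<bar> \<partial>gaussian t)"
      using integral_norm_bound by auto
    also have "\<dots> \<le> (\<integral>z. M * (norm (y - x))\<^sup>2 \<partial>(gaussian t :: (real^'n) measure))"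
    proof (rule integral_mono)
      fix z :: "real^'n"
      show "\<bar>h (y + z) - h (x + z) - G (x + z) \<bullet> (y - x)\<bar> \<le> M * (norm (y - x))\<^sup>2"
        using C11D(4)[OF h, of "y + z" "x + z"] by simp
    qed (use inth intG in auto)
    finally show "\<bar>heat t h y - heat t h x - heat t G x \<bullet> (y - x)\<bar> \<le> M * (norm (y - x))\<^sup>2"
      by (simp add: t)
  qed
qed

section \<open>Functional inequalities for the Gaussian measure\<close>

text \<open>Here \<open>\<phi>'\<close> stands for the derivative of the convex function \<open>\<phi>\<close>, and \<open>q\<close> for half its second
  derivative. The last assumption gives \<open>q c * r\<^sup>2\<close>, as a function of \<open>c\<close> and \<open>r\<close>, supporting planes that
  are nondecreasing in \<open>r\<close>. This is the joint convexity that makes the energy \<open>q h * (norm G)\<^sup>2\<close>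
  decrease under averaging.\<close>

locale entropy_function =
  fixes \<phi> \<phi>' q :: "real \<Rightarrow> real" and lo hi K Q B :: real
  assumes measurable_phi [measurable]: "\<phi> \<in> borel_measurable borel"
    and phi_bounded: "y \<in> {lo..hi} \<Longrightarrow> \<bar>\<phi> y\<bar> \<le> B"
    and phi_tangent: "c \<in> {lo..hi} \<Longrightarrow> y \<in> {lo..hi} \<Longrightarrow> \<phi> c + \<phi>' c * (y - c) \<le> \<phi> y"
    and phi_upper: "c \<in> {lo..hi} \<Longrightarrow> y \<in> {lo..hi} \<Longrightarrow>
        \<phi> y \<le> \<phi> c + \<phi>' c * (y - c) + q c * (y - c)\<^sup>2 + K * \<bar>y - c\<bar> ^ 3"
    and K_nonneg: "K \<ge> 0"
    and q_bounds: "c \<in> {lo..hi} \<Longrightarrow> 0 \<le> q c \<and> q c \<le> Q"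
    and q_support: "c \<in> {lo..hi} \<Longrightarrow> 0 \<le> r \<Longrightarrow>
        \<exists>a b. 0 \<le> b \<and> (\<forall>c'\<in>{lo..hi}. \<forall>r'\<ge>0. q c * r\<^sup>2 + a * (c' - c) + b * (r' - r) \<le> q c' * r'\<^sup>2)"
begin

text \<open>Expand \<open>\<phi> (h (x + z))\<close> at \<open>h x\<close>. By convexity, the mean of the tangent part is at most
  \<open>\<phi> (heat d h x)\<close>. The second-order term \<open>(G x \<bullet> z)\<^sup>2\<close> contributes to first order in \<open>d\<close>. The remaining
  terms are of third order in \<open>norm z\<close>, hence of order \<open>3 / 2\<close> in \<open>d\<close>, and so is the error made by
  replacing \<open>\<psi> x\<close> by its average. The constant \<open>E\<close> depends on \<open>h\<close> only through bounds that are invariant under the heat semigroup, so that it serves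
  all steps of an iteration.\<close>

lemma heat_phi_small_time:
  fixes L M D :: real
  obtains E where "\<And>d (h :: real^'n::finite \<Rightarrow> real) G \<psi> B' x.
     d > 0 \<Longrightarrow> C11 L M h G \<Longrightarrow> (\<And>x. h x \<in> {lo..hi}) \<Longrightarrow>
     (\<And>x. q (h x) * (norm (G x))\<^sup>2 \<le> \<psi> x) \<Longrightarrow>
     (\<And>x y. \<bar>\<psi> y - \<psi> x\<bar> \<le> D * norm (y - x)) \<Longrightarrow> (\<And>x. \<bar>\<psi> x\<bar> \<le> B') \<Longrightarrow>
     heat d (\<lambda>x. \<phi> (h x)) x \<le> \<phi> (heat d h x) + d * heat d \<psi> x + E * sqrt d ^ 3"
proof -
  obtain K1 where K1: "\<And>t. t > 0 \<Longrightarrow> integrable (gaussian t) (\<lambda>z :: real^'n. norm z ^ 1)"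
    "\<And>t. t > 0 \<Longrightarrow> (\<integral>z. norm (z :: real^'n) ^ 1 \<partial>gaussian t) \<le> K1 * sqrt t ^ 1"
    using gaussian_norm_moment[where 'n = 'n and k = 1] by blast
  obtain K3 where K3: "\<And>t. t > 0 \<Longrightarrow> integrable (gaussian t) (\<lambda>z :: real^'n. norm z ^ 3)"
    "\<And>t. t > 0 \<Longrightarrow> (\<integral>z. norm (z :: real^'n) ^ 3 \<partial>gaussian t) \<le> K3 * sqrt t ^ 3"
    using gaussian_norm_moment[where 'n = 'n and k = 3] by blast
  define A where "A = Q * (2 * L * M) + K * L ^ 3"
  show thesis
  proof (rule that[of "A * K3 + \<bar>D\<bar> * K1"])
    fix d B' :: real and x :: "real^'n" and h :: "real^'n \<Rightarrow> real" and G \<psi>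
    assume d: "d > 0" and h: "C11 L M h G" and hI: "\<And>x. h x \<in> {lo..hi}"
      and q\<psi>: "\<And>x. q (h x) * (norm (G x))\<^sup>2 \<le> \<psi> x"
      and lip: "\<And>x y. \<bar>\<psi> y - \<psi> x\<bar> \<le> D * norm (y - x)" and bd: "\<And>x. \<bar>\<psi> x\<bar> \<le> B'"
    interpret prob_space "gaussian d :: (real^'n) measure" by (rule prob_space_gaussian[OF d])
    note [measurable] = C11D(5,6)[OF h]
    have [measurable]: "\<psi> \<in> borel_measurable borel"
      using lip by (intro borel_measurable_Lipschitz[where L = D]) simp
    have hb: "\<bar>h x\<bar> \<le> \<bar>lo\<bar> + \<bar>hi\<bar>" for x using hI[of x] by auto
    have L: "L \<ge> 0" and M: "M \<ge> 0" using C11_nonneg[OF h] by auto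
    define c where "c = h x"
    have c: "c \<in> {lo..hi}" using hI by (simp add: c_def)
    have Q: "0 \<le> q c" "q c \<le> Q" using q_bounds[OF c] by auto
    have A: "A \<ge> 0" using Q K_nonneg L M by (simp add: A_def)
    have pointwise: "\<phi> (h (x + z)) \<le> \<phi> c + \<phi>' c * (h (x + z) - c) + q c * (G x \<bullet> z)\<^sup>2 + A * norm z ^ 3"
      for z
    proof -
      define y where "y = h (x + z) - c"
      have y1: "\<bar>y\<bar> \<le> L * norm z" using C11D(2)[OF h, of "x + z" x] by (simp add: y_def c_def)
      have y2: "\<bar>y - G x \<bullet> z\<bar> \<le> M * (norm z)\<^sup>2" using C11D(4)[OF h, of "x + z" x] by (simp add: y_def c_def)
      have g: "\<bar>G x \<bullet> z\<bar> \<le> L * norm z"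
        using Cauchy_Schwarz_ineq2[of "G x" z] mult_right_mono[OF C11D(1)[OF h, of x] norm_ge_zero[of z]]
        by linarith
      have "y\<^sup>2 = (G x \<bullet> z)\<^sup>2 + (y - G x \<bullet> z) * (y + G x \<bullet> z)"
        by (simp add: power2_eq_square algebra_simps)
      also have "(y - G x \<bullet> z) * (y + G x \<bullet> z) \<le> \<bar>y - G x \<bullet> z\<bar> * \<bar>y + G x \<bullet> z\<bar>"
        by (metis abs_ge_self abs_mult)
      also have "\<dots> \<le> (M * (norm z)\<^sup>2) * (2 * L * norm z)"
        using y1 y2 g M by (intro mult_mono) auto
      finally have sq: "y\<^sup>2 \<le> (G x \<bullet> z)\<^sup>2 + 2 * L * M * norm z ^ 3"
        by (simp add: power2_eq_square power3_eq_cube mult_ac)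
      have "q c * y\<^sup>2 \<le> q c * (G x \<bullet> z)\<^sup>2 + q c * (2 * L * M * norm z ^ 3)"
        using mult_left_mono[OF sq Q(1)] by (simp add: algebra_simps)
      also have "q c * (2 * L * M * norm z ^ 3) \<le> Q * (2 * L * M * norm z ^ 3)"
        using Q L M by (intro mult_right_mono) auto
      finally have 1: "q c * y\<^sup>2 \<le> q c * (G x \<bullet> z)\<^sup>2 + Q * (2 * L * M) * norm z ^ 3" by (simp add: mult_ac)
      have "\<bar>y\<bar> ^ 3 \<le> (L * norm z) ^ 3" using y1 by (intro power_mono) auto
      then have 2: "K * \<bar>y\<bar> ^ 3 \<le> K * L ^ 3 * norm z ^ 3"
        using mult_left_mono[OF _ K_nonneg] by (simp add: power_mult_distrib mult.assoc)
      show ?thesis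
        using phi_upper[OF c hI[of "x + z"]] 1 2 unfolding y_def[symmetric]
        by (simp add: A_def algebra_simps)
    qed
    have inth: "integrable (gaussian d) (\<lambda>z. h (x + z))"
      using hb by (intro integrable_heat[OF d, where B = "\<bar>lo\<bar> + \<bar>hi\<bar>"]) auto
    have intp: "integrable (gaussian d) (\<lambda>z. \<phi> (h (x + z)))"
      using phi_bounded[OF hI] by (intro integrable_heat[OF d, where B = B]) auto
    have int\<psi>: "integrable (gaussian d) (\<lambda>z. \<psi> (x + z))"
      using bd by (intro integrable_heat[OF d, where B = B']) auto
    note sm = gaussian_second_moment[OF d, of "G x"]
    have "heat d (\<lambda>x. \<phi> (h x)) x
        \<le> (\<integral>z. \<phi> c + \<phi>' c * (h (x + z) - c) + q c * (G x \<bullet> z)\<^sup>2 + A * norm z ^ 3 \<partial>gaussian d)"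
      unfolding heat_def using inth intp sm(1) K3(1)[OF d]
      by (intro integral_mono pointwise) auto
    also have "\<dots> = \<phi> c + \<phi>' c * (heat d h x - c) + q c * (\<integral>z. (G x \<bullet> z)\<^sup>2 \<partial>gaussian d)
        + A * (\<integral>z. norm (z :: real^'n) ^ 3 \<partial>gaussian d)"
      unfolding heat_def using inth sm(1) K3(1)[OF d] by (simp add: d)
    also have "\<dots> \<le> \<phi> c + \<phi>' c * (heat d h x - c) + q c * (d * (norm (G x))\<^sup>2) + A * (K3 * sqrt d ^ 3)"
      using mult_left_mono[OF sm(2) Q(1)] mult_left_mono[OF K3(2)[OF d] A] by linarith
    also have "\<phi> c + \<phi>' c * (heat d h x - c) \<le> \<phi> (heat d h x)"
      by (intro phi_tangent c heat_in_interval[OF d] hI) measurable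
    also have "q c * (d * (norm (G x))\<^sup>2) \<le> d * \<psi> x"
      using q\<psi>[of x] d by (simp add: c_def mult.left_commute)
    also have "\<psi> x \<le> heat d \<psi> x + \<bar>D\<bar> * (K1 * sqrt d)"
    proof -
      have "\<psi> x = (\<integral>z. \<psi> x \<partial>(gaussian d :: (real^'n) measure))" by (simp add: d)
      also have "\<dots> \<le> (\<integral>z. \<psi> (x + z) + \<bar>D\<bar> * norm z ^ 1 \<partial>gaussian d)"
      proof (rule integral_mono)
        fix z :: "real^'n"
        have "\<bar>\<psi> x - \<psi> (x + z)\<bar> \<le> D * norm z" using lip[of x "x + z"] by simp
        also have "\<dots> \<le> \<bar>D\<bar> * norm z" by (intro mult_right_mono) auto
        finally show "\<psi> x \<le> \<psi> (x + z) + \<bar>D\<bar> * norm z ^ 1" by simp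
      qed (use int\<psi> K1(1)[OF d] in auto)
      also have "\<dots> = heat d \<psi> x + \<bar>D\<bar> * (\<integral>z. norm (z :: real^'n) ^ 1 \<partial>gaussian d)"
        unfolding heat_def using int\<psi> K1(1)[OF d] by simp
      also have "\<dots> \<le> heat d \<psi> x + \<bar>D\<bar> * (K1 * sqrt d)"
        using mult_left_mono[OF K1(2)[OF d], of "\<bar>D\<bar>"] by simp
      finally show ?thesis .
    qed
    finally have "heat d (\<lambda>x. \<phi> (h x)) x
        \<le> \<phi> (heat d h x) + d * (heat d \<psi> x + \<bar>D\<bar> * (K1 * sqrt d)) + A * (K3 * sqrt d ^ 3)"
      using d by simp
    also have "d * (\<bar>D\<bar> * (K1 * sqrt d)) = \<bar>D\<bar> * K1 * sqrt d ^ 3"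
      using d by (simp add: power3_eq_cube)
    then have "d * (heat d \<psi> x + \<bar>D\<bar> * (K1 * sqrt d)) = d * heat d \<psi> x + \<bar>D\<bar> * K1 * sqrt d ^ 3"
      by (simp add: distrib_left)
    finally show "heat d (\<lambda>x. \<phi> (h x)) x
        \<le> \<phi> (heat d h x) + d * heat d \<psi> x + (A * K3 + \<bar>D\<bar> * K1) * sqrt d ^ 3"
      by (simp add: algebra_simps)
  qed
qed

text \<open>Jensen's inequality for the jointly convex function \<open>q c * r\<^sup>2\<close>, combined with the triangle
  inequality for the averaged gradient.\<close>

lemma heat_q_support:
  fixes h :: "real^'n::finite \<Rightarrow> real"
  assumes d: "d > 0" and h: "C11 L M h G" and hI: "\<And>x. h x \<in> {lo..hi}"
    and q\<psi>: "\<And>x. q (h x) * (norm (G x))\<^sup>2 \<le> \<psi> x"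
    and [measurable]: "\<psi> \<in> borel_measurable borel" and bd: "\<And>x. \<bar>\<psi> x\<bar> \<le> B'"
  shows "q (heat d h x) * (norm (heat d G x))\<^sup>2 \<le> heat d \<psi> x"
proof -
  interpret prob_space "gaussian d :: (real^'n) measure" by (rule prob_space_gaussian[OF d])
  note [measurable] = C11D(5,6)[OF h]
  define c r where "c = heat d h x" and "r = norm (heat d G x)"
  have hb: "\<bar>h x\<bar> \<le> \<bar>lo\<bar> + \<bar>hi\<bar>" for x using hI[of x] by auto
  have inth: "integrable (gaussian d) (\<lambda>z. h (x + z))"
    using hb by (intro integrable_heat[OF d, where B = "\<bar>lo\<bar> + \<bar>hi\<bar>"]) auto
  have intG: "integrable (gaussian d) (\<lambda>z. norm (G (x + z)))"
    using C11D(1)[OF h] by (intro integrable_heat[OF d, where B = L and f = "\<lambda>x. norm (G x)"]) auto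
  have int\<psi>: "integrable (gaussian d) (\<lambda>z. \<psi> (x + z))"
    using bd by (intro integrable_heat[OF d, where B = B']) auto
  have c: "c \<in> {lo..hi}" unfolding c_def by (intro heat_in_interval[OF d] hI) measurable
  obtain a b where b: "0 \<le> b"
    and sup: "\<And>c' r'. c' \<in> {lo..hi} \<Longrightarrow> 0 \<le> r' \<Longrightarrow> q c * r\<^sup>2 + a * (c' - c) + b * (r' - r) \<le> q c' * r'\<^sup>2"
    using q_support[OF c, of r] unfolding r_def by (metis norm_ge_zero)
  have "r \<le> (\<integral>z. norm (G (x + z)) \<partial>gaussian d)"
    unfolding r_def heat_def by (rule integral_norm_bound)
  then have "q c * r\<^sup>2 \<le> q c * r\<^sup>2 + a * (heat d h x - c) + b * ((\<integral>z. norm (G (x + z)) \<partial>gaussian d) - r)"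
    using b by (simp add: c_def)
  also have "\<dots> = (\<integral>z. q c * r\<^sup>2 + a * (h (x + z) - c) + b * (norm (G (x + z)) - r) \<partial>gaussian d)"
    unfolding heat_def using inth intG by (simp add: d)
  also have "\<dots> \<le> (\<integral>z. \<psi> (x + z) \<partial>gaussian d)"
    using inth intG int\<psi> order_trans[OF sup[OF hI norm_ge_zero] q\<psi>]
    by (intro integral_mono) auto
  finally show ?thesis by (simp add: c_def r_def heat_def)
qed

text \<open>The heat flow is cut into \<open>n\<close> steps of length \<open>d = t / n\<close>. Each step loses at most \<open>d\<close> times the
  energy at that time, which is at most the average of the initial energy bound \<open>\<psi>\<close>. The errors add
  up to \<open>n\<close> times \<open>d powr (3 / 2)\<close>, which vanishes as \<open>n\<close> grows.\<close>

theorem heat_phi_le: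
  fixes h :: "real^'n::finite \<Rightarrow> real"
  assumes t: "t > 0" and h: "C11 L M h G" and hI: "\<And>x. h x \<in> {lo..hi}"
    and q\<psi>: "\<And>x. q (h x) * (norm (G x))\<^sup>2 \<le> \<psi> x"
    and lip: "\<And>x y. \<bar>\<psi> y - \<psi> x\<bar> \<le> D * norm (y - x)" and bd: "\<And>x. \<bar>\<psi> x\<bar> \<le> B'"
  shows "heat t (\<lambda>x. \<phi> (h x)) x \<le> \<phi> (heat t h x) + t * heat t \<psi> x"
proof -
  obtain E where E: "\<And>d (h :: real^'n::finite \<Rightarrow> real) G \<psi> B' x.
     d > 0 \<Longrightarrow> C11 L M h G \<Longrightarrow> (\<And>x. h x \<in> {lo..hi}) \<Longrightarrow>
     (\<And>x. q (h x) * (norm (G x))\<^sup>2 \<le> \<psi> x) \<Longrightarrow>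
     (\<And>x y. \<bar>\<psi> y - \<psi> x\<bar> \<le> D * norm (y - x)) \<Longrightarrow> (\<And>x. \<bar>\<psi> x\<bar> \<le> B') \<Longrightarrow>
     heat d (\<lambda>x. \<phi> (h x)) x \<le> \<phi> (heat d h x) + d * heat d \<psi> x + E * sqrt d ^ 3"
    using heat_phi_small_time[where L = L and M = M and D = D] by blast
  \<comment> \<open>The induction takes out the first step: \<open>h\<close>, \<open>G\<close> and \<open>\<psi>\<close> are replaced by their averages over
    time \<open>d\<close>, which satisfy the same assumptions with the same constants.\<close>
  have steps: "heat (real (Suc n) * d) (\<lambda>x. \<phi> (h x)) x \<le> \<phi> (heat (real (Suc n) * d) h x)
      + real (Suc n) * d * heat (real (Suc n) * d) \<psi> x + real (Suc n) * (E * sqrt d ^ 3)"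
    if d: "d > 0" and "C11 L M h G" "\<And>x. h x \<in> {lo..hi}" "\<And>x. q (h x) * (norm (G x))\<^sup>2 \<le> \<psi> x"
      "\<And>x y. \<bar>\<psi> y - \<psi> x\<bar> \<le> D * norm (y - x)" "\<And>x. \<bar>\<psi> x\<bar> \<le> B'"
    for n d h G \<psi>
    using that(2-)
  proof (induction n arbitrary: h G \<psi>)
    case 0
    then show ?case using E[OF d, of h G \<psi> B' x] by simp
  next
    case (Suc n)
    note h = Suc.prems(1) and hI = Suc.prems(2) and bd = Suc.prems(5)
    define s where "s = real (Suc n) * d"
    have s: "s > 0" using d by (simp add: s_def)
    have sd: "real (Suc (Suc n)) * d = s + d" by (simp add: s_def algebra_simps)
    note [measurable] = C11D(5,6)[OF h]
    have [measurable]: "\<psi> \<in> borel_measurable borel"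
      using Suc.prems(4) by (intro borel_measurable_Lipschitz[where L = D]) simp
    have hb: "\<bar>h x\<bar> \<le> \<bar>lo\<bar> + \<bar>hi\<bar>" for x using hI[of x] by auto
    have [measurable]: "heat d h \<in> borel_measurable borel" "heat d \<psi> \<in> borel_measurable borel"
      "heat d (\<lambda>x. \<phi> (h x)) \<in> borel_measurable borel"
      by (intro borel_measurable_heat d; measurable)+
    have hI': "heat d h x \<in> {lo..hi}" for x by (intro heat_in_interval[OF d] hI) measurable
    have \<psi>b: "\<bar>heat d \<psi> x\<bar> \<le> B'" for x
      using norm_heat_le[OF d, of \<psi> B' x] bd by simp
    have phib: "\<bar>heat d (\<lambda>x. \<phi> (h x)) x\<bar> \<le> B" for x
      using norm_heat_le[OF d, of "\<lambda>x. \<phi> (h x)" B x] phi_bounded[OF hI] by simp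
    have IH: "heat s (\<lambda>x. \<phi> (heat d h x)) x \<le> \<phi> (heat s (heat d h) x)
        + s * heat s (heat d \<psi>) x + real (Suc n) * (E * sqrt d ^ 3)"
      unfolding s_def
    proof (rule Suc.IH)
      show "C11 L M (heat d h) (heat d G)" by (rule C11_heat[OF d h hb])
      show "\<bar>heat d \<psi> y - heat d \<psi> x\<bar> \<le> D * norm (y - x)" for x y
        using heat_Lipschitz[OF d, of \<psi> B' D y x] bd Suc.prems(4) by simp
      show "q (heat d h x) * (norm (heat d G x))\<^sup>2 \<le> heat d \<psi> x" for x
        by (rule heat_q_support[OF d h hI Suc.prems(3) _ bd]) measurable
    qed (fact hI' \<psi>b)+
    let ?u = "\<lambda>x. \<phi> (heat d h x) + d * heat d \<psi> x + E * sqrt d ^ 3"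
    have "heat (s + d) (\<lambda>x. \<phi> (h x)) x = heat s (heat d (\<lambda>x. \<phi> (h x))) x"
      using phi_bounded[OF hI] by (intro heat_heat[OF s d, symmetric, where B = B]) auto
    also have "\<dots> \<le> heat s ?u x"
    proof (rule heat_mono[OF s, where B = B and B' = "B + d * B' + \<bar>E * sqrt d ^ 3\<bar>"])
      fix x
      show "heat d (\<lambda>x. \<phi> (h x)) x \<le> ?u x"
        using E[OF d h hI Suc.prems(3,4) bd] .
      have "\<bar>d * heat d \<psi> x\<bar> \<le> d * B'" using \<psi>b d by (simp add: abs_mult)
      with phi_bounded[OF hI'[of x]]
      show "\<bar>?u x\<bar> \<le> B + d * B' + \<bar>E * sqrt d ^ 3\<bar>" by linarith
    qed (use phib in measurable)
    also have "\<dots> = heat s (\<lambda>x. \<phi> (heat d h x)) x + d * heat s (heat d \<psi>) x + E * sqrt d ^ 3"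
    proof -
      interpret prob_space "gaussian s :: (real^'n) measure" by (rule prob_space_gaussian[OF s])
      have "integrable (gaussian s) (\<lambda>z. \<phi> (heat d h (x + z)))"
        using phi_bounded[OF hI'] by (intro integrable_heat[OF s, where B = B]) auto
      moreover have "integrable (gaussian s) (\<lambda>z. heat d \<psi> (x + z))"
        using \<psi>b by (intro integrable_heat[OF s, where B = B']) auto
      ultimately show ?thesis
        unfolding heat_def[of s] by (simp add: s)
    qed
    also note IH
    also have "heat s (heat d h) x = heat (s + d) h x" by (rule heat_heat[OF s d _ hb]) measurable
    also have "heat s (heat d \<psi>) x = heat (s + d) \<psi> x" by (rule heat_heat[OF s d _ bd]) measurable
    finally show ?case
      unfolding sd by (simp add: algebra_simps s_def)
  qed
  have "(\<lambda>n. E * t * sqrt (t * inverse (real (Suc n)))) \<longlonglongrightarrow> E * t * sqrt (t * 0)"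
    by (intro tendsto_intros LIMSEQ_inverse_real_of_nat)
  then have "(\<lambda>n. \<phi> (heat t h x) + t * heat t \<psi> x + E * t * sqrt (t * inverse (real (Suc n))))
      \<longlonglongrightarrow> \<phi> (heat t h x) + t * heat t \<psi> x + E * t * sqrt (t * 0)"
    by (intro tendsto_add tendsto_const)
  moreover have "heat t (\<lambda>x. \<phi> (h x)) x
      \<le> \<phi> (heat t h x) + t * heat t \<psi> x + E * t * sqrt (t * inverse (real (Suc n)))" for n
  proof -
    define d where "d = t * inverse (real (Suc n))"
    have d: "d > 0" and nd: "real (Suc n) * d = t" using t by (auto simp: d_def)
    have "real (Suc n) * (E * sqrt d ^ 3) = E * (real (Suc n) * d) * sqrt d"
      using d by (simp add: power3_eq_cube)
    then have eq: "real (Suc n) * (E * sqrt d ^ 3) = E * t * sqrt d" unfolding nd .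
    show ?thesis
      using steps[OF d h hI q\<psi> lip bd, of n] unfolding nd eq d_def[symmetric] .
  qed
  ultimately show ?thesis
    by (intro LIMSEQ_le_const[where X = "\<lambda>n. \<phi> (heat t h x) + t * heat t \<psi> x
        + E * t * sqrt (t * inverse (real (Suc n)))"]) auto
qed

end

text \<open>For the square, which gives the Poincare inequality, the second-order expansion is exact and
  \<open>q\<close> is constant.\<close>

lemma entropy_function_square:
  "entropy_function (\<lambda>y. y\<^sup>2) (\<lambda>y. 2 * y) (\<lambda>_. 1) (- B) B 0 1 (B\<^sup>2)"
proof
  fix c y :: real
  show "y \<in> {- B..B} \<Longrightarrow> \<bar>y\<^sup>2\<bar> \<le> B\<^sup>2"
    using abs_le_square_iff[of y B] by (auto simp: abs_if split: if_splits)
  have "y\<^sup>2 - (c\<^sup>2 + 2 * c * (y - c)) = (y - c)\<^sup>2"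
    by (simp add: power2_eq_square algebra_simps)
  then show "c\<^sup>2 + 2 * c * (y - c) \<le> y\<^sup>2" "y\<^sup>2 \<le> c\<^sup>2 + 2 * c * (y - c) + 1 * (y - c)\<^sup>2 + 0 * \<bar>y - c\<bar> ^ 3"
    using zero_le_power2[of "y - c"] by linarith+
next
  fix c r :: real assume r: "0 \<le> r"
  have "1 * r\<^sup>2 + 0 * (c' - c) + 2 * r * (r' - r) \<le> 1 * r'\<^sup>2" for c' r' :: real
    using zero_le_power2[of "r' - r"] by (simp add: power2_eq_square algebra_simps)
  with r show "\<exists>a b. 0 \<le> b \<and> (\<forall>c'\<in>{- B..B}. \<forall>r'\<ge>0. 1 * r\<^sup>2 + a * (c' - c) + b * (r' - r) \<le> 1 * r'\<^sup>2)"
    by (intro exI[of _ 0] exI[of _ "2 * r"]) auto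
qed auto

lemma norm_power2_Lipschitz:
  fixes F :: "'a::real_normed_vector \<Rightarrow> 'b::real_normed_vector"
  assumes bd: "\<And>x. norm (F x) \<le> L" and lip: "\<And>x y. norm (F y - F x) \<le> M * norm (y - x)"
  shows "\<bar>(norm (F y))\<^sup>2 - (norm (F x))\<^sup>2\<bar> \<le> (2 * L * M) * norm (y - x)"
proof -
  have "\<bar>(norm (F y))\<^sup>2 - (norm (F x))\<^sup>2\<bar> = (norm (F y) + norm (F x)) * \<bar>norm (F y) - norm (F x)\<bar>"
    by (simp add: power2_eq_square square_diff_square_factored abs_mult)
  also have "\<dots> \<le> (2 * L) * (M * norm (y - x))"
    using bd[of x] bd[of y] norm_triangle_ineq3[of "F y" "F x"] lip[of y x] norm_ge_zero[of "F x"]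
    by (intro mult_mono) linarith+
  finally show ?thesis by (simp add: mult_ac)
qed

theorem gaussian_poincare:
  fixes f :: "real^'n::finite \<Rightarrow> real"
  assumes t: "t > 0" and f: "C11 L M f F" and bd: "\<And>x. \<bar>f x\<bar> \<le> B"
  shows "heat t (\<lambda>x. (f x)\<^sup>2) x \<le> (heat t f x)\<^sup>2 + t * heat t (\<lambda>x. (norm (F x))\<^sup>2) x"
proof -
  interpret entropy_function "\<lambda>y. y\<^sup>2" "\<lambda>y. 2 * y" "\<lambda>_. 1" "- B" B 0 1 "B\<^sup>2"
    by (rule entropy_function_square)
  show ?thesis
  proof (rule heat_phi_le[OF t f])
    show "f x \<in> {- B..B}" for x using bd[of x] by auto
    show "\<bar>(norm (F y))\<^sup>2 - (norm (F x))\<^sup>2\<bar> \<le> (2 * L * M) * norm (y - x)" for x y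
      using C11D(1,3)[OF f] by (intro norm_power2_Lipschitz) auto
    show "\<bar>(norm (F x))\<^sup>2\<bar> \<le> L\<^sup>2" for x
      using C11D(1)[OF f, of x] by (simp add: power_mono)
  qed simp
qed

lemma ln_add_one_le_cubic:
  fixes u :: real
  assumes u: "u > -1"
  shows "ln (1 + u) \<le> u - u\<^sup>2 / 2 + u ^ 3 / 3"
proof -
  define g where "g u = u - u\<^sup>2 / 2 + u ^ 3 / 3 - ln (1 + u)" for u :: real
  have der: "(g has_real_derivative x ^ 3 / (1 + x)) (at x)" if "x > -1" for x
    unfolding g_def using that
    by (auto intro!: derivative_eq_intros simp: field_simps power2_eq_square power3_eq_cube)
  have "g u \<ge> g 0"
  proof (cases "u \<ge> 0")
    case True
    show ?thesis
    proof (rule DERIV_nonneg_imp_nondecreasing[OF True])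
      fix x :: real assume "0 \<le> x"
      then show "\<exists>y. (g has_real_derivative y) (at x) \<and> 0 \<le> y"
        using der[of x] by (intro exI[of _ "x ^ 3 / (1 + x)"]) auto
    qed
  next
    case False
    show ?thesis
    proof (rule DERIV_nonpos_imp_nonincreasing[of u 0 g])
      fix x assume "u \<le> x" "x \<le> 0"
      then show "\<exists>y. (g has_real_derivative y) (at x) \<and> y \<le> 0"
        using der[of x] u by (intro exI[of _ "x ^ 3 / (1 + x)"])
          (auto simp: divide_nonpos_pos power_le_zero_eq)
    qed (use False in auto)
  qed
  then show ?thesis by (simp add: g_def)
qed

text \<open>With \<open>y = c * (1 + u)\<close>, the upper bound reduces to the cubic upper bound for \<open>ln (1 + u)\<close>, since
  \<open>u\<close> is bounded on the interval. The supporting planes are those of \<open>r\<^sup>2 / c\<close>, which is homogeneous of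
  degree one.\<close>

lemma entropy_function_x_ln_x:
  assumes e: "0 < e"
  shows "entropy_function (\<lambda>y. y * ln y) (\<lambda>y. ln y + 1) (\<lambda>y. 1 / (2 * y)) e B
    ((1 + \<bar>B\<bar> / e) / e\<^sup>2) (1 / (2 * e)) (\<bar>B\<bar> * (\<bar>ln e\<bar> + \<bar>ln B\<bar>))"
proof
  fix c y :: real
  show "\<bar>y * ln y\<bar> \<le> \<bar>B\<bar> * (\<bar>ln e\<bar> + \<bar>ln B\<bar>)" if "y \<in> {e..B}"
  proof -
    have "ln e \<le> ln y" "ln y \<le> ln B" using that e by auto
    then have "\<bar>ln y\<bar> \<le> \<bar>ln e\<bar> + \<bar>ln B\<bar>" by linarith
    then show ?thesis unfolding abs_mult using that e by (intro mult_mono) auto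
  qed
  assume c: "c \<in> {e..B}"
  then have c0: "c > 0" using e by auto
  show "0 \<le> 1 / (2 * c) \<and> 1 / (2 * c) \<le> 1 / (2 * e)"
    using c e by (auto intro!: divide_left_mono)
  assume y: "y \<in> {e..B}"
  then have y0: "y > 0" using e by auto
  have "ln (c / y) \<le> c / y - 1" using c0 y0 by (intro ln_le_minus_one) simp
  then have "y * (ln c - ln y) \<le> y * (c / y - 1)" using c0 y0 by (simp add: ln_div)
  also have "\<dots> = c - y" using y0 by (simp add: field_simps)
  finally show "c * ln c + (ln c + 1) * (y - c) \<le> y * ln y" by (simp add: algebra_simps)
  define u where "u = (y - c) / c"
  have yu: "y = c * (1 + u)" using c0 by (simp add: u_def field_simps)
  have u1: "u > -1" using yu y0 c0 by (simp add: zero_less_mult_iff)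
  have uR: "\<bar>u\<bar> \<le> \<bar>B\<bar> / e"
  proof -
    have "\<bar>u\<bar> = \<bar>y - c\<bar> / c" using c0 by (simp add: u_def)
    also have "\<dots> \<le> \<bar>B\<bar> / e" using c y e by (intro frac_le) auto
    finally show ?thesis .
  qed
  define R where "R = 1 + \<bar>B\<bar> / e"
  have "(1 + u) * ln (1 + u) \<le> (1 + u) * (u - u\<^sup>2 / 2 + u ^ 3 / 3)"
    using u1 by (intro mult_left_mono ln_add_one_le_cubic) auto
  also have "\<dots> = u + u\<^sup>2 / 2 + (u ^ 3 * (2 * u - 1)) / 6"
    by (simp add: power2_eq_square power3_eq_cube field_simps)
  also have "u ^ 3 * (2 * u - 1) \<le> \<bar>u ^ 3\<bar> * \<bar>2 * u - 1\<bar>"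
    by (metis abs_ge_self abs_mult)
  also have "\<dots> \<le> \<bar>u\<bar> ^ 3 * (6 * R)"
    using uR by (intro mult_mono) (auto simp: power_abs R_def)
  finally have main: "(1 + u) * ln (1 + u) \<le> u + u\<^sup>2 / 2 + (1 + \<bar>B\<bar> / e) * \<bar>u\<bar> ^ 3"
    unfolding R_def[symmetric] by (simp add: mult.commute)
  have "ln y = ln c + ln (1 + u)"
    unfolding yu using c0 u1 by (intro ln_mult_pos) auto
  then have "y * ln y = y * ln c + c * ((1 + u) * ln (1 + u))"
    by (simp only: distrib_left) (simp add: yu mult.assoc)
  also have "\<dots> \<le> y * ln c + c * (u + u\<^sup>2 / 2 + (1 + \<bar>B\<bar> / e) * \<bar>u\<bar> ^ 3)"
    using c0 main by (intro add_left_mono mult_left_mono) auto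
  also have "\<dots> = c * ln c + (ln c + 1) * (y - c) + c * u\<^sup>2 / 2 + (1 + \<bar>B\<bar> / e) * (c * \<bar>u\<bar> ^ 3)"
    unfolding yu by (simp add: algebra_simps)
  also have "c * u\<^sup>2 / 2 = 1 / (2 * c) * (y - c)\<^sup>2"
    using c0 by (simp add: u_def power2_eq_square)
  also have "(1 + \<bar>B\<bar> / e) * (c * \<bar>u\<bar> ^ 3) \<le> (1 + \<bar>B\<bar> / e) * (\<bar>y - c\<bar> ^ 3 / e\<^sup>2)"
  proof (intro mult_left_mono)
    have "c * \<bar>u\<bar> ^ 3 = \<bar>y - c\<bar> ^ 3 / c\<^sup>2"
      using c0 by (simp add: u_def power_divide power3_eq_cube power2_eq_square)
    also have "\<dots> \<le> \<bar>y - c\<bar> ^ 3 / e\<^sup>2"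
      using c e by (intro divide_left_mono power_mono) auto
    finally show "c * \<bar>u\<bar> ^ 3 \<le> \<bar>y - c\<bar> ^ 3 / e\<^sup>2" .
  qed (use e in auto)
  finally show "y * ln y \<le> c * ln c + (ln c + 1) * (y - c) + 1 / (2 * c) * (y - c)\<^sup>2
      + (1 + \<bar>B\<bar> / e) / e\<^sup>2 * \<bar>y - c\<bar> ^ 3"
    by simp
next
  fix c r :: real assume c: "c \<in> {e..B}" and r: "0 \<le> r"
  then have c0: "c > 0" using e by auto
  have "1 / (2 * c) * r\<^sup>2 + (- r\<^sup>2 / (2 * c\<^sup>2)) * (c' - c) + r / c * (r' - r) \<le> 1 / (2 * c') * r'\<^sup>2"
    if c': "c' \<in> {e..B}" for c' r'
  proof -
    have c'0: "c' > 0" using c' e by auto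
    have "0 \<le> (r' - c' * (r / c))\<^sup>2 / (2 * c')" using c'0 by simp
    also have "\<dots> = 1 / (2 * c') * r'\<^sup>2 - (1 / (2 * c) * r\<^sup>2 + (- r\<^sup>2 / (2 * c\<^sup>2)) * (c' - c) + r / c * (r' - r))"
      using c0 c'0 by (simp add: field_simps power2_eq_square)
    finally show ?thesis by simp
  qed
  then show "\<exists>a b. 0 \<le> b \<and> (\<forall>c'\<in>{e..B}. \<forall>r'\<ge>0. 1 / (2 * c) * r\<^sup>2 + a * (c' - c) + b * (r' - r) \<le> 1 / (2 * c') * r'\<^sup>2)"
    using c0 r by (intro exI[of _ "- r\<^sup>2 / (2 * c\<^sup>2)"] exI[of _ "r / c"]) auto
qed (use e in auto)

lemma C11_square_add:
  fixes f :: "real^'n::finite \<Rightarrow> real"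
  assumes f: "C11 L M f F" and bd: "\<And>x. \<bar>f x\<bar> \<le> B"
  shows "C11 (2 * B * L) (2 * B * M + 2 * L\<^sup>2) (\<lambda>x. (f x)\<^sup>2 + e) (\<lambda>x. (2 * f x) *\<^sub>R F x)"
  unfolding C11_def
proof (intro conjI allI)
  fix x y :: "real^'n"
  let ?z = "norm (y - x)"
  have B: "B \<ge> 0" using bd[of x] by linarith
  have L: "L \<ge> 0" and M: "M \<ge> 0" using C11_nonneg[OF f] by auto
  note f' = C11D(1-4)[OF f]
  show "norm ((2 * f x) *\<^sub>R F x) \<le> 2 * B * L"
    using mult_mono[OF bd f'(1) B norm_ge_zero] by (simp add: abs_mult)
  have "\<bar>((f y)\<^sup>2 + e) - ((f x)\<^sup>2 + e)\<bar> = \<bar>f y - f x\<bar> * \<bar>f y + f x\<bar>"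
    by (simp add: power2_eq_square square_diff_square_factored abs_mult mult.commute)
  also have "\<dots> \<le> (L * ?z) * (2 * B)"
    using f'(2) bd[of x] bd[of y] L by (intro mult_mono) auto
  finally show "\<bar>((f y)\<^sup>2 + e) - ((f x)\<^sup>2 + e)\<bar> \<le> 2 * B * L * ?z" by (simp add: mult_ac)
  have "(2 * f y) *\<^sub>R F y - (2 * f x) *\<^sub>R F x = (2 * (f y - f x)) *\<^sub>R F y + (2 * f x) *\<^sub>R (F y - F x)"
    by (simp add: algebra_simps)
  also have "norm \<dots> \<le> norm ((2 * (f y - f x)) *\<^sub>R F y) + norm ((2 * f x) *\<^sub>R (F y - F x))"
    by (rule norm_triangle_ineq)
  also have "\<dots> = 2 * (\<bar>f y - f x\<bar> * norm (F y)) + 2 * (\<bar>f x\<bar> * norm (F y - F x))"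
    by (simp only: norm_scaleR abs_mult abs_numeral mult.assoc)
  also have "\<dots> \<le> 2 * ((L * ?z) * L) + 2 * (B * (M * ?z))"
    using f' bd L B by (intro add_mono mult_left_mono mult_mono) auto
  finally show "norm ((2 * f y) *\<^sub>R F y - (2 * f x) *\<^sub>R F x) \<le> (2 * B * M + 2 * L\<^sup>2) * ?z"
    by (simp add: algebra_simps power2_eq_square)
  have "((f y)\<^sup>2 + e) - ((f x)\<^sup>2 + e) - ((2 * f x) *\<^sub>R F x) \<bullet> (y - x)
      = 2 * f x * (f y - f x - F x \<bullet> (y - x)) + (f y - f x)\<^sup>2"
    by (simp add: algebra_simps power2_eq_square)
  also have "\<bar>\<dots>\<bar> \<le> 2 * (\<bar>f x\<bar> * \<bar>f y - f x - F x \<bullet> (y - x)\<bar>) + \<bar>f y - f x\<bar>\<^sup>2"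
    by (rule order_trans[OF abs_triangle_ineq]) (simp add: abs_mult)
  also have "\<dots> \<le> 2 * (B * (M * ?z\<^sup>2)) + (L * ?z)\<^sup>2"
    using f'(2,4) bd B by (intro add_mono mult_left_mono mult_mono power_mono) auto
  also have "\<dots> \<le> (2 * B * M + 2 * L\<^sup>2) * ?z\<^sup>2"
    by (simp add: algebra_simps power_mult_distrib)
  finally show "\<bar>((f y)\<^sup>2 + e) - ((f x)\<^sup>2 + e) - ((2 * f x) *\<^sub>R F x) \<bullet> (y - x)\<bar> \<le> (2 * B * M + 2 * L\<^sup>2) * ?z\<^sup>2" .
qed

lemma continuous_on_x_ln_x: "continuous_on {0..} (\<lambda>x::real. x * ln x)"
proof -
  have "continuous (at x within {0..}) (\<lambda>x::real. x * ln x)" if "x \<ge> 0" for x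
  proof (cases "x = 0")
    case True
    have "((\<lambda>x::real. x * ln x) \<longlongrightarrow> 0) (at_right 0)" by real_asymp
    moreover have "(at 0 within {0..}) = (at_right (0::real))"
      by (rule at_within_nhd[of _ UNIV]) auto
    ultimately show ?thesis using True by (simp add: continuous_within)
  next
    case False
    then have "isCont (\<lambda>x. x * ln x) x" by (intro isCont_mult continuous_ident isCont_ln)
    then show ?thesis by (rule continuous_at_imp_continuous_at_within)
  qed
  then show ?thesis by (simp add: continuous_on_eq_continuous_within)
qed

lemma abs_x_ln_x_le:
  fixes y :: real
  assumes "0 \<le> y" "y \<le> B"
  shows "\<bar>y * ln y\<bar> \<le> 1 + B\<^sup>2"
proof (cases "y = 0")
  case False
  then have y: "y > 0" using assms by simp
  have "y * ln y \<le> y * (y - 1)" using y by (intro mult_left_mono ln_le_minus_one) auto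
  also have "\<dots> \<le> y\<^sup>2" using y by (simp add: algebra_simps power2_eq_square)
  also have "y\<^sup>2 \<le> B\<^sup>2" using assms by (intro power_mono) auto
  finally have 1: "y * ln y \<le> B\<^sup>2" .
  have "ln (1 / y) \<le> 1 / y - 1" using y by (intro ln_le_minus_one) auto
  then have "y * - ln y \<le> y * (1 / y - 1)" using y by (intro mult_left_mono) (auto simp: ln_div)
  also have "\<dots> \<le> 1" using y by (simp add: field_simps)
  finally have "- (y * ln y) \<le> 1" by simp
  with 1 show ?thesis by (smt (verit) zero_le_power2)
qed auto

text \<open>Adding \<open>e > 0\<close> keeps \<open>f\<^sup>2\<close> away from \<open>0\<close>, where \<open>1 / (2 * y)\<close> is singular. The energy of \<open>f\<^sup>2 + e\<close> is
  at most \<open>2 * (norm F)\<^sup>2\<close> for every \<open>e\<close>, and \<open>e\<close> tends to \<open>0\<close> at the end.\<close>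

theorem gaussian_log_sobolev:
  fixes f :: "real^'n::finite \<Rightarrow> real"
  assumes t: "t > 0" and f: "C11 L M f F" and bd: "\<And>x. \<bar>f x\<bar> \<le> B"
  shows "heat t (\<lambda>x. (f x)\<^sup>2 * ln ((f x)\<^sup>2)) x
    \<le> heat t (\<lambda>x. (f x)\<^sup>2) x * ln (heat t (\<lambda>x. (f x)\<^sup>2) x) + 2 * t * heat t (\<lambda>x. (norm (F x))\<^sup>2) x"
proof -
  interpret prob_space "gaussian t :: (real^'n) measure" by (rule prob_space_gaussian[OF t])
  note [measurable] = C11D(5,6)[OF f]
  define \<phi> where "\<phi> y = y * ln y" for y :: real
  have [measurable]: "\<phi> \<in> borel_measurable borel" unfolding \<phi>_def by measurable
  define h where "h e y = (f y)\<^sup>2 + e" for e y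
  have [measurable]: "h e \<in> borel_measurable borel" for e unfolding h_def by measurable
  have f2: "(f y)\<^sup>2 \<le> B\<^sup>2" for y using bd[of y] by (simp add: abs_le_square_iff[symmetric])
  have F2: "\<bar>(norm (F y))\<^sup>2\<bar> \<le> L\<^sup>2" for y using C11D(1)[OF f, of y] by (simp add: power_mono)
  have intF: "integrable (gaussian t) (\<lambda>z. (norm (F (x + z)))\<^sup>2)"
    using F2 by (intro integrable_heat[OF t, where B = "L\<^sup>2" and f = "\<lambda>y. (norm (F y))\<^sup>2"]) auto
  have pos: "heat t (\<lambda>y. \<phi> (h e y)) x
      \<le> \<phi> (heat t (h e) x) + 2 * t * heat t (\<lambda>x. (norm (F x))\<^sup>2) x" if e: "e > 0" for e
  proof -
    interpret entropy_function "\<lambda>y. y * ln y" "\<lambda>y. ln y + 1" "\<lambda>y. 1 / (2 * y)" e "B\<^sup>2 + e"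
      "(1 + \<bar>B\<^sup>2 + e\<bar> / e) / e\<^sup>2" "1 / (2 * e)" "\<bar>B\<^sup>2 + e\<bar> * (\<bar>ln e\<bar> + \<bar>ln (B\<^sup>2 + e)\<bar>)"
      by (rule entropy_function_x_ln_x[OF e])
    have "heat t (\<lambda>y. h e y * ln (h e y)) x
        \<le> heat t (h e) x * ln (heat t (h e) x) + t * heat t (\<lambda>x. 2 * (norm (F x))\<^sup>2) x"
    proof (rule heat_phi_le[OF t])
      show "C11 (2 * B * L) (2 * B * M + 2 * L\<^sup>2) (h e) (\<lambda>x. (2 * f x) *\<^sub>R F x)"
        unfolding h_def by (rule C11_square_add[OF f bd])
      show "h e y \<in> {e..B\<^sup>2 + e}" for y using f2[of y] by (simp add: h_def)
      show "1 / (2 * h e y) * (norm ((2 * f y) *\<^sub>R F y))\<^sup>2 \<le> 2 * (norm (F y))\<^sup>2" for y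
      proof -
        have "1 / (2 * h e y) * (norm ((2 * f y) *\<^sub>R F y))\<^sup>2 = ((f y)\<^sup>2 / h e y) * (2 * (norm (F y))\<^sup>2)"
          by (simp add: power_mult_distrib)
        also have "\<dots> \<le> 1 * (2 * (norm (F y))\<^sup>2)"
          using e by (intro mult_right_mono) (auto simp: h_def divide_le_eq_1 add_nonneg_pos)
        finally show ?thesis by simp
      qed
      show "\<bar>2 * (norm (F y))\<^sup>2 - 2 * (norm (F x))\<^sup>2\<bar> \<le> (2 * (2 * L * M)) * norm (y - x)" for x y
        using norm_power2_Lipschitz[of F L M y x] C11D(1,3)[OF f] by (simp add: abs_if split: if_splits)
      show "\<bar>2 * (norm (F y))\<^sup>2\<bar> \<le> 2 * L\<^sup>2" for y using F2[of y] by simp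
    qed
    then show ?thesis using intF by (simp add: \<phi>_def heat_def)
  qed
  define e where "e n = inverse (real (Suc n))" for n
  have e: "e n > 0" "e n \<le> 1" "e \<longlonglongrightarrow> 0" for n
    unfolding e_def using LIMSEQ_inverse_real_of_nat by (auto simp: inverse_le_1_iff)
  have \<phi>_lim: "(\<lambda>n. \<phi> (y + e n)) \<longlonglongrightarrow> \<phi> y" if "y \<ge> 0" for y
    unfolding \<phi>_def
  proof (rule continuous_on_tendsto_compose[OF continuous_on_x_ln_x])
    show "(\<lambda>n. y + e n) \<longlonglongrightarrow> y" using tendsto_add[OF tendsto_const e(3), of y] by simp
    show "\<forall>\<^sub>F n in sequentially. y + e n \<in> {0..}"
      using that e(1) by (intro always_eventually) (auto intro: add_nonneg_nonneg less_imp_le)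
  qed (use that in auto)
  have "(\<lambda>n. heat t (\<lambda>y. \<phi> (h (e n) y)) x) \<longlonglongrightarrow> heat t (\<lambda>y. \<phi> ((f y)\<^sup>2)) x"
    unfolding heat_def
  proof (rule integral_dominated_convergence[where w = "\<lambda>_. 1 + (B\<^sup>2 + 1)\<^sup>2"])
    show "AE z in gaussian t. (\<lambda>n. \<phi> (h (e n) (x + z))) \<longlonglongrightarrow> \<phi> ((f (x + z))\<^sup>2)"
      by (intro AE_I2) (simp add: h_def \<phi>_lim)
    show "AE z in gaussian t. norm (\<phi> (h (e n) (x + z))) \<le> 1 + (B\<^sup>2 + 1)\<^sup>2" for n
    proof (rule AE_I2)
      fix z
      have "h (e n) (x + z) \<le> B\<^sup>2 + 1" using f2[of "x + z"] e(2)[of n] by (simp add: h_def)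
      moreover have "0 \<le> h (e n) (x + z)" using e(1)[of n] by (simp add: h_def)
      ultimately show "norm (\<phi> (h (e n) (x + z))) \<le> 1 + (B\<^sup>2 + 1)\<^sup>2"
        unfolding \<phi>_def real_norm_def by (intro abs_x_ln_x_le)
    qed
  qed auto
  moreover have "(\<lambda>n. \<phi> (heat t (h (e n)) x) + 2 * t * heat t (\<lambda>x. (norm (F x))\<^sup>2) x)
      \<longlonglongrightarrow> \<phi> (heat t (\<lambda>x. (f x)\<^sup>2) x) + 2 * t * heat t (\<lambda>x. (norm (F x))\<^sup>2) x"
  proof (intro tendsto_add tendsto_const)
    have "integrable (gaussian t) (\<lambda>z. (f (x + z))\<^sup>2)"
      using f2 by (intro integrable_heat[OF t, where B = "B\<^sup>2" and f = "\<lambda>y. (f y)\<^sup>2"]) auto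
    then have "heat t (h (e n)) x = heat t (\<lambda>x. (f x)\<^sup>2) x + e n" for n
      by (simp add: heat_def h_def t)
    moreover have "0 \<le> heat t (\<lambda>x. (f x)\<^sup>2) x" by (simp add: heat_def)
    ultimately show "(\<lambda>n. \<phi> (heat t (h (e n)) x)) \<longlonglongrightarrow> \<phi> (heat t (\<lambda>x. (f x)\<^sup>2) x)"
      by (simp add: \<phi>_lim)
  qed
  ultimately show ?thesis
    using pos e(1) unfolding \<phi>_def[symmetric] by (intro LIMSEQ_le) auto
qed

section \<open>Comparison of Gaussian averages at different points\<close>

lemma integrable_mult_of_squares:
  fixes f g :: "'a \<Rightarrow> real"
  assumes f2: "integrable M (\<lambda>x. (f x)\<^sup>2)" and g2: "integrable M (\<lambda>x. (g x)\<^sup>2)"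
    and [measurable]: "f \<in> borel_measurable M" "g \<in> borel_measurable M"
  shows "integrable M (\<lambda>x. f x * g x)"
proof (rule Bochner_Integration.integrable_bound[OF Bochner_Integration.integrable_add[OF f2 g2]])
  have "\<bar>f x * g x\<bar> \<le> (f x)\<^sup>2 + (g x)\<^sup>2" for x
  proof -
    have "2 * \<bar>f x * g x\<bar> \<le> (f x)\<^sup>2 + (g x)\<^sup>2"
      using sum_squares_bound[of "\<bar>f x\<bar>" "\<bar>g x\<bar>"] by (simp add: abs_mult mult.assoc)
    then show ?thesis by linarith
  qed
  then show "AE x in M. norm (f x * g x) \<le> norm ((f x)\<^sup>2 + (g x)\<^sup>2)"
    by (auto intro!: AE_I2 simp: abs_of_nonneg)
qed measurable

lemma integral_Cauchy_Schwarz: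
  fixes f g :: "'a \<Rightarrow> real"
  assumes f2: "integrable M (\<lambda>x. (f x)\<^sup>2)" and g2: "integrable M (\<lambda>x. (g x)\<^sup>2)"
    and [measurable]: "f \<in> borel_measurable M" "g \<in> borel_measurable M"
  shows "(\<integral>x. f x * g x \<partial>M)\<^sup>2 \<le> (\<integral>x. (f x)\<^sup>2 \<partial>M) * (\<integral>x. (g x)\<^sup>2 \<partial>M)"
proof -
  have fg: "integrable M (\<lambda>x. f x * g x)"
    by (intro integrable_mult_of_squares f2 g2 assms(3,4))
  define a b c where "a = (\<integral>x. (f x)\<^sup>2 \<partial>M)" and "b = (\<integral>x. f x * g x \<partial>M)" and "c = (\<integral>x. (g x)\<^sup>2 \<partial>M)"
  have q: "0 \<le> a - 2 * l * b + l\<^sup>2 * c" for l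
  proof -
    have "0 \<le> (\<integral>x. (f x - l * g x)\<^sup>2 \<partial>M)" by (rule integral_nonneg_AE) simp
    also have "\<dots> = (\<integral>x. (f x)\<^sup>2 - 2 * l * (f x * g x) + l\<^sup>2 * (g x)\<^sup>2 \<partial>M)"
      by (intro arg_cong[where f = "integral\<^sup>L M"] ext) (simp add: power2_eq_square algebra_simps)
    also have "\<dots> = a - 2 * l * b + l\<^sup>2 * c"
      using f2 g2 fg by (simp add: a_def b_def c_def)
    finally show ?thesis .
  qed
  have c0: "c \<ge> 0" unfolding c_def by (rule integral_nonneg_AE) simp
  show ?thesis unfolding a_def[symmetric] b_def[symmetric] c_def[symmetric]
  proof (cases "c = 0")
    case True
    have "b = 0"
    proof (rule ccontr)
      assume "b \<noteq> 0"
      then show False using q[of "(a + 1) / (2 * b)"] True by simp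
    qed
    then show "b\<^sup>2 \<le> a * c" using True by simp
  next
    case False
    then have c: "c > 0" using c0 by simp
    have "0 \<le> c * (a - 2 * (b / c) * b + (b / c)\<^sup>2 * c)" using q[of "b / c"] c by (intro mult_nonneg_nonneg) auto
    also have "\<dots> = a * c - b\<^sup>2" using c by (simp add: field_simps power2_eq_square)
    finally show "b\<^sup>2 \<le> a * c" by simp
  qed
qed

text \<open>The density of \<open>N(x, t)\<close> with respect to \<open>N(x', t)\<close>, as a function of \<open>z\<close> at the point \<open>x' + z\<close>,
  with \<open>a = x - x'\<close>.\<close>

definition shift_density :: "real \<Rightarrow> real^'n::finite \<Rightarrow> real^'n \<Rightarrow> real" where
  "shift_density t a z = exp (a \<bullet> z / t - (norm a)\<^sup>2 / (2 * t))"

lemma shift_density_pos: "shift_density t a z > 0"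
  by (simp add: shift_density_def)

lemma borel_measurable_shift_density [measurable]: "shift_density t a \<in> borel_measurable borel"
  unfolding shift_density_def by measurable

lemma heat_eq_shift_density:
  assumes t: "t > 0" and [measurable]: "f \<in> borel_measurable borel"
  shows "heat t f x = (\<integral>z. f (x' + z) * shift_density t (x - x') z \<partial>gaussian t)"
  using gaussian_shift[OF t, of "\<lambda>z. f (x' + z)" "x - x'"]
  by (simp add: heat_def shift_density_def algebra_simps)

lemma integral_shift_density_power2:
  fixes a :: "real^'n::finite"
  assumes t: "t > 0"
  shows "integrable (gaussian t) (\<lambda>z. (shift_density t a z)\<^sup>2)"
    and "(\<integral>z. (shift_density t a z)\<^sup>2 \<partial>gaussian t) = exp ((norm a)\<^sup>2 / t)"
proof -
  have eq: "(shift_density t a z)\<^sup>2 = exp (((2 / t) *\<^sub>R a) \<bullet> z) * exp (- (norm a)\<^sup>2 / t)" for z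
    unfolding shift_density_def exp_of_nat_mult[of 2, symmetric, simplified] mult_exp_exp
    using t by (simp add: field_simps flip: exp_of_nat_mult)
  show "integrable (gaussian t) (\<lambda>z. (shift_density t a z)\<^sup>2)"
    unfolding eq by (intro integrable_mult_left gaussian_mgf(1)[OF t])
  have "(\<integral>z. (shift_density t a z)\<^sup>2 \<partial>gaussian t)
      = exp (t * (norm ((2 / t) *\<^sub>R a))\<^sup>2 / 2) * exp (- (norm a)\<^sup>2 / t)"
    unfolding eq using gaussian_mgf(2)[OF t, of "(2 / t) *\<^sub>R a"] by simp
  also have "\<dots> = exp ((norm a)\<^sup>2 / t)"
    unfolding mult_exp_exp using t by (simp add: power_mult_distrib power_divide field_simps power2_eq_square)
  finally show "(\<integral>z. (shift_density t a z)\<^sup>2 \<partial>gaussian t) = exp ((norm a)\<^sup>2 / t)" .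
qed

text \<open>Move the centre to \<open>x'\<close> by means of the relative density and apply Cauchy--Schwarz.\<close>

lemma heat_square_comparison:
  fixes f :: "real^'n::finite \<Rightarrow> real"
  assumes t: "t > 0" and [measurable]: "f \<in> borel_measurable borel" and bd: "\<And>x. \<bar>f x\<bar> \<le> B"
  shows "(heat t f x)\<^sup>2 \<le> exp ((norm (x - x'))\<^sup>2 / t) * heat t (\<lambda>y. (f y)\<^sup>2) x'"
proof -
  have f2: "\<bar>(f y)\<^sup>2\<bar> \<le> B\<^sup>2" for y
    using power_mono[OF bd abs_ge_zero, of y 2] by simp
  have "(heat t f x)\<^sup>2 \<le> (\<integral>z. (f (x' + z))\<^sup>2 \<partial>gaussian t) * (\<integral>z. (shift_density t (x - x') z)\<^sup>2 \<partial>gaussian t)"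
    unfolding heat_eq_shift_density[OF t assms(2), of x x']
    using f2 by (intro integral_Cauchy_Schwarz integral_shift_density_power2[OF t]
        integrable_heat[OF t, where B = "B\<^sup>2" and f = "\<lambda>y. (f y)\<^sup>2"]) auto
  then show ?thesis by (simp add: integral_shift_density_power2[OF t] heat_def mult.commute)
qed

text \<open>Both averages are moved to a third centre. As the two relative densities are positive, their
  squared difference is at most the sum of their squares.\<close>

lemma heat_difference_comparison:
  fixes f :: "real^'n::finite \<Rightarrow> real"
  assumes t: "t > 0" and [measurable]: "f \<in> borel_measurable borel" and bd: "\<And>x. \<bar>f x\<bar> \<le> B"
  shows "(heat t f x - heat t f x')\<^sup>2
    \<le> (exp ((norm (x - x''))\<^sup>2 / t) + exp ((norm (x' - x''))\<^sup>2 / t)) * heat t (\<lambda>y. (f y)\<^sup>2) x''"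
proof -
  define r where "r z = shift_density t (x - x'') z" for z
  define r' where "r' z = shift_density t (x' - x'') z" for z
  have [measurable]: "r \<in> borel_measurable borel" "r' \<in> borel_measurable borel"
    unfolding r_def r'_def by measurable
  have pos: "r z > 0" "r' z > 0" for z unfolding r_def r'_def by (rule shift_density_pos)+
  have r2: "integrable (gaussian t) (\<lambda>z. (r z)\<^sup>2)" "(\<integral>z. (r z)\<^sup>2 \<partial>gaussian t) = exp ((norm (x - x''))\<^sup>2 / t)"
    unfolding r_def by (rule integral_shift_density_power2[OF t])+
  have r'2: "integrable (gaussian t) (\<lambda>z. (r' z)\<^sup>2)" "(\<integral>z. (r' z)\<^sup>2 \<partial>gaussian t) = exp ((norm (x' - x''))\<^sup>2 / t)"
    unfolding r'_def by (rule integral_shift_density_power2[OF t])+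
  have f2: "\<bar>(f y)\<^sup>2\<bar> \<le> B\<^sup>2" for y
    using power_mono[OF bd abs_ge_zero, of y 2] by simp
  have f2int: "integrable (gaussian t) (\<lambda>z. (f (x'' + z))\<^sup>2)"
    using f2 by (intro integrable_heat[OF t, where B = "B\<^sup>2" and f = "\<lambda>y. (f y)\<^sup>2"]) auto
  have int: "integrable (gaussian t) (\<lambda>z. f (x'' + z) * s z)"
    if s: "integrable (gaussian t) (\<lambda>z. (s z)\<^sup>2)" and [measurable]: "s \<in> borel_measurable borel" for s
    by (intro integrable_mult_of_squares f2int s) measurable
  have sqle: "(r z - r' z)\<^sup>2 \<le> (r z)\<^sup>2 + (r' z)\<^sup>2" for z
    using mult_pos_pos[OF pos, of z z] by (simp add: power2_diff mult.commute)
  have dint: "integrable (gaussian t) (\<lambda>z. (r z - r' z)\<^sup>2)"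
    by (rule Bochner_Integration.integrable_bound[OF Bochner_Integration.integrable_add[OF r2(1) r'2(1)]])
       (use sqle in \<open>auto intro!: AE_I2 simp: abs_of_nonneg\<close>)
  have "heat t f x - heat t f x' = (\<integral>z. f (x'' + z) * (r z - r' z) \<partial>gaussian t)"
    unfolding heat_eq_shift_density[OF t assms(2), of x x''] heat_eq_shift_density[OF t assms(2), of x' x'']
    using int[OF r2(1)] int[OF r'2(1)]
    by (simp add: right_diff_distrib r_def[symmetric] r'_def[symmetric])
  also have "\<dots>\<^sup>2 \<le> (\<integral>z. (f (x'' + z))\<^sup>2 \<partial>gaussian t) * (\<integral>z. (r z - r' z)\<^sup>2 \<partial>gaussian t)"
    by (intro integral_Cauchy_Schwarz f2int dint) auto
  also have "\<dots> \<le> (\<integral>z. (f (x'' + z))\<^sup>2 \<partial>gaussian t) * (\<integral>z. (r z)\<^sup>2 + (r' z)\<^sup>2 \<partial>gaussian t)"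
    by (intro mult_left_mono integral_mono dint sqle integral_nonneg_AE) (use r2 r'2 in auto)
  also have "(\<integral>z. (r z)\<^sup>2 + (r' z)\<^sup>2 \<partial>gaussian t)
      = exp ((norm (x - x''))\<^sup>2 / t) + exp ((norm (x' - x''))\<^sup>2 / t)"
    using r2 r'2 by simp
  finally show ?thesis
    by (simp add: heat_def mult.commute)
qed

section \<open>Entropy and variance\<close>

text \<open>Young's inequality for the conjugate pair of entropy and exponential, in logarithmic form.\<close>

lemma Young_ln:
  fixes x y r :: real
  assumes "x \<ge> 0" "y > 0" "r > 0"
  shows "x * ln r \<le> x * ln (x / y) - x + y * r"
proof (cases "x = 0")
  case False
  then have x: "x > 0" using assms by simp
  have "ln (y * r / x) \<le> y * r / x - 1" using x assms by (intro ln_le_minus_one) auto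
  then have "x * ln (y * r / x) \<le> x * (y * r / x - 1)" using x by (intro mult_left_mono) auto
  also have "\<dots> = y * r - x" using x by (simp add: field_simps)
  also have "ln (y * r / x) = ln r - ln (x / y)" using x assms by (simp add: ln_div ln_mult)
  finally show ?thesis by (simp add: algebra_simps)
qed (use assms in auto)

text \<open>For \<open>u\<close> of mean \<open>0\<close> and variance \<open>s\<close>, the expectation of the right-hand side is the entropy of \<open>u\<^sup>2\<close>
  plus \<open>4 * s\<close>, since the terms linear in \<open>u\<close> drop out; that of the left-hand side is the entropy of
  \<open>(1 + u)\<^sup>2\<close>. For \<open>u \<ge> - 1 / 2\<close>, split \<open>(1 + u)\<^sup>2 = (1 + 2 * u) + u\<^sup>2\<close> and use \<open>ln (1 + u) \<le> u\<close> for the first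
  summand and Young's inequality for the second one. For \<open>u < - 1 / 2\<close> the factor \<open>1 + 2 * u\<close> is
  negative and the logarithm has a pole at \<open>- 1\<close>, so \<open>(1 + u)\<^sup>2\<close> is not split. There
  \<open>ln (1 + u) \<le> u\<close> suffices down to \<open>- 1\<close>, and \<open>\<bar>1 + u\<bar> < \<bar>u\<bar>\<close> below, with the help of the
  term \<open>ln c\<close>.\<close>

lemma entropy_expansion_pointwise:
  fixes u s :: real
  assumes s: "s > 0"
  defines "c \<equiv> 1 + s"
  shows "(1 + u)\<^sup>2 * ln ((1 + u)\<^sup>2 / c)
    \<le> u\<^sup>2 * ln (u\<^sup>2 / s) + (1 + 2 * u) * (2 * u - ln c) + (s + 2 * u * s - u\<^sup>2) / c + ln c"
proof -
  have c: "c > 1" using s by (simp add: c_def)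
  have lnc: "ln c \<ge> 0" using c by simp
  define x where "x = s / c"
  have x: "0 < x" "x < 1" using s c by (auto simp: x_def c_def)
  have x1: "1 / c = 1 - x" using c by (simp add: x_def c_def field_simps)
  have r: "(s + 2 * u * s - u\<^sup>2) / c = x * (1 + u)\<^sup>2 - u\<^sup>2"
    using c by (simp add: x_def c_def field_simps power2_eq_square)
  have lnx: "ln c \<ge> x"
  proof -
    have "ln (1 / c) \<le> 1 / c - 1" using c by (intro ln_le_minus_one) auto
    moreover have "ln (1 / c) = - ln c" using c by (subst ln_div) auto
    ultimately show ?thesis using x1 by simp
  qed
  consider "u \<ge> - 1/2" | "-1 \<le> u" "u < - 1/2" | "u < -1" by linarith
  then show ?thesis
  proof cases
    case 1
    define l where "l = ln ((1 + u)\<^sup>2 / c)"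
    have l: "l \<le> 2 * u - ln c"
      using 1 c ln_add_one_self_le_self2[of u] by (simp add: l_def ln_div ln_realpow)
    have "u\<^sup>2 * l \<le> u\<^sup>2 * ln (u\<^sup>2 / s) - u\<^sup>2 + s * ((1 + u)\<^sup>2 / c)"
      unfolding l_def using 1 s c by (intro Young_ln) auto
    moreover have "(1 + 2 * u) * l \<le> (1 + 2 * u) * (2 * u - ln c)"
      using 1 l by (intro mult_left_mono) auto
    moreover have "(1 + u)\<^sup>2 * l = (1 + 2 * u) * l + u\<^sup>2 * l"
      by (simp add: power2_eq_square algebra_simps)
    ultimately show ?thesis using lnc unfolding r l_def[symmetric] by (simp add: x_def)
  next
    case 2
    define v where "v = - u"
    have v: "1/2 < v" "v \<le> 1" and u: "u = - v" using 2 by (auto simp: v_def)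
    have main: "(1 - v)\<^sup>2 * ln ((1 - v)\<^sup>2) \<le> (1 - v)\<^sup>2 * (- 2 * v)"
    proof (cases "v = 1")
      case False
      then have "ln (1 - v) \<le> - v" using v ln_le_minus_one[of "1 - v"] by simp
      then show ?thesis using v False by (intro mult_left_mono) (auto simp: ln_realpow)
    qed auto
    have "v\<^sup>2 * ln 1 \<le> v\<^sup>2 * ln (v\<^sup>2 / x) - v\<^sup>2 + x * 1"
      using x by (intro Young_ln) auto
    then have Y: "v\<^sup>2 - x \<le> v\<^sup>2 * ln (v\<^sup>2 / x)" by simp
    have "v\<^sup>2 * ln (v\<^sup>2 / x) = v\<^sup>2 * ln (v\<^sup>2 / s) + v\<^sup>2 * ln c"
      using v s c by (simp add: x_def ln_div ln_mult algebra_simps)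
    with Y have Y': "v\<^sup>2 - x \<le> v\<^sup>2 * ln (v\<^sup>2 / s) + v\<^sup>2 * ln c" by simp
    have "(1 - v)\<^sup>2 * ln ((1 - v)\<^sup>2 / c) = (1 - v)\<^sup>2 * ln ((1 - v)\<^sup>2) - (1 - v)\<^sup>2 * ln c"
      using c by (cases "v = 1") (auto simp: ln_div algebra_simps)
    moreover have "0 \<le> x * (1 - v)\<^sup>2 + 2 * v ^ 3"
      using x v by (intro add_nonneg_nonneg mult_nonneg_nonneg) auto
    moreover have "(1 - v)\<^sup>2 * (- 2 * v) = - 2 * v + 4 * v\<^sup>2 - 2 * v ^ 3"
      by (simp add: power2_eq_square power3_eq_cube algebra_simps)
    moreover have "(1 - v)\<^sup>2 * ln c = ln c - 2 * v * ln c + v\<^sup>2 * ln c"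
      by (simp add: power2_eq_square algebra_simps)
    moreover have "(1 - 2 * v) * (- 2 * v - ln c) = - 2 * v + 4 * v\<^sup>2 - ln c + 2 * v * ln c"
      by (simp add: power2_eq_square algebra_simps)
    ultimately have "(1 - v)\<^sup>2 * ln ((1 - v)\<^sup>2 / c)
        \<le> v\<^sup>2 * ln (v\<^sup>2 / s) + (1 - 2 * v) * (- 2 * v - ln c) + (x * (1 - v)\<^sup>2 - v\<^sup>2) + ln c"
      using main Y' lnx by linarith
    then show ?thesis unfolding r by (simp add: u)
  next
    case 3
    define v where "v = - u"
    have v: "1 < v" and u: "u = - v" using 3 by (auto simp: v_def)
    have main: "(1 - v)\<^sup>2 * ln ((1 - v)\<^sup>2) \<le> v\<^sup>2 * ln (v\<^sup>2)"
    proof (cases "(1 - v)\<^sup>2 \<le> 1")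
      case True
      then have "ln ((1 - v)\<^sup>2) \<le> 0" using v by (simp add: ln_le_zero_iff)
      then have "(1 - v)\<^sup>2 * ln ((1 - v)\<^sup>2) \<le> 0" by (intro mult_nonneg_nonpos) auto
      also have "0 \<le> v\<^sup>2 * ln (v\<^sup>2)" using v by simp
      finally show ?thesis .
    next
      case False
      have "(1 - v)\<^sup>2 \<le> v\<^sup>2" using v by (simp add: power2_eq_square algebra_simps)
      then show ?thesis using v False by (intro mult_mono) auto
    qed
    have "(1 - v)\<^sup>2 * ln ((1 - v)\<^sup>2 / c) = (1 - v)\<^sup>2 * ln ((1 - v)\<^sup>2) - (1 - v)\<^sup>2 * ln c"
      using c v by (simp add: ln_div algebra_simps)
    moreover have "(1 - v)\<^sup>2 * ln c = ln c - 2 * v * ln c + v\<^sup>2 * ln c"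
      by (simp add: power2_eq_square algebra_simps)
    moreover have "v\<^sup>2 * ln (v\<^sup>2) \<le> v\<^sup>2 * ln (v\<^sup>2 / x)"
      using x v by (intro mult_left_mono ln_mono) (auto simp: field_simps)
    moreover have "v\<^sup>2 * ln (v\<^sup>2 / x) = v\<^sup>2 * ln (v\<^sup>2 / s) + v\<^sup>2 * ln c"
      using v s c by (simp add: x_def ln_div ln_mult algebra_simps)
    moreover have "0 \<le> x * (1 - v)\<^sup>2" using x by simp
    moreover have "0 \<le> 3 * v\<^sup>2 - 2 * v" using v by (simp add: power2_eq_square)
    moreover have "(1 - 2 * v) * (- 2 * v - ln c) = - 2 * v + 4 * v\<^sup>2 - ln c + 2 * v * ln c"
      by (simp add: power2_eq_square algebra_simps)
    ultimately have "(1 - v)\<^sup>2 * ln ((1 - v)\<^sup>2 / c)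
        \<le> v\<^sup>2 * ln (v\<^sup>2 / s) + (1 - 2 * v) * (- 2 * v - ln c) + (x * (1 - v)\<^sup>2 - v\<^sup>2) + ln c"
      using main lnc by linarith
    then show ?thesis unfolding r by (simp add: u)
  qed
qed

lemma integral_ln_relative:
  fixes h :: "'a \<Rightarrow> real"
  assumes "integrable M h" "integrable M (\<lambda>x. h x * ln (h x))" "k > 0"
    and "\<And>x. h x \<ge> 0"
  shows "(\<integral>x. h x * ln (h x / k) \<partial>M) = (\<integral>x. h x * ln (h x) \<partial>M) - (\<integral>x. h x \<partial>M) * ln k"
    and "integrable M (\<lambda>x. h x * ln (h x / k))"
proof -
  have eq: "h x * ln (h x / k) = h x * ln (h x) - h x * ln k" for x
  proof (cases "h x = 0")
    case False
    then have "ln (h x / k) = ln (h x) - ln k"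
      using assms(3) assms(4)[of x] by (intro ln_divide_pos) auto
    then show ?thesis by (simp add: right_diff_distrib)
  qed simp
  show "(\<integral>x. h x * ln (h x / k) \<partial>M) = (\<integral>x. h x * ln (h x) \<partial>M) - (\<integral>x. h x \<partial>M) * ln k"
    unfolding eq using assms by simp
  show "integrable M (\<lambda>x. h x * ln (h x / k))"
    unfolding eq using assms by simp
qed

context prob_space
begin

lemma integrable_x_ln_x:
  fixes h :: "'a \<Rightarrow> real"
  assumes [measurable]: "h \<in> borel_measurable M" and bd: "\<And>x. 0 \<le> h x" "\<And>x. h x \<le> B"
  shows "integrable M (\<lambda>x. h x * ln (h x))"
proof (intro integrable_const_bound[where B = "1 + B\<^sup>2"])
  show "AE x in M. norm (h x * ln (h x)) \<le> 1 + B\<^sup>2"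
    unfolding real_norm_def by (intro AE_I2 abs_x_ln_x_le bd)
qed measurable

text \<open>Rothaus' lemma with the constant \<open>4\<close> in place of the optimal \<open>2\<close>, which makes an elementary
  pointwise proof possible. The pointwise inequality is applied to \<open>u = (f - m) / m\<close>, where \<open>m\<close> is the
  mean of \<open>f\<close>.\<close>

lemma entropy_square_le_centered:
  assumes [measurable]: "f \<in> borel_measurable M" and bd: "\<And>x. \<bar>f x\<bar> \<le> B"
  shows "ent_of M (\<lambda>x. (f x)\<^sup>2) \<le> ent_of M (\<lambda>x. (f x - expectation f)\<^sup>2) + 4 * var_of M f"
proof -
  define m where "m = expectation f"
  define g where "g x = f x - m" for x
  define S where "S = expectation (\<lambda>x. (g x)\<^sup>2)"
  have [measurable]: "g \<in> borel_measurable M" unfolding g_def by measurable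
  define B' where "B' = \<bar>B\<bar> + \<bar>m\<bar>"
  have gb: "\<bar>g x\<bar> \<le> B'" for x using bd[of x] by (simp add: g_def B'_def)
  have intf: "integrable M f" using bd by (intro integrable_const_bound[where B = B]) auto
  have intg: "integrable M g" "expectation g = 0"
    unfolding g_def using intf by (auto simp: prob_space m_def)
  have g2b: "(g x)\<^sup>2 \<le> B'\<^sup>2" for x using power_mono[OF gb abs_ge_zero, of x 2] by simp
  have f2b: "(f x)\<^sup>2 \<le> B\<^sup>2" for x using power_mono[OF bd abs_ge_zero, of x 2] by simp
  have intg2: "integrable M (\<lambda>x. (g x)\<^sup>2)"
    using g2b by (intro integrable_const_bound[where B = "B'\<^sup>2"]) auto
  have intf2: "integrable M (\<lambda>x. (f x)\<^sup>2)"
    using f2b by (intro integrable_const_bound[where B = "B\<^sup>2"]) auto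
  have entg: "integrable M (\<lambda>x. (g x)\<^sup>2 * ln ((g x)\<^sup>2))"
    using g2b by (intro integrable_x_ln_x[where B = "B'\<^sup>2"]) auto
  have entf: "integrable M (\<lambda>x. (f x)\<^sup>2 * ln ((f x)\<^sup>2))"
    using f2b by (intro integrable_x_ln_x[where B = "B\<^sup>2"]) auto
  have f2: "expectation (\<lambda>x. (f x)\<^sup>2) = m\<^sup>2 + S"
  proof -
    have "(f x)\<^sup>2 = m\<^sup>2 + 2 * m * g x + (g x)\<^sup>2" for x by (simp add: g_def power2_eq_square algebra_simps)
    then show ?thesis using intg intg2 by (simp add: prob_space S_def)
  qed
  have S0: "S \<ge> 0" unfolding S_def by (rule integral_nonneg_AE) simp
  have "ent_of M (\<lambda>x. (f x)\<^sup>2) \<le> ent_of M (\<lambda>x. (g x)\<^sup>2) + 4 * S"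
  proof (cases "m = 0 \<or> S = 0")
    case True
    then show ?thesis
    proof
      assume "m = 0"
      then show ?thesis using S0 by (simp add: g_def)
    next
      assume S: "S = 0"
      then have "AE x in M. (g x)\<^sup>2 = 0"
        using integral_nonneg_eq_0_iff_AE[OF intg2] unfolding S_def by simp
      then have ae: "AE x in M. f x = m" by eventually_elim (simp add: g_def)
      have "expectation (\<lambda>x. (f x)\<^sup>2 * ln ((f x)\<^sup>2)) = expectation (\<lambda>x. m\<^sup>2 * ln (m\<^sup>2))"
        using ae by (intro integral_cong_AE) (auto elim: eventually_mono)
      moreover have "expectation (\<lambda>x. (g x)\<^sup>2 * ln ((g x)\<^sup>2)) = expectation (\<lambda>x. 0)"
        using ae by (intro integral_cong_AE) (auto elim: eventually_mono simp: g_def)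
      ultimately show ?thesis
        using S f2 unfolding ent_of_def S_def[symmetric] by (simp add: prob_space)
    qed
  next
    case False
    then have m: "m \<noteq> 0" and S: "S > 0" using S0 by auto
    define s where "s = S / m\<^sup>2"
    have s: "s > 0" using m S by (simp add: s_def)
    have pw: "(f x)\<^sup>2 * ln ((f x)\<^sup>2 / (m\<^sup>2 + S)) \<le> (g x)\<^sup>2 * ln ((g x)\<^sup>2 / S)
       + (2 * m - 2 * m * ln (1 + s) + 2 * m * s / (1 + s)) * g x
       + (4 - 1 / (1 + s)) * (g x)\<^sup>2 + m\<^sup>2 * s / (1 + s)" for x
    proof -
      define u where "u = g x / m"
      have fu: "f x = m * (1 + u)" using m by (simp add: u_def g_def field_simps)
      have gu: "g x = m * u" using m by (simp add: u_def)
      have mS: "m\<^sup>2 + S = m\<^sup>2 * (1 + s)" "S = m\<^sup>2 * s" using m by (auto simp: s_def field_simps)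
      have "(f x)\<^sup>2 * ln ((f x)\<^sup>2 / (m\<^sup>2 + S)) = m\<^sup>2 * ((1 + u)\<^sup>2 * ln ((1 + u)\<^sup>2 / (1 + s)))"
        unfolding fu mS(1) using m by (simp add: power_mult_distrib)
      also have "\<dots> \<le> m\<^sup>2 * (u\<^sup>2 * ln (u\<^sup>2 / s) + (1 + 2 * u) * (2 * u - ln (1 + s))
          + (s + 2 * u * s - u\<^sup>2) / (1 + s) + ln (1 + s))"
        by (intro mult_left_mono entropy_expansion_pointwise s) auto
      also have "\<dots> = (g x)\<^sup>2 * ln ((g x)\<^sup>2 / S)
       + (2 * m - 2 * m * ln (1 + s) + 2 * m * s / (1 + s)) * g x
       + (4 - 1 / (1 + s)) * (g x)\<^sup>2 + m\<^sup>2 * s / (1 + s)"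
      proof -
        have "(g x)\<^sup>2 * ln ((g x)\<^sup>2 / S) = m\<^sup>2 * (u\<^sup>2 * ln (u\<^sup>2 / s))"
          unfolding gu mS(2) using m by (simp add: power_mult_distrib)
        moreover have "(s + 2 * u * s - u\<^sup>2) / (1 + s) = s / (1 + s) + 2 * u * (s / (1 + s)) - u\<^sup>2 * (1 / (1 + s))"
          by (simp add: add_divide_distrib diff_divide_distrib)
        moreover have "m\<^sup>2 * (A + (1 + 2 * u) * (2 * u - L) + (p + 2 * u * p - u\<^sup>2 * k) + L)
            = m\<^sup>2 * A + (2 * m - 2 * m * L + 2 * m * p) * (m * u) + (4 - k) * (m * u)\<^sup>2 + m\<^sup>2 * p" for A L p k
          by (simp add: power2_eq_square algebra_simps)
        ultimately show ?thesis unfolding gu by (simp only: times_divide_eq_right[symmetric])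
      qed
      finally show ?thesis .
    qed
    note relf = integral_ln_relative[OF intf2 entf, of "m\<^sup>2 + S"]
    note relg = integral_ln_relative[OF intg2 entg, of S]
    have mS: "m\<^sup>2 + S > 0" using S by (simp add: add_nonneg_pos)
    have "ent_of M (\<lambda>x. (f x)\<^sup>2) = expectation (\<lambda>x. (f x)\<^sup>2 * ln ((f x)\<^sup>2 / (m\<^sup>2 + S)))"
      using relf(1)[OF mS] by (simp add: ent_of_def f2)
    also have "\<dots> \<le> expectation (\<lambda>x. (g x)\<^sup>2 * ln ((g x)\<^sup>2 / S)
       + (2 * m - 2 * m * ln (1 + s) + 2 * m * s / (1 + s)) * g x
       + (4 - 1 / (1 + s)) * (g x)\<^sup>2 + m\<^sup>2 * s / (1 + s))"
      using relf(2)[OF mS] relg(2)[OF S] intg intg2 by (intro integral_mono pw) auto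
    also have "\<dots> = expectation (\<lambda>x. (g x)\<^sup>2 * ln ((g x)\<^sup>2 / S)) + (4 - 1 / (1 + s)) * S + m\<^sup>2 * s / (1 + s)"
      using relg(2)[OF S] intg intg2 by (simp add: prob_space S_def)
    also have "m\<^sup>2 * s / (1 + s) = 1 / (1 + s) * S" using m by (simp add: s_def)
    also have "expectation (\<lambda>x. (g x)\<^sup>2 * ln ((g x)\<^sup>2 / S)) = ent_of M (\<lambda>x. (g x)\<^sup>2)"
      using relg(1)[OF S] by (simp add: ent_of_def S_def)
    finally show ?thesis by (simp add: algebra_simps)
  qed
  then show ?thesis by (simp add: S_def g_def m_def var_of_def)
qed

end

section \<open>Regularity of bounded smooth functions\<close>

lemma frechet_derivative_eq_grad:
  fixes f :: "real^'n::finite \<Rightarrow> real"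
  assumes "f differentiable (at x)"
  shows "frechet_derivative f (at x) = (\<lambda>v. grad f x \<bullet> v)"
proof
  fix v :: "real^'n"
  have lin: "linear (frechet_derivative f (at x))"
    using assms by (rule linear_frechet_derivative)
  have "frechet_derivative f (at x) v = frechet_derivative f (at x) (\<Sum>i\<in>UNIV. v $ i *\<^sub>R axis i 1)"
    using basis_expansion[of v] by (simp add: scalar_mult_eq_scaleR)
  also have "\<dots> = (\<Sum>i\<in>UNIV. v $ i * partial_deriv i f x)"
    using lin by (simp add: linear_sum linear_scale partial_deriv_def)
  finally show "frechet_derivative f (at x) v = grad f x \<bullet> v"
    by (simp add: inner_vec_def grad_def mult.commute)
qed

lemma has_derivative_grad:
  fixes f :: "real^'n::finite \<Rightarrow> real"
  assumes "f differentiable (at x)"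
  shows "(f has_derivative (\<lambda>v. grad f x \<bullet> v)) (at x)"
  using assms frechet_derivative_eq_grad[OF assms] by (metis frechet_derivative_works)

lemma onorm_inner_le: "onorm (\<lambda>v. a \<bullet> v) \<le> norm (a :: 'a::real_inner)"
  by (rule onorm_bound) (auto simp: Cauchy_Schwarz_ineq2)

lemma norm_vec_le_sum_bound:
  fixes v :: "real^'n::finite"
  assumes "\<And>i. \<bar>v $ i\<bar> \<le> b i"
  shows "norm v \<le> (\<Sum>i\<in>UNIV. b i)"
proof -
  have "norm v \<le> (\<Sum>i\<in>UNIV. \<bar>v $ i\<bar>)" by (rule norm_le_l1_cart)
  also have "\<dots> \<le> (\<Sum>i\<in>UNIV. b i)" using assms by (intro sum_mono) auto
  finally show ?thesis .
qed

lemma Lipschitz_of_bounded_grad: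
  fixes f :: "real^'n::finite \<Rightarrow> real"
  assumes d: "\<And>x. f differentiable (at x)" and b: "\<And>x. norm (grad f x) \<le> L"
  shows "\<bar>f y - f x\<bar> \<le> L * norm (y - x)"
proof -
  have "norm (f y - f x) \<le> L * norm (y - x)"
  proof (rule differentiable_bound[where S = UNIV and f' = "\<lambda>x v. grad f x \<bullet> v"])
    show "(f has_derivative (\<lambda>v. grad f x \<bullet> v)) (at x within UNIV)" for x
      using has_derivative_grad[OF d] by simp
    show "onorm (\<lambda>v. grad f x \<bullet> v) \<le> L" for x
      using order_trans[OF onorm_inner_le b] .
  qed auto
  then show ?thesis by simp
qed

lemma Taylor_of_Lipschitz_grad:
  fixes f :: "real^'n::finite \<Rightarrow> real"
  assumes d: "\<And>x. f differentiable (at x)"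
    and lip: "\<And>x y. norm (grad f y - grad f x) \<le> M * norm (y - x)"
  shows "\<bar>f y - f x - grad f x \<bullet> (y - x)\<bar> \<le> M * (norm (y - x))\<^sup>2"
proof -
  define g where "g z = f z - grad f x \<bullet> z" for z
  have M: "M * norm (z - x) \<le> M * norm (y - x)" if "z \<in> closed_segment x y" for z
  proof (cases "x = y")
    case False
    have "0 \<le> M * norm (y - x)" using lip[of y x] norm_ge_zero order_trans by blast
    then have "M \<ge> 0" using False by (simp add: zero_le_mult_iff)
    moreover have "norm (z - x) \<le> norm (y - x)"
      using segment_bound(1)[OF that] by (simp add: norm_minus_commute)
    ultimately show ?thesis by (rule mult_left_mono[rotated])
  qed (use that in auto)
  have "norm (g y - g x) \<le> (M * norm (y - x)) * norm (y - x)"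
  proof (rule differentiable_bound[where S = "closed_segment x y" and f' = "\<lambda>z v. (grad f z - grad f x) \<bullet> v"])
    fix z assume z: "z \<in> closed_segment x y"
    have "(g has_derivative (\<lambda>v. grad f z \<bullet> v - grad f x \<bullet> v)) (at z)"
      unfolding g_def by (intro has_derivative_diff has_derivative_grad[OF d]
          bounded_linear_imp_has_derivative bounded_linear_inner_right)
    then show "(g has_derivative (\<lambda>v. (grad f z - grad f x) \<bullet> v)) (at z within closed_segment x y)"
      by (simp add: inner_diff_left has_derivative_at_withinI)
    show "onorm (\<lambda>v. (grad f z - grad f x) \<bullet> v) \<le> M * norm (y - x)"
      using onorm_inner_le[of "grad f z - grad f x"] lip[of z x] M[OF z] by linarith
  qed auto
  then show ?thesis by (simp add: g_def inner_diff_right power2_eq_square algebra_simps)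
qed

lemma Cb_infty_iter_partial:
  assumes "f \<in> Cb_infty"
  shows "iter_partial is f differentiable (at x)" "\<exists>B. \<forall>x. \<bar>iter_partial is f x\<bar> \<le> B"
proof -
  show "iter_partial is f differentiable (at x)" using assms by (simp add: Cb_infty_def)
  have "bounded (range (iter_partial is f))" using assms by (simp add: Cb_infty_def)
  then show "\<exists>B. \<forall>x. \<bar>iter_partial is f x\<bar> \<le> B" by (auto simp: bounded_iff)
qed

text \<open>The bounds on the first partial derivatives bound the gradient, and those on the second ones
  make it Lipschitz.\<close>

lemma Cb_infty_C11:
  fixes f :: "real^'n::finite \<Rightarrow> real"
  assumes f: "f \<in> Cb_infty"
  shows "\<exists>L M. C11 L M f (grad f)" and "\<exists>B. \<forall>x. \<bar>f x\<bar> \<le> B"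
proof -
  show "\<exists>B. \<forall>x. \<bar>f x\<bar> \<le> B" using Cb_infty_iter_partial(2)[OF f, of "[]"] by simp
  have grad_bounded: "\<exists>L. \<forall>x. norm (grad (iter_partial is f) x) \<le> L" for "is"
  proof -
    have "\<forall>i. \<exists>B. \<forall>x. \<bar>iter_partial (i # is) f x\<bar> \<le> B"
      using Cb_infty_iter_partial(2)[OF f] by blast
    then obtain B where B: "\<And>i x. \<bar>iter_partial (i # is) f x\<bar> \<le> B i" by metis
    have "norm (grad (iter_partial is f) x) \<le> (\<Sum>i\<in>UNIV. B i)" for x
      using B by (intro norm_vec_le_sum_bound) (simp add: grad_def)
    then show ?thesis by blast
  qed
  obtain L where L: "\<And>x. norm (grad f x) \<le> L" using grad_bounded[of "[]"] by auto
  have "\<forall>i. \<exists>M. \<forall>x. norm (grad (iter_partial [i] f) x) \<le> M"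
    using grad_bounded by blast
  then obtain m where m: "\<And>i x. norm (grad (partial_deriv i f) x) \<le> m i"
    by (simp, metis)
  define M where "M = (\<Sum>i\<in>UNIV. m i)"
  have lip: "norm (grad f y - grad f x) \<le> M * norm (y - x)" for x y
  proof -
    have "\<bar>partial_deriv i f y - partial_deriv i f x\<bar> \<le> m i * norm (y - x)" for i
      using Cb_infty_iter_partial(1)[OF f, of "[i]"] m
      by (intro Lipschitz_of_bounded_grad) auto
    then have "norm (grad f y - grad f x) \<le> (\<Sum>i\<in>UNIV. m i * norm (y - x))"
      by (intro norm_vec_le_sum_bound) (simp add: grad_def)
    then show ?thesis by (simp add: M_def sum_distrib_right)
  qed
  have d: "f differentiable (at x)" for x
    using Cb_infty_iter_partial(1)[OF f, of "[]"] by simp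
  have "C11 L M f (grad f)"
    unfolding C11_def
    using L lip Lipschitz_of_bounded_grad[OF d L] Taylor_of_Lipschitz_grad[OF d lip] by blast
  then show "\<exists>L M. C11 L M f (grad f)" by blast
qed

lemma C11_diff_const:
  assumes "C11 L M f F"
  shows "C11 L M (\<lambda>x. f x - c) F"
  using assms by (simp add: C11_def)

section \<open>Cauchy--Schwarz and Jensen inequalities for averages\<close>

context prob_space
begin

text \<open>A number that is at most \<open>sqrt (a x) * sqrt (b x)\<close> for all \<open>x\<close> is at most the mean of this product.
  This averages a comparison of Gaussian means over the centre of comparison.\<close>

lemma power2_le_integral_mult_integral:
  fixes a b :: "'a \<Rightarrow> real"
  assumes a: "integrable M a" and b: "integrable M b"
    and nonneg: "\<And>x. a x \<ge> 0" "\<And>x. b x \<ge> 0" and le: "\<And>x. d\<^sup>2 \<le> a x * b x"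
  shows "d\<^sup>2 \<le> (\<integral>x. a x \<partial>M) * (\<integral>x. b x \<partial>M)"
proof -
  have [measurable]: "a \<in> borel_measurable M" "b \<in> borel_measurable M" using a b by auto
  have sq: "integrable M (\<lambda>x. (sqrt (a x))\<^sup>2)" "integrable M (\<lambda>x. (sqrt (b x))\<^sup>2)"
    using a b nonneg by simp_all
  have "\<bar>d\<bar> = (\<integral>x. \<bar>d\<bar> \<partial>M)" by (simp add: prob_space)
  also have "\<dots> \<le> (\<integral>x. sqrt (a x) * sqrt (b x) \<partial>M)"
  proof (rule integral_mono)
    show "integrable M (\<lambda>x. sqrt (a x) * sqrt (b x))"
      by (rule integrable_mult_of_squares[OF sq]) measurable
    show "\<bar>d\<bar> \<le> sqrt (a x) * sqrt (b x)" for x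
      using real_sqrt_le_mono[OF le[of x]] by (simp add: real_sqrt_mult)
  qed simp
  finally have "\<bar>d\<bar>\<^sup>2 \<le> (\<integral>x. sqrt (a x) * sqrt (b x) \<partial>M)\<^sup>2" by (rule power_mono) simp
  also have "\<dots> \<le> (\<integral>x. (sqrt (a x))\<^sup>2 \<partial>M) * (\<integral>x. (sqrt (b x))\<^sup>2 \<partial>M)"
    by (rule integral_Cauchy_Schwarz[OF sq]) measurable
  finally show ?thesis using nonneg by simp
qed

text \<open>Jensen's inequality for the logarithm under the probability density \<open>f\<^sup>2 / g\<close>, applied to the
  function \<open>1 / \<bar>f\<bar>\<close>, whose mean under this density is \<open>m / g\<close>.\<close>

lemma ln_moment_ratio_le_entropy:
  fixes f :: "'a \<Rightarrow> real"
  assumes [measurable]: "f \<in> borel_measurable M" and bd: "\<And>x. \<bar>f x\<bar> \<le> B"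
    and g: "g = (\<integral>x. (f x)\<^sup>2 \<partial>M)" "g > 0" and m: "m = (\<integral>x. \<bar>f x\<bar> \<partial>M)"
  shows "m > 0" and "g * ln (g / m\<^sup>2) \<le> ent_of M (\<lambda>x. (f x)\<^sup>2)"
proof -
  have f2b: "(f x)\<^sup>2 \<le> B\<^sup>2" for x using power_mono[OF bd abs_ge_zero, of x 2] by simp
  have intf: "integrable M (\<lambda>x. \<bar>f x\<bar>)"
    using bd by (intro integrable_const_bound[where B = B]) auto
  have intf2: "integrable M (\<lambda>x. (f x)\<^sup>2)"
    using f2b by (intro integrable_const_bound[where B = "B\<^sup>2"]) auto
  have entf: "integrable M (\<lambda>x. (f x)\<^sup>2 * ln ((f x)\<^sup>2))"
    using f2b by (intro integrable_x_ln_x[where B = "B\<^sup>2"]) auto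
  have "m \<ge> 0" unfolding m by (rule integral_nonneg_AE) simp
  moreover have "m \<noteq> 0"
  proof
    assume "m = 0"
    then have "AE x in M. \<bar>f x\<bar> = 0"
      using integral_nonneg_eq_0_iff_AE[OF intf] unfolding m by simp
    then have "g = (\<integral>x. 0 \<partial>M)" unfolding g(1) by (intro integral_cong_AE) auto
    with g(2) show False by simp
  qed
  ultimately show m0: "m > 0" by simp
  have pw: "(f x)\<^sup>2 * (2 * ln (g / m)) - (f x)\<^sup>2 * ln ((f x)\<^sup>2) \<le> 2 * (g / m) * \<bar>f x\<bar> - 2 * (f x)\<^sup>2" for x
  proof (cases "f x = 0")
    case False
    define y where "y = \<bar>f x\<bar>"
    have y: "y > 0" and fy: "(f x)\<^sup>2 = y\<^sup>2" using False by (auto simp: y_def)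
    have "ln (g / m / y) \<le> g / m / y - 1" using g m0 y by (intro ln_le_minus_one) auto
    then have "2 * y\<^sup>2 * ln (g / m / y) \<le> 2 * y\<^sup>2 * (g / m / y - 1)" by (intro mult_left_mono) auto
    also have "\<dots> = 2 * (g / m) * y - 2 * y\<^sup>2" using y by (simp add: field_simps power2_eq_square)
    also have "ln (g / m / y) = ln (g / m) - ln y" using g m0 y by (intro ln_divide_pos) auto
    finally show ?thesis unfolding fy y_def[symmetric] using y by (simp add: ln_realpow algebra_simps)
  qed simp
  have "g * (2 * ln (g / m)) - (\<integral>x. (f x)\<^sup>2 * ln ((f x)\<^sup>2) \<partial>M)
      = (\<integral>x. (f x)\<^sup>2 * (2 * ln (g / m)) - (f x)\<^sup>2 * ln ((f x)\<^sup>2) \<partial>M)"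
    using intf2 entf by (simp add: g(1))
  also have "\<dots> \<le> (\<integral>x. 2 * (g / m) * \<bar>f x\<bar> - 2 * (f x)\<^sup>2 \<partial>M)"
    using intf intf2 entf by (intro integral_mono pw) auto
  also have "\<dots> = 2 * (g / m) * m - 2 * g"
    using intf intf2 by (simp add: g(1) m)
  also have "\<dots> = 0" using m0 by simp
  finally have "g * (2 * ln (g / m)) \<le> (\<integral>x. (f x)\<^sup>2 * ln ((f x)\<^sup>2) \<partial>M)" by simp
  moreover have "g * (2 * ln (g / m)) = g * ln (g / m\<^sup>2) + g * ln g"
  proof -
    have "2 * ln (g / m) = ln (g / m\<^sup>2) + ln g"
      using g m0 by (simp add: ln_divide_pos ln_realpow)
    then show ?thesis by (simp only: distrib_left)
  qed
  ultimately show "g * ln (g / m\<^sup>2) \<le> ent_of M (\<lambda>x. (f x)\<^sup>2)"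
    by (simp add: ent_of_def g(1)[symmetric])
qed

end

section \<open>Gaussian mixtures with sub-Gaussian mixing measure\<close>

locale subgaussian_mixture = prob_space \<mu>
  for \<mu> :: "(real^'n::finite) measure" +
  fixes s t C :: real
  assumes sets_mu [measurable_cong]: "sets \<mu> = sets borel"
    and s: "s > 0" and st: "s < t"
    and subgaussian: "(\<integral>\<^sup>+x. (\<integral>\<^sup>+y. ennreal (exp ((norm (x - y))\<^sup>2 / s)) \<partial>\<mu>) \<partial>\<mu>) \<le> ennreal C"
begin

lemma t: "t > 0" using s st by simp

definition W :: "real^'n \<Rightarrow> real^'n \<Rightarrow> real" where
  "W x y = exp ((norm (x - y))\<^sup>2 / s)"

definition w :: "real^'n \<Rightarrow> real^'n \<Rightarrow> real" where
  "w x y = exp ((norm (x - y))\<^sup>2 / t)"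

definition W_mean :: "real^'n \<Rightarrow> real" where
  "W_mean x = (\<integral>y. W x y \<partial>\<mu>)"

definition w_mean :: "real^'n \<Rightarrow> real" where
  "w_mean x = (\<integral>y. w x y \<partial>\<mu>)"

text \<open>The reciprocal of the exponent \<open>t / s\<close> in which the weight \<open>w\<close> is integrable.\<close>

definition \<theta> :: real where "\<theta> = s / t"

lemma \<theta>: "0 < \<theta>" "\<theta> < 1" using s st by (auto simp: \<theta>_def)

lemma measurable_weights [measurable]:
  "(\<lambda>y. W x y) \<in> borel_measurable borel" "(\<lambda>y. w x y) \<in> borel_measurable borel"
  "W_mean \<in> borel_measurable borel" "w_mean \<in> borel_measurable borel"
  unfolding W_def w_def W_mean_def w_mean_def by measurable

lemma W_ge_1: "1 \<le> W x y"
  using s by (simp add: W_def)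

lemma w_eq_exp: "w x y = exp (\<theta> * ((norm (x - y))\<^sup>2 / s))"
  using s by (simp add: w_def \<theta>_def)

lemma w_le_W: "w x y \<le> W x y"
  using s st by (auto simp: w_def W_def intro!: divide_left_mono)

lemma AE_integrable_W: "AE x in \<mu>. integrable \<mu> (W x)"
proof -
  have "(\<integral>\<^sup>+x. (\<integral>\<^sup>+y. ennreal (W x y) \<partial>\<mu>) \<partial>\<mu>) < \<infinity>"
    using subgaussian by (simp add: W_def le_less_trans[OF _ ennreal_less_top])
  then have "AE x in \<mu>. (\<integral>\<^sup>+y. ennreal (W x y) \<partial>\<mu>) \<noteq> \<infinity>"
    unfolding W_def by (intro nn_integral_PInf_AE) auto
  then show ?thesis
  proof eventually_elim
    case (elim x)
    then show ?case
      using W_ge_1[of x] by (intro integrableI_nonneg AE_I2) (auto simp: less_top intro: order_trans[OF zero_le_one])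
  qed
qed

lemma integrable_w:
  assumes "integrable \<mu> (W x)"
  shows "integrable \<mu> (w x)"
proof (rule Bochner_Integration.integrable_bound[OF assms])
  have "norm (w x y) \<le> norm (W x y)" for y
    using w_le_W[of x y] by (simp add: w_def W_def)
  then show "AE y in \<mu>. norm (w x y) \<le> norm (W x y)" by simp
qed measurable

lemma W_mean_ge_1:
  assumes "integrable \<mu> (W x)"
  shows "1 \<le> W_mean x"
proof -
  have "(\<integral>y. 1 \<partial>\<mu>) \<le> W_mean x"
    unfolding W_mean_def using assms W_ge_1 by (intro integral_mono) auto
  then show ?thesis by (simp add: prob_space)
qed

lemma nn_integral_W_mean: "(\<integral>\<^sup>+x. ennreal (W_mean x) \<partial>\<mu>) \<le> ennreal C"
proof -
  have "(\<integral>\<^sup>+x. ennreal (W_mean x) \<partial>\<mu>) = (\<integral>\<^sup>+x. (\<integral>\<^sup>+y. ennreal (W x y) \<partial>\<mu>) \<partial>\<mu>)"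
  proof (rule nn_integral_cong_AE)
    show "AE x in \<mu>. ennreal (W_mean x) = (\<integral>\<^sup>+y. ennreal (W x y) \<partial>\<mu>)"
      using AE_integrable_W
    proof eventually_elim
      case (elim x)
      then show ?case unfolding W_mean_def
        using W_ge_1[of x] by (intro nn_integral_eq_integral[symmetric] AE_I2) (auto intro: order_trans[OF zero_le_one])
    qed
  qed
  then show ?thesis using subgaussian by (simp add: W_def)
qed

lemma AE_W_mean_ge_1: "AE x in \<mu>. 1 \<le> W_mean x"
  using AE_integrable_W by eventually_elim (rule W_mean_ge_1)

lemma integrable_W_mean: "integrable \<mu> W_mean"
proof (rule integrableI_nonneg)
  show "AE x in \<mu>. 0 \<le> W_mean x" using AE_W_mean_ge_1 by eventually_elim simp
  show "(\<integral>\<^sup>+x. ennreal (W_mean x) \<partial>\<mu>) < \<infinity>"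
    using nn_integral_W_mean by (simp add: le_less_trans[OF _ ennreal_less_top])
qed measurable

lemma C_bounds: "1 \<le> C" "(\<integral>x. W_mean x \<partial>\<mu>) \<le> C"
proof -
  have 1: "1 \<le> (\<integral>x. W_mean x \<partial>\<mu>)"
  proof -
    have "(\<integral>x. 1 \<partial>\<mu>) \<le> (\<integral>x. W_mean x \<partial>\<mu>)"
      by (intro integral_mono_AE integrable_W_mean AE_W_mean_ge_1) simp
    then show ?thesis by (simp add: prob_space)
  qed
  have "ennreal (\<integral>x. W_mean x \<partial>\<mu>) = (\<integral>\<^sup>+x. ennreal (W_mean x) \<partial>\<mu>)"
    using AE_W_mean_ge_1
    by (intro nn_integral_eq_integral[symmetric] integrable_W_mean) (auto elim: eventually_mono)
  with nn_integral_W_mean have le: "ennreal (\<integral>x. W_mean x \<partial>\<mu>) \<le> ennreal C" by simp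
  show "(\<integral>x. W_mean x \<partial>\<mu>) \<le> C"
  proof (cases "C \<ge> 0")
    case True
    then show ?thesis using le by simp
  next
    case False
    then have "ennreal C = 0" by (simp add: ennreal_neg)
    with le 1 show ?thesis by (simp add: ennreal_eq_0_iff)
  qed
  with 1 show "1 \<le> C" by simp
qed

text \<open>Jensen's inequality for the power \<open>1 / \<theta>\<close>, which turns \<open>w\<close> into \<open>W\<close>.\<close>

lemma w_mean_le:
  assumes int: "integrable \<mu> (W x)"
  shows "w_mean x \<le> exp (\<theta> * ln (W_mean x))"
proof -
  define l where "l = ln (W_mean x)"
  have K: "exp l = W_mean x" using W_mean_ge_1[OF int] by (simp add: l_def)
  have pw: "w x y \<le> exp (\<theta> * l) * (\<theta> * (W x y * exp (- l)) + (1 - \<theta>))" for y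
  proof -
    define a where "a = (norm (x - y))\<^sup>2 / s - l"
    have "exp (\<theta> * a) \<le> \<theta> * exp a + (1 - \<theta>)"
      using convex_onD[OF exp_convex, of "\<theta>" 0 a] \<theta> by simp
    then have "exp (\<theta> * l) * exp (\<theta> * a) \<le> exp (\<theta> * l) * (\<theta> * exp a + (1 - \<theta>))"
      by (intro mult_left_mono) auto
    moreover have "exp (\<theta> * l) * exp (\<theta> * a) = w x y"
      unfolding w_eq_exp mult_exp_exp by (simp add: a_def algebra_simps)
    moreover have "exp a = W x y * exp (- l)"
      unfolding W_def mult_exp_exp by (simp add: a_def)
    ultimately show ?thesis by simp
  qed
  have "w_mean x \<le> (\<integral>y. exp (\<theta> * l) * (\<theta> * (W x y * exp (- l)) + (1 - \<theta>)) \<partial>\<mu>)"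
    unfolding w_mean_def using int integrable_w[OF int] by (intro integral_mono pw) auto
  also have "\<dots> = exp (\<theta> * l) * (\<theta> * (W_mean x * exp (- l)) + (1 - \<theta>))"
    unfolding W_mean_def using int by (simp add: prob_space)
  also have "\<dots> = exp (\<theta> * l)" unfolding K[symmetric] by (simp add: mult_exp_exp)
  finally show ?thesis by (simp add: l_def)
qed

text \<open>Young's inequality for \<open>exp ((1 - \<theta>) * a) * exp (\<theta> * b)\<close>, averaged over the second factor. It
  brings the product of two weights with different arguments back to the integrable weight \<open>W\<close>.\<close>

lemma exp_mult_w_mean_le:
  assumes int: "integrable \<mu> (W x)"
  shows "exp ((1 - \<theta>) * a) * w_mean x \<le> (1 - \<theta>) * exp a + \<theta> * W_mean x"
proof -
  have pw: "exp ((1 - \<theta>) * a) * w x z \<le> (1 - \<theta>) * exp a + \<theta> * W x z" for z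
    using convex_onD[OF exp_convex, of \<theta> a "(norm (x - z))\<^sup>2 / s"] \<theta>
    by (simp add: w_eq_exp W_def mult_exp_exp)
  have "exp ((1 - \<theta>) * a) * w_mean x = (\<integral>z. exp ((1 - \<theta>) * a) * w x z \<partial>\<mu>)"
    by (simp add: w_mean_def)
  also have "\<dots> \<le> (\<integral>z. (1 - \<theta>) * exp a + \<theta> * W x z \<partial>\<mu>)"
    using int integrable_w[OF int] by (intro integral_mono pw) auto
  also have "\<dots> = (1 - \<theta>) * exp a + \<theta> * W_mean x"
    using int by (simp add: W_mean_def prob_space)
  finally show ?thesis .
qed

definition \<alpha> :: real where "\<alpha> = C powr (s / (t - s))"

lemma \<alpha>_ge_1: "\<alpha> \<ge> 1"
  unfolding \<alpha>_def using C_bounds(1) s st by (intro ge_one_powr_ge_zero) auto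

text \<open>Geometric interpolation between two bounds for \<open>D\<close>, linearised by Young's inequality. The
  parameter in Young's inequality is chosen such that the weight disappears from the first term, at
  the price of a power of the weight in the second one. The choice of \<open>\<alpha>\<close> makes the factor of that
  power equal to \<open>1 / C\<close>.\<close>

lemma interpolate_bounds:
  assumes D: "D \<le> w x y * v" "D \<le> b" and D0: "D \<ge> 0"
  shows "D \<le> (1 - \<theta>) * (\<alpha> * v) + \<theta> * (exp ((1 - \<theta>) * ((norm (x - y))\<^sup>2 / s)) / C * b)"
proof -
  define r where "r = (norm (x - y))\<^sup>2 / s"
  define l where "l = ln C / (1 / \<theta> - 1)"
  define q where "q = \<theta> * r - l"
  have C: "C > 0" using C_bounds by simp
  have p: "1 / \<theta> - 1 > 0" using \<theta> by simp
  have expl: "exp l = \<alpha>"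
  proof -
    have "s / (t - s) = 1 / (1 / \<theta> - 1)" using s st by (simp add: \<theta>_def field_simps)
    then show ?thesis using C by (simp add: \<alpha>_def l_def powr_def)
  qed
  \<comment> \<open>The weighted inequality between the arithmetic and the geometric mean, for numbers whose
    geometric mean is \<open>1\<close>.\<close>
  have 1: "1 \<le> (1 - \<theta>) * exp (- q) + \<theta> * exp ((1 / \<theta> - 1) * q)"
  proof -
    have "(1 - \<theta>) * (1 + (- q)) + \<theta> * (1 + (1 / \<theta> - 1) * q)
        \<le> (1 - \<theta>) * exp (- q) + \<theta> * exp ((1 / \<theta> - 1) * q)"
      using \<theta> by (intro add_mono mult_left_mono exp_ge_add_one_self) auto
    also have "(1 - \<theta>) * (1 + (- q)) + \<theta> * (1 + (1 / \<theta> - 1) * q) = 1"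
      using \<theta> by (simp add: field_simps)
    finally show ?thesis .
  qed
  have e1: "exp (- q) * w x y = \<alpha>"
    unfolding w_eq_exp mult_exp_exp expl[symmetric] by (simp add: q_def r_def)
  have e2: "exp ((1 / \<theta> - 1) * q) = exp ((1 - \<theta>) * r) / C"
  proof -
    have "(1 / \<theta> - 1) * l = ln C" using p by (simp only: l_def times_divide_eq_right nonzero_mult_div_cancel_left)
    moreover have "(1 / \<theta> - 1) * (\<theta> * r) = (1 - \<theta>) * r" using \<theta> by (simp add: field_simps)
    ultimately have "(1 / \<theta> - 1) * q = (1 - \<theta>) * r - ln C" by (simp add: q_def right_diff_distrib)
    then show ?thesis using C by (simp add: exp_diff)
  qed
  have "D = 1 * D" by simp
  also have "\<dots> \<le> ((1 - \<theta>) * exp (- q) + \<theta> * exp ((1 / \<theta> - 1) * q)) * D"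
    using 1 D0 by (rule mult_right_mono)
  also have "\<dots> = (1 - \<theta>) * (exp (- q) * D) + \<theta> * (exp ((1 / \<theta> - 1) * q) * D)"
    by (simp add: algebra_simps)
  also have "\<dots> \<le> (1 - \<theta>) * (exp (- q) * (w x y * v)) + \<theta> * (exp ((1 / \<theta> - 1) * q) * b)"
    using D \<theta> by (intro add_mono mult_left_mono) auto
  also have "exp (- q) * (w x y * v) = \<alpha> * v" by (simp only: mult.assoc[symmetric] e1)
  finally show ?thesis unfolding e2 r_def .
qed

lemma integrable_bounded:
  fixes h :: "real^'n \<Rightarrow> real"
  assumes [measurable]: "h \<in> borel_measurable borel" and "\<And>x. \<bar>h x\<bar> \<le> b"
  shows "integrable \<mu> h"
  using assms(2) by (intro integrable_const_bound[where B = b]) auto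

lemma integral_mixture:
  fixes h :: "real^'n \<Rightarrow> real"
  assumes [measurable]: "h \<in> borel_measurable borel" and bd: "\<And>x. \<bar>h x\<bar> \<le> b"
  shows "(\<integral>x. h x \<partial>(\<mu> \<star> gaussian t)) = (\<integral>x. heat t h x \<partial>\<mu>)"
  unfolding heat_def
  by (rule integral_convolution[OF prob_space_axioms prob_space_gaussian[OF t] sets_mu sets_gaussian _ bd])
     measurable

text \<open>For independent \<open>x\<close> and \<open>y\<close> drawn from \<open>\<mu>\<close>, the mean of \<open>(G x - G y)\<^sup>2\<close> is twice the variance of the
  conditional means \<open>G\<close>. The interpolated bound, integrated, controls it by the mean of \<open>v\<close> and the
  fraction \<open>\<theta>\<close> of the total variance, which is absorbed on the left.\<close>

lemma centered_mixture_variance_le: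
  fixes f :: "real^'n \<Rightarrow> real"
  assumes f[measurable]: "f \<in> borel_measurable borel" and bd: "\<And>x. \<bar>f x\<bar> \<le> B"
    and mean0: "(\<integral>x. heat t f x \<partial>\<mu>) = 0"
  defines "v \<equiv> \<lambda>x. heat t (\<lambda>y. (f y)\<^sup>2) x - (heat t f x)\<^sup>2"
  shows "(\<integral>x. heat t (\<lambda>y. (f y)\<^sup>2) x \<partial>\<mu>) \<le> (t / (t - s) + \<alpha> / 2) * (\<integral>x. v x \<partial>\<mu>)"
proof -
  define G where "G = heat t f"
  define H where "H = heat t (\<lambda>y. (f y)\<^sup>2)"
  have [measurable]: "G \<in> borel_measurable borel" "H \<in> borel_measurable borel"
    unfolding G_def H_def by (intro borel_measurable_heat t; measurable)+
  have v_eq: "v x = H x - (G x)\<^sup>2" for x by (simp add: v_def G_def H_def)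
  have [measurable]: "v \<in> borel_measurable borel" unfolding v_eq[abs_def] by measurable
  have f2b: "\<bar>(f x)\<^sup>2\<bar> \<le> B\<^sup>2" for x using power_mono[OF bd abs_ge_zero, of x 2] by simp
  have Gb: "\<bar>G x\<bar> \<le> B" for x using norm_heat_le[OF t f, of B x] bd by (simp add: G_def)
  have Hb: "\<bar>H x\<bar> \<le> B\<^sup>2" for x
    using norm_heat_le[OF t, of "\<lambda>y. (f y)\<^sup>2" "B\<^sup>2" x] f2b by (simp add: H_def)
  have H0: "0 \<le> H x" for x unfolding H_def heat_def by (rule integral_nonneg_AE) simp
  have G2b: "\<bar>(G x)\<^sup>2\<bar> \<le> B\<^sup>2" for x using power_mono[OF Gb abs_ge_zero, of x 2] by simp
  have intG: "integrable \<mu> G" by (rule integrable_bounded[OF _ Gb]) measurable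
  have intH: "integrable \<mu> H" by (rule integrable_bounded[OF _ Hb]) measurable
  have intG2: "integrable \<mu> (\<lambda>x. (G x)\<^sup>2)" by (rule integrable_bounded[OF _ G2b]) measurable
  have intv: "integrable \<mu> v" unfolding v_eq[abs_def] using intH intG2 by simp
  define V where "V = (\<integral>x. H x \<partial>\<mu>)"
  define Ev where "Ev = (\<integral>x. v x \<partial>\<mu>)"
  define Q where "Q = (\<integral>x. (G x)\<^sup>2 \<partial>\<mu>)"
  have VQ: "V = Ev + Q" unfolding V_def Ev_def Q_def v_eq[abs_def] using intH intG2 by simp
  have V0: "V \<ge> 0" unfolding V_def using H0 by (intro integral_nonneg_AE) auto
  have A: "(G x - G y)\<^sup>2 \<le> w x y * v y" for x y
  proof -
    interpret N: prob_space "gaussian t :: (real^'n) measure" by (rule prob_space_gaussian[OF t])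
    have int: "integrable (gaussian t) (\<lambda>z. f (x + z))" "integrable (gaussian t) (\<lambda>z. (f (x + z))\<^sup>2)" for x
      using integrable_heat[OF t, of f B x] integrable_heat[OF t, of "\<lambda>x. (f x)\<^sup>2" "B\<^sup>2" x] bd f2b by auto
    have cb: "\<bar>f z - G y\<bar> \<le> B + \<bar>G y\<bar>" for z using bd[of z] by linarith
    have "heat t (\<lambda>z. f z - G y) x = G x - G y"
      using int by (simp add: heat_def G_def t)
    moreover have "heat t (\<lambda>z. (f z - G y)\<^sup>2) y = v y"
    proof -
      have "heat t (\<lambda>z. (f z - G y)\<^sup>2) y = heat t (\<lambda>y. (f y)\<^sup>2) y - 2 * G y * heat t f y + (G y)\<^sup>2"
        using int[of y] by (simp add: heat_def power2_diff t)
      also have "\<dots> = H y - 2 * G y * G y + (G y)\<^sup>2" by (simp only: G_def H_def)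
      finally show ?thesis by (simp add: v_eq power2_eq_square)
    qed
    ultimately show ?thesis
      using heat_square_comparison[OF t, of "\<lambda>z. f z - G y" "B + \<bar>G y\<bar>" x y] cb by (simp add: w_def)
  qed
  have B': "(G x - G y)\<^sup>2 \<le> (w_mean x + w_mean y) * V"
    if x: "integrable \<mu> (W x)" and y: "integrable \<mu> (W y)" for x y
  proof -
    have "(G x - G y)\<^sup>2 \<le> (\<integral>z. w x z + w y z \<partial>\<mu>) * (\<integral>z. H z \<partial>\<mu>)"
    proof (rule power2_le_integral_mult_integral)
      show "integrable \<mu> (\<lambda>z. w x z + w y z)" using integrable_w[OF x] integrable_w[OF y] by simp
      show "(G x - G y)\<^sup>2 \<le> (w x z + w y z) * H z" for z
        using heat_difference_comparison[OF t f bd, of x y z] by (simp add: G_def H_def w_def)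
    qed (use intH H0 in \<open>auto simp: w_def\<close>)
    also have "(\<integral>z. w x z + w y z \<partial>\<mu>) = w_mean x + w_mean y"
      unfolding w_mean_def using integrable_w[OF x] integrable_w[OF y] by simp
    finally show ?thesis by (simp add: V_def)
  qed
  have pw: "(G x - G y)\<^sup>2 \<le> (1 - \<theta>) * \<alpha> * v y
      + \<theta> / C * V * (2 * (1 - \<theta>) * W x y + \<theta> * W_mean x + \<theta> * W_mean y)"
    if x: "integrable \<mu> (W x)" and y: "integrable \<mu> (W y)" for x y
  proof -
    define Z where "Z = exp ((1 - \<theta>) * ((norm (x - y))\<^sup>2 / s))"
    have C: "C > 0" using C_bounds by simp
    have "(G x - G y)\<^sup>2 \<le> (1 - \<theta>) * (\<alpha> * v y) + \<theta> * (Z / C * ((w_mean x + w_mean y) * V))"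
      unfolding Z_def by (rule interpolate_bounds[OF A B'[OF x y]]) simp
    also have "Z / C * ((w_mean x + w_mean y) * V) = V / C * (Z * w_mean x + Z * w_mean y)"
      by (simp add: algebra_simps)
    also have "\<theta> * (V / C * (Z * w_mean x + Z * w_mean y))
        \<le> \<theta> * (V / C * (((1 - \<theta>) * W x y + \<theta> * W_mean x) + ((1 - \<theta>) * W x y + \<theta> * W_mean y)))"
      unfolding Z_def W_def using \<theta> V0 C
      by (intro mult_left_mono add_mono exp_mult_w_mean_le x y) auto
    finally show ?thesis by (simp add: algebra_simps)
  qed
  have inner: "(G x)\<^sup>2 + Q \<le> (1 - \<theta>) * \<alpha> * Ev
      + \<theta> / C * V * ((2 - \<theta>) * W_mean x + \<theta> * (\<integral>y. W_mean y \<partial>\<mu>))"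
    if x: "integrable \<mu> (W x)" for x
  proof -
    have "(G x)\<^sup>2 + Q = (\<integral>y. (G x)\<^sup>2 - 2 * G x * G y + (G y)\<^sup>2 \<partial>\<mu>)"
      using intG intG2 mean0 by (simp add: prob_space Q_def G_def[symmetric])
    also have "\<dots> = (\<integral>y. (G x - G y)\<^sup>2 \<partial>\<mu>)" by (simp add: power2_diff algebra_simps)
    also have "\<dots> \<le> (\<integral>y. (1 - \<theta>) * \<alpha> * v y
      + \<theta> / C * V * (2 * (1 - \<theta>) * W x y + \<theta> * W_mean x + \<theta> * W_mean y) \<partial>\<mu>)"
    proof (rule integral_mono_AE)
      show "integrable \<mu> (\<lambda>y. (G x - G y)\<^sup>2)"
        unfolding power2_diff using intG intG2 by simp
      show "AE y in \<mu>. (G x - G y)\<^sup>2 \<le> (1 - \<theta>) * \<alpha> * v y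
        + \<theta> / C * V * (2 * (1 - \<theta>) * W x y + \<theta> * W_mean x + \<theta> * W_mean y)"
        using AE_integrable_W by eventually_elim (rule pw[OF x])
    qed (use x intv integrable_W_mean in simp)
    also have "\<dots> = (1 - \<theta>) * \<alpha> * Ev
      + \<theta> / C * V * (2 * (1 - \<theta>) * W_mean x + \<theta> * W_mean x + \<theta> * (\<integral>y. W_mean y \<partial>\<mu>))"
      using x intv integrable_W_mean by (simp add: Ev_def W_mean_def[symmetric] prob_space)
    finally show ?thesis by (simp add: algebra_simps)
  qed
  have "2 * Q = (\<integral>x. (G x)\<^sup>2 + Q \<partial>\<mu>)" using intG2 by (simp add: Q_def prob_space)
  also have "\<dots> \<le> (\<integral>x. (1 - \<theta>) * \<alpha> * Ev
      + \<theta> / C * V * ((2 - \<theta>) * W_mean x + \<theta> * (\<integral>y. W_mean y \<partial>\<mu>)) \<partial>\<mu>)"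
  proof (rule integral_mono_AE)
    show "AE x in \<mu>. (G x)\<^sup>2 + Q \<le> (1 - \<theta>) * \<alpha> * Ev
      + \<theta> / C * V * ((2 - \<theta>) * W_mean x + \<theta> * (\<integral>y. W_mean y \<partial>\<mu>))"
      using AE_integrable_W by eventually_elim (rule inner)
  qed (use intG2 integrable_W_mean in simp_all)
  also have "\<dots> = (1 - \<theta>) * \<alpha> * Ev
      + \<theta> / C * V * ((2 - \<theta>) * (\<integral>y. W_mean y \<partial>\<mu>) + \<theta> * (\<integral>y. W_mean y \<partial>\<mu>))"
    using integrable_W_mean by (simp add: prob_space)
  also have "\<dots> = (1 - \<theta>) * \<alpha> * Ev + \<theta> / C * V * (2 * (\<integral>y. W_mean y \<partial>\<mu>))"
    by (simp add: algebra_simps)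
  also have "\<dots> \<le> (1 - \<theta>) * \<alpha> * Ev + \<theta> / C * V * (2 * C)"
    using \<theta> C_bounds V0 by (intro add_left_mono mult_left_mono) auto
  also have "\<theta> / C * V * (2 * C) = 2 * (\<theta> * V)" using C_bounds by simp
  finally have "2 * Q \<le> (1 - \<theta>) * \<alpha> * Ev + 2 * (\<theta> * V)" .
  moreover have "(1 - \<theta>) * ((1 / (1 - \<theta>) + \<alpha> / 2) * Ev) = Ev + (1 - \<theta>) * \<alpha> * Ev / 2"
  proof -
    have "(1 - \<theta>) * ((k + \<alpha> / 2) * Ev) = ((1 - \<theta>) * k) * Ev + (1 - \<theta>) * \<alpha> * Ev / 2" for k
      by (simp add: algebra_simps)
    then show ?thesis using \<theta> by simp
  qed
  moreover have "(1 - \<theta>) * V = V - \<theta> * V" by (simp add: algebra_simps)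
  ultimately have "(1 - \<theta>) * V \<le> (1 - \<theta>) * ((1 / (1 - \<theta>) + \<alpha> / 2) * Ev)"
    using VQ by linarith
  then have "V \<le> (1 / (1 - \<theta>) + \<alpha> / 2) * Ev" using \<theta> by simp
  moreover have "1 / (1 - \<theta>) = t / (t - s)" using s st by (simp add: \<theta>_def field_simps)
  ultimately show ?thesis by (simp add: V_def Ev_def H_def)
qed

lemma integrable_heat_bounded:
  fixes h :: "real^'n \<Rightarrow> real"
  assumes [measurable]: "h \<in> borel_measurable borel" and bd: "\<And>x. \<bar>h x\<bar> \<le> b"
  shows "integrable \<mu> (heat t h)"
proof (rule integrable_bounded)
  show "heat t h \<in> borel_measurable borel" by (rule borel_measurable_heat[OF t]) measurable
  show "\<bar>heat t h x\<bar> \<le> b" for x using norm_heat_le[OF t, of h b x] bd by simp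
qed

text \<open>The entropy splits into the mean of the conditional entropies, which the Gaussian inequality
  bounds, and the entropy of the conditional second moments \<open>g\<close>. By comparison of \<open>\<bar>f\<bar>\<close> at different
  centres, the ratio of \<open>g x\<close> to its mean is at most a power of \<open>W_mean x\<close>, up to a factor that the
  conditional entropy controls. The term \<open>ln (W_mean x)\<close> is removed by Young's inequality, which
  produces only the fraction \<open>\<theta>\<close> of the entropy of \<open>g\<close>.\<close>

lemma mixture_entropy_le:
  fixes f :: "real^'n \<Rightarrow> real"
  assumes f: "C11 L M f F" and bd: "\<And>x. \<bar>f x\<bar> \<le> B"
  shows "ent_of (\<mu> \<star> gaussian t) (\<lambda>x. (f x)\<^sup>2)
    \<le> 2 * t * (1 + t / (t - s)) * (\<integral>x. (norm (F x))\<^sup>2 \<partial>(\<mu> \<star> gaussian t))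
      + s / (t - s) * ln C * (\<integral>x. (f x)\<^sup>2 \<partial>(\<mu> \<star> gaussian t))"
proof -
  note f'[measurable] = C11D(5,6)[OF f]
  define N where "N = heat t (\<lambda>x. (norm (F x))\<^sup>2)"
  define g where "g = heat t (\<lambda>x. (f x)\<^sup>2)"
  define e where "e = heat t (\<lambda>x. (f x)\<^sup>2 * ln ((f x)\<^sup>2))"
  have [measurable]: "g \<in> borel_measurable borel"
    unfolding g_def by (rule borel_measurable_heat[OF t]) measurable
  have f2: "0 \<le> (f x)\<^sup>2" "(f x)\<^sup>2 \<le> B\<^sup>2" for x
    using power_mono[OF bd abs_ge_zero, of x 2] by simp_all
  have f2b: "\<bar>(f x)\<^sup>2\<bar> \<le> B\<^sup>2" for x using f2[of x] by simp
  have F2b: "\<bar>(norm (F x))\<^sup>2\<bar> \<le> L\<^sup>2" for x using C11D(1)[OF f, of x] by (simp add: power_mono)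
  have entb: "\<bar>(f x)\<^sup>2 * ln ((f x)\<^sup>2)\<bar> \<le> 1 + (B\<^sup>2)\<^sup>2" for x by (rule abs_x_ln_x_le[OF f2])
  have intg: "integrable \<mu> g" unfolding g_def by (rule integrable_heat_bounded[OF _ f2b]) measurable
  have intN: "integrable \<mu> N" unfolding N_def by (rule integrable_heat_bounded[OF _ F2b]) measurable
  have inte: "integrable \<mu> e" unfolding e_def by (rule integrable_heat_bounded[OF _ entb]) measurable
  have g0: "0 \<le> g x" for x unfolding g_def heat_def by (rule integral_nonneg_AE) simp
  have N0: "0 \<le> N x" for x unfolding N_def heat_def by (rule integral_nonneg_AE) simp
  have gb: "g x \<le> B\<^sup>2" for x
    using norm_heat_le[OF t, of "\<lambda>y. (f y)\<^sup>2" "B\<^sup>2" x] f2b by (simp add: g_def)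
  define m where "m = (\<integral>x. g x \<partial>\<mu>)"
  define D where "D = (\<integral>x. N x \<partial>\<mu>)"
  have m0: "m \<ge> 0" unfolding m_def using g0 by (intro integral_nonneg_AE) auto
  have D0: "D \<ge> 0" unfolding D_def using N0 by (intro integral_nonneg_AE) auto
  have mix: "(\<integral>x. (f x)\<^sup>2 \<partial>(\<mu> \<star> gaussian t)) = m"
    "(\<integral>x. (norm (F x))\<^sup>2 \<partial>(\<mu> \<star> gaussian t)) = D"
    "(\<integral>x. (f x)\<^sup>2 * ln ((f x)\<^sup>2) \<partial>(\<mu> \<star> gaussian t)) = (\<integral>x. e x \<partial>\<mu>)"
    unfolding m_def D_def g_def N_def e_def
    by (rule integral_mixture[OF _ f2b] integral_mixture[OF _ F2b] integral_mixture[OF _ entb]; measurable)+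
  have lsi: "e x \<le> g x * ln (g x) + 2 * t * N x" for x
    unfolding e_def g_def N_def by (rule gaussian_log_sobolev[OF t f bd])
  have p: "1 / (1 - \<theta>) = t / (t - s)" "\<theta> / (1 - \<theta>) = s / (t - s)"
    using s st by (simp_all add: \<theta>_def field_simps)
  have lnC: "ln C \<ge> 0" using C_bounds by simp
  show ?thesis
  proof (cases "m = 0")
    case True
    then have "AE x in \<mu>. g x = 0"
      using integral_nonneg_eq_0_iff_AE[OF intg] g0 unfolding m_def by simp
    then have "AE x in \<mu>. e x \<le> 2 * t * N x"
    proof eventually_elim
      case (elim x)
      then show ?case using lsi[of x] by simp
    qed
    then have "(\<integral>x. e x \<partial>\<mu>) \<le> (\<integral>x. 2 * t * N x \<partial>\<mu>)"
      using inte intN by (intro integral_mono_AE) auto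
    also have "\<dots> = 2 * t * 1 * D" using intN by (simp add: D_def)
    also have "\<dots> \<le> 2 * t * (1 + t / (t - s)) * D"
      using s st D0 by (intro mult_right_mono mult_left_mono) auto
    finally show ?thesis unfolding ent_of_def mix True by simp
  next
    case False
    then have m: "m > 0" using m0 by simp
    define I where "I = (\<integral>x. g x * ln (g x / m) \<partial>\<mu>)"
    have intgl: "integrable \<mu> (\<lambda>x. g x * ln (g x))"
      using g0 gb by (intro integrable_x_ln_x[where B = "B\<^sup>2"]) auto
    have I_eq: "I = (\<integral>x. g x * ln (g x) \<partial>\<mu>) - m * ln m"
      unfolding I_def m_def[symmetric]
      using integral_ln_relative(1)[OF intg intgl m g0] by (simp add: m_def)
    have intI: "integrable \<mu> (\<lambda>x. g x * ln (g x / m))"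
      by (rule integral_ln_relative(2)[OF intg intgl m g0])
    have intlnW: "integrable \<mu> (\<lambda>x. g x * ln (W_mean x))"
    proof (rule Bochner_Integration.integrable_bound[of _ "\<lambda>x. B\<^sup>2 * W_mean x"])
      show "AE x in \<mu>. norm (g x * ln (W_mean x)) \<le> norm (B\<^sup>2 * W_mean x)"
        using AE_W_mean_ge_1
      proof eventually_elim
        case (elim x)
        have "g x * ln (W_mean x) \<le> B\<^sup>2 * W_mean x"
          using elim ln_le_minus_one[of "W_mean x"] g0[of x] gb[of x] by (intro mult_mono) auto
        then show ?case using elim g0[of x] by (simp add: abs_mult)
      qed
    qed (use integrable_W_mean in simp_all)
    have pw: "g x * ln (g x / m) \<le> 2 * t * N x + \<theta> * (g x * ln (W_mean x))"
      if x: "integrable \<mu> (W x)" for x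
    proof (cases "g x = 0")
      case True
      then show ?thesis using N0[of x] t by simp
    next
      case False
      then have gx: "g x > 0" using g0[of x] by simp
      interpret N: prob_space "gaussian t :: (real^'n) measure" by (rule prob_space_gaussian[OF t])
      define a where "a = heat t (\<lambda>y. \<bar>f y\<bar>) x"
      have a0: "a > 0" and ratio: "g x * ln (g x / a\<^sup>2) \<le> ent_of (gaussian t) (\<lambda>z. (f (x + z))\<^sup>2)"
        using N.ln_moment_ratio_le_entropy[of "\<lambda>z. f (x + z)" B "g x" a] gx bd
        by (simp_all add: a_def g_def heat_def)
      have "ent_of (gaussian t) (\<lambda>z. (f (x + z))\<^sup>2) = e x - g x * ln (g x)"
        by (simp add: ent_of_def e_def g_def heat_def)
      with ratio lsi[of x] have 1: "g x * ln (g x / a\<^sup>2) \<le> 2 * t * N x" by linarith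
      have "a\<^sup>2 \<le> (\<integral>y. w x y \<partial>\<mu>) * (\<integral>y. g y \<partial>\<mu>)"
      proof (rule power2_le_integral_mult_integral[OF integrable_w[OF x] intg])
        show "a\<^sup>2 \<le> w x y * g y" for y
          using heat_square_comparison[OF t, of "\<lambda>y. \<bar>f y\<bar>" B x y] bd by (simp add: a_def g_def w_def)
      qed (use g0 in \<open>auto simp: w_def\<close>)
      also have "\<dots> \<le> exp (\<theta> * ln (W_mean x)) * m"
        using w_mean_le[OF x] m0 by (simp add: w_mean_def m_def mult_right_mono)
      finally have "ln (a\<^sup>2) \<le> ln (exp (\<theta> * ln (W_mean x)) * m)"
        using a0 m by (intro ln_mono) auto
      also have "\<dots> = \<theta> * ln (W_mean x) + ln m" using m by (simp add: ln_mult_pos)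
      finally have "ln (g x / m) \<le> ln (g x / a\<^sup>2) + \<theta> * ln (W_mean x)"
        using gx m a0 by (simp add: ln_divide_pos)
      then have "g x * ln (g x / m) \<le> g x * (ln (g x / a\<^sup>2) + \<theta> * ln (W_mean x))"
        using gx by (intro mult_left_mono) auto
      with 1 show ?thesis by (simp add: algebra_simps)
    qed
    have "I \<le> (\<integral>x. 2 * t * N x + \<theta> * (g x * ln (W_mean x)) \<partial>\<mu>)"
      unfolding I_def
    proof (rule integral_mono_AE[OF intI])
      show "AE x in \<mu>. g x * ln (g x / m) \<le> 2 * t * N x + \<theta> * (g x * ln (W_mean x))"
        using AE_integrable_W by eventually_elim (rule pw)
    qed (use intN intlnW in simp)
    also have "\<dots> = 2 * t * D + \<theta> * (\<integral>x. g x * ln (W_mean x) \<partial>\<mu>)"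
      using intN intlnW by (simp add: D_def)
    also have "(\<integral>x. g x * ln (W_mean x) \<partial>\<mu>) \<le> I + m * ln C"
    proof -
      have C: "C > 0" using C_bounds by simp
      have "(\<integral>x. g x * ln (W_mean x) \<partial>\<mu>) \<le> (\<integral>x. g x * ln C + (g x * ln (g x / m) - g x + m * (W_mean x / C)) \<partial>\<mu>)"
      proof (rule integral_mono_AE[OF intlnW])
        show "AE x in \<mu>. g x * ln (W_mean x) \<le> g x * ln C + (g x * ln (g x / m) - g x + m * (W_mean x / C))"
          using AE_W_mean_ge_1
        proof eventually_elim
          case (elim x)
          have "g x * ln (W_mean x / C) \<le> g x * ln (g x / m) - g x + m * (W_mean x / C)"
            using elim C m g0 by (intro Young_ln) auto
          moreover have "ln (W_mean x / C) = ln (W_mean x) - ln C"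
            using elim C by (intro ln_divide_pos) auto
          ultimately show ?case by (simp add: algebra_simps)
        qed
      qed (use intg intI integrable_W_mean in simp)
      also have "\<dots> = m * ln C + (I - m + m * ((\<integral>x. W_mean x \<partial>\<mu>) / C))"
        using intg intI integrable_W_mean by (simp add: I_def m_def[symmetric])
      also have "m * ((\<integral>x. W_mean x \<partial>\<mu>) / C) \<le> m * 1"
        using C_bounds C m by (intro mult_left_mono) auto
      finally show ?thesis by simp
    qed
    finally have "I \<le> 2 * t * D + \<theta> * (I + m * ln C)" using \<theta> by simp
    then have "I * (1 - \<theta>) \<le> 2 * t * D + \<theta> * (m * ln C)"
      by (simp add: algebra_simps)
    then have "I \<le> (2 * t * D + \<theta> * (m * ln C)) / (1 - \<theta>)"
      using \<theta> by (simp add: pos_le_divide_eq)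
    then have I_le: "I \<le> 1 / (1 - \<theta>) * (2 * t * D) + \<theta> / (1 - \<theta>) * (m * ln C)"
      by (simp add: add_divide_distrib)
    have "(\<integral>x. e x \<partial>\<mu>) \<le> (\<integral>x. g x * ln (g x) + 2 * t * N x \<partial>\<mu>)"
      using inte intgl intN by (intro integral_mono lsi) auto
    also have "\<dots> = I + m * ln m + 2 * t * D"
      using intgl intN by (simp add: I_eq D_def)
    finally have "(\<integral>x. e x \<partial>\<mu>) - m * ln m
        \<le> (1 / (1 - \<theta>) * (2 * t * D) + \<theta> / (1 - \<theta>) * (m * ln C)) + 2 * t * D"
      using I_le by linarith
    then show ?thesis unfolding ent_of_def mix p by (simp add: algebra_simps)
  qed
qed

lemma mixture_poincare:
  fixes f :: "real^'n \<Rightarrow> real"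
  assumes f: "C11 L M f F" and bd: "\<And>x. \<bar>f x\<bar> \<le> B"
  shows "var_of (\<mu> \<star> gaussian t) f
    \<le> t * (t / (t - s) + \<alpha> / 2) * (\<integral>x. (norm (F x))\<^sup>2 \<partial>(\<mu> \<star> gaussian t))"
proof -
  define c where "c = (\<integral>x. f x \<partial>(\<mu> \<star> gaussian t))"
  define h where "h x = f x - c" for x
  have h: "C11 L M h F" unfolding h_def by (rule C11_diff_const[OF f])
  note [measurable] = C11D(5,6)[OF f] C11D(5)[OF h]
  have hb: "\<bar>h x\<bar> \<le> B + \<bar>c\<bar>" for x using bd[of x] by (simp add: h_def)
  have h2b: "\<bar>(h x)\<^sup>2\<bar> \<le> (B + \<bar>c\<bar>)\<^sup>2" for x using power_mono[OF hb abs_ge_zero, of x 2] by simp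
  have F2b: "\<bar>(norm (F x))\<^sup>2\<bar> \<le> L\<^sup>2" for x using C11D(1)[OF f, of x] by (simp add: power_mono)
  define v where "v x = heat t (\<lambda>y. (h y)\<^sup>2) x - (heat t h x)\<^sup>2" for x
  define N where "N = heat t (\<lambda>x. (norm (F x))\<^sup>2)"
  have hsh: "heat t h x = heat t f x - c" for x
  proof -
    interpret N: prob_space "gaussian t :: (real^'n) measure" by (rule prob_space_gaussian[OF t])
    show ?thesis using integrable_heat[OF t, of f B x] bd by (simp add: heat_def h_def t)
  qed
  have intf: "integrable \<mu> (heat t f)" by (rule integrable_heat_bounded[OF _ bd]) measurable
  have "(\<integral>x. heat t f x \<partial>\<mu>) = c"
    unfolding c_def by (rule integral_mixture[OF _ bd, symmetric]) measurable
  then have mean0: "(\<integral>x. heat t h x \<partial>\<mu>) = 0"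
    unfolding hsh using intf by (simp add: prob_space)
  have Hb: "integrable \<mu> (heat t (\<lambda>y. (h y)\<^sup>2))" by (rule integrable_heat_bounded[OF _ h2b]) measurable
  have hhb: "\<bar>(heat t h x)\<^sup>2\<bar> \<le> (B + \<bar>c\<bar>)\<^sup>2" for x
    using power_mono[of "\<bar>heat t h x\<bar>" "B + \<bar>c\<bar>" 2] norm_heat_le[OF t, of h "B + \<bar>c\<bar>" x] hb by simp
  have [measurable]: "heat t h \<in> borel_measurable borel" by (rule borel_measurable_heat[OF t]) measurable
  have intv: "integrable \<mu> v"
    unfolding v_def by (intro Bochner_Integration.integrable_diff Hb integrable_bounded[OF _ hhb]) measurable
  have intN: "integrable \<mu> N" unfolding N_def by (rule integrable_heat_bounded[OF _ F2b]) measurable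
  have "var_of (\<mu> \<star> gaussian t) f = (\<integral>x. heat t (\<lambda>y. (h y)\<^sup>2) x \<partial>\<mu>)"
    unfolding var_of_def c_def[symmetric] h_def[symmetric]
    by (rule integral_mixture[OF _ h2b]) measurable
  also have "\<dots> \<le> (t / (t - s) + \<alpha> / 2) * (\<integral>x. v x \<partial>\<mu>)"
    unfolding v_def by (rule centered_mixture_variance_le[OF _ hb mean0]) measurable
  also have "\<dots> \<le> (t / (t - s) + \<alpha> / 2) * (\<integral>x. t * N x \<partial>\<mu>)"
  proof (intro mult_left_mono integral_mono intv)
    show "v x \<le> t * N x" for x
      using gaussian_poincare[OF t h hb, of x] by (simp add: v_def N_def)
    show "0 \<le> t / (t - s) + \<alpha> / 2" using s st \<alpha>_ge_1 by (intro add_nonneg_nonneg) auto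
  qed (use intN in simp)
  also have "(\<integral>x. t * N x \<partial>\<mu>) = t * (\<integral>x. (norm (F x))\<^sup>2 \<partial>(\<mu> \<star> gaussian t))"
    unfolding N_def by (subst integral_mixture[OF _ F2b]) auto
  finally show ?thesis by (simp add: mult_ac)
qed

text \<open>The entropy bound is applied to the centred function, for which the mean of the square is the
  variance; the Poincare inequality then bounds all occurrences of the variance. The factor \<open>3\<close>
  leaves room for the constant in Rothaus' lemma.\<close>

lemma mixture_log_sobolev:
  fixes f :: "real^'n \<Rightarrow> real"
  assumes f: "C11 L M f F" and bd: "\<And>x. \<bar>f x\<bar> \<le> B"
  shows "ent_of (\<mu> \<star> gaussian t) (\<lambda>x. (f x)\<^sup>2)
    \<le> 2 * (3 * t * (t / (t - s) + \<alpha>) * (1 + s / (t - s) * ln C))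
      * (\<integral>x. (norm (F x))\<^sup>2 \<partial>(\<mu> \<star> gaussian t))"
proof -
  let ?R = "\<mu> \<star> gaussian t"
  interpret N: prob_space "gaussian t :: (real^'n) measure" by (rule prob_space_gaussian[OF t])
  interpret R: prob_space ?R
  proof -
    interpret P: pair_prob_space \<mu> "gaussian t :: (real^'n) measure" ..
    show "prob_space ?R" unfolding convolution_def by (rule P.prob_space_distr) measurable
  qed
  note [measurable] = C11D(5,6)[OF f]
  define c where "c = R.expectation f"
  define q where "q = t / (t - s)"
  define l where "l = s / (t - s) * ln C"
  define D where "D = (\<integral>x. (norm (F x))\<^sup>2 \<partial>?R)"
  have hb: "\<bar>f x - c\<bar> \<le> B + \<bar>c\<bar>" for x using bd[of x] by linarith
  have D0: "D \<ge> 0" unfolding D_def by (rule integral_nonneg_AE) simp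
  have q0: "q \<ge> 0" and l0: "l \<ge> 0" using s st C_bounds by (auto simp: q_def l_def)
  have V: "var_of ?R f \<le> t * (q + \<alpha> / 2) * D"
    unfolding D_def q_def by (rule mixture_poincare[OF f bd])
  have "ent_of ?R (\<lambda>x. (f x)\<^sup>2) \<le> ent_of ?R (\<lambda>x. (f x - c)\<^sup>2) + 4 * var_of ?R f"
    unfolding c_def by (rule R.entropy_square_le_centered[OF _ bd]) (simp add: convolution_def)
  also have "ent_of ?R (\<lambda>x. (f x - c)\<^sup>2) \<le> 2 * t * (1 + q) * D + l * var_of ?R f"
    using mixture_entropy_le[OF C11_diff_const[OF f] hb]
    by (simp add: q_def l_def D_def var_of_def c_def)
  finally have "ent_of ?R (\<lambda>x. (f x)\<^sup>2) \<le> 2 * t * (1 + q) * D + (4 + l) * var_of ?R f"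
    by (simp add: algebra_simps)
  also have "\<dots> \<le> 2 * t * (1 + q) * D + (4 + l) * (t * (q + \<alpha> / 2) * D)"
    using V l0 by (intro add_left_mono mult_left_mono) auto
  also have "\<dots> = 2 * t * D * ((1 + q) + (2 + l / 2) * (q + \<alpha> / 2))"
    by (simp add: algebra_simps)
  also have "\<dots> \<le> 2 * t * D * ((q + \<alpha>) + (2 + 3 * l) * (q + \<alpha>))"
  proof (rule mult_left_mono, rule add_mono)
    show "(2 + l / 2) * (q + \<alpha> / 2) \<le> (2 + 3 * l) * (q + \<alpha>)"
      using q0 l0 \<alpha>_ge_1 by (intro mult_mono) auto
    show "1 + q \<le> q + \<alpha>" using \<alpha>_ge_1 by simp
  qed (use t D0 in auto)
  also have "\<dots> \<le> 2 * (3 * t * (q + \<alpha>) * (1 + l)) * D"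
    by (simp add: algebra_simps)
  finally show ?thesis unfolding q_def l_def D_def .
qed

end

theorem theorem2:
  fixes \<mu> :: "(real^'d::finite) measure" and \<sigma> C_SG t :: real
  assumes "prob_space \<mu>" and "sets \<mu> = sets borel"
    and "\<sigma>\<^sup>2 > 0"
    and "(\<integral>\<^sup>+x. (\<integral>\<^sup>+x'. ennreal (exp ((norm (x - x'))\<^sup>2 / \<sigma>\<^sup>2)) \<partial>\<mu>) \<partial>\<mu>) \<le> ennreal C_SG"
    and "t > \<sigma>\<^sup>2"
  shows "satisfies_poincare (convolution \<mu> (gaussian t)) \<and>
    satisfies_log_sobolev (convolution \<mu> (gaussian t)) \<and>
    poincare_const (convolution \<mu> (gaussian t))
      \<le> ereal (t * (t / (t - \<sigma>\<^sup>2) + C_SG powr (\<sigma>\<^sup>2 / (t - \<sigma>\<^sup>2)))) \<and>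
    log_sobolev_const (convolution \<mu> (gaussian t))
      \<le> ereal (3 * t * (t / (t - \<sigma>\<^sup>2) + C_SG powr (\<sigma>\<^sup>2 / (t - \<sigma>\<^sup>2)))
                * (1 + \<sigma>\<^sup>2 / (t - \<sigma>\<^sup>2) * ln C_SG))"
proof -
  interpret subgaussian_mixture \<mu> "\<sigma>\<^sup>2" t C_SG
    using assms by (simp add: subgaussian_mixture_def subgaussian_mixture_axioms_def)
  let ?R = "\<mu> \<star> gaussian t"
  have "poincare_with ?R (t * (t / (t - \<sigma>\<^sup>2) + \<alpha>))"
    unfolding poincare_with_def
  proof
    fix f :: "real^'d \<Rightarrow> real" assume f: "f \<in> Cb_infty"
    obtain L M where LM: "C11 L M f (grad f)" using Cb_infty_C11(1)[OF f] by blast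
    obtain B where B: "\<And>x. \<bar>f x\<bar> \<le> B" using Cb_infty_C11(2)[OF f] by blast
    have "var_of ?R f \<le> t * (t / (t - \<sigma>\<^sup>2) + \<alpha> / 2) * (\<integral>x. (norm (grad f x))\<^sup>2 \<partial>?R)"
      by (rule mixture_poincare[OF LM B])
    also have "\<dots> \<le> t * (t / (t - \<sigma>\<^sup>2) + \<alpha>) * (\<integral>x. (norm (grad f x))\<^sup>2 \<partial>?R)"
      using t \<alpha>_ge_1 by (intro mult_right_mono mult_left_mono integral_nonneg_AE) auto
    finally show "var_of ?R f \<le> t * (t / (t - \<sigma>\<^sup>2) + \<alpha>) * (\<integral>x. (norm (grad f x))\<^sup>2 \<partial>?R)" .
  qed
  then have P: "poincare_const ?R \<le> ereal (t * (t / (t - \<sigma>\<^sup>2) + \<alpha>))"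
    by (simp add: poincare_const_le_iff)
  have "log_sobolev_with ?R (3 * t * (t / (t - \<sigma>\<^sup>2) + \<alpha>) * (1 + \<sigma>\<^sup>2 / (t - \<sigma>\<^sup>2) * ln C_SG))"
    unfolding log_sobolev_with_def
  proof
    fix f :: "real^'d \<Rightarrow> real" assume f: "f \<in> Cb_infty"
    obtain L M where LM: "C11 L M f (grad f)" using Cb_infty_C11(1)[OF f] by blast
    obtain B where B: "\<And>x. \<bar>f x\<bar> \<le> B" using Cb_infty_C11(2)[OF f] by blast
    show "ent_of ?R (\<lambda>x. (f x)\<^sup>2)
      \<le> 2 * (3 * t * (t / (t - \<sigma>\<^sup>2) + \<alpha>) * (1 + \<sigma>\<^sup>2 / (t - \<sigma>\<^sup>2) * ln C_SG))
        * (\<integral>x. (norm (grad f x))\<^sup>2 \<partial>?R)"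
      by (rule mixture_log_sobolev[OF LM B])
  qed
  then have LS: "log_sobolev_const ?R
      \<le> ereal (3 * t * (t / (t - \<sigma>\<^sup>2) + \<alpha>) * (1 + \<sigma>\<^sup>2 / (t - \<sigma>\<^sup>2) * ln C_SG))"
    by (simp add: log_sobolev_const_le_iff)
  have "satisfies_poincare ?R" "satisfies_log_sobolev ?R"
    unfolding satisfies_poincare_def satisfies_log_sobolev_def
    using P LS by (auto intro: le_less_trans)
  with P LS show ?thesis unfolding \<alpha>_def by blast
qed

end
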